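(* Assume $\phi\in C^{1,1}_{\mathrm{loc}}([0,\infty))$ is strictly increasing and that for every $c>0$ there is $\lambda=\lambda(c)>0$ such that $|\phi(s)-\phi(t)|\ge\lambda|s-t|$ for all $s,t\in[c,\mathrm{diam}(\mathrm{supp}\,\mu)]$. Assume that $\mu(B_\epsilon(x))=o(\epsilon)$ as $\epsilon\to0^+$ for each $x\in\mathbb{R}^d$. Let $\ell>0$. Then any minimizer $\Sigma\in\mathcal{S}_\ell$ of $\mathscr{J}$ over $\mathcal{S}_\ell$ has an atom, i.e. there is $\sigma\in\Sigma$ with $$\mu(\{x\in\mathbb{R}^d:\mathrm{dist}(x,\Sigma)=|x-\sigma|\})>0.$$
   Context: Fix an integer $d\ge 2$, a compactly supported Borel probability measure $\mu$ on $\mathbb{R}^d$, and a function $\phi:[0,\infty)\to\mathbb{R}$ with $\phi(0)=0$. $\phi\in C^{1,1}_{\mathrm{loc}}([0,\infty))$ means $\phi$ is $C^1$ on $[0,\infty)$ (up to $0$) with $\phi'$ locally Lipschitz on $[0,\infty)$. $B_\epsilon(x)$ is the Euclidean ball of radius $\epsilon$ about $x$. $\mathcal{S}_\ell$ is the set of nonempty compact connected $\Sigma\subseteq\mathbb{R}^d$ with Hausdorff $1$-measure $\mathcal{H}^1(\Sigma)\le\ell$. $\mathrm{dist}(x,\Sigma)=\inf_{\sigma\in\Sigma}|x-\sigma|$ and $\mathscr{J}(\Sigma)=\int_{\mathbb{R}^d}\phi(\mathrm{dist}(x,\Sigma))\,d\mu(x)$. *)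

theory Defs
  imports "HOL-Probability.Probability" "HOL-Library.Landau_Symbols"
begin

text \<open>
  One-dimensional Hausdorff measure, with the standard normalisation (the weight of a
  covering set is its diameter).  Covering sets are required to be bounded because
  \<^const>\<open>diameter\<close> is real-valued and says nothing about unbounded sets; empty sets are
  allowed and have diameter 0, so finite covers are included.
\<close>

definition hausdorff1_content :: "real \<Rightarrow> 'a::metric_space set \<Rightarrow> ennreal" where
  "hausdorff1_content \<delta> A =
     (INF C \<in> {C :: nat \<Rightarrow> 'a set. A \<subseteq> (\<Union>i. C i) \<and> (\<forall>i. bounded (C i) \<and> diameter (C i) \<le> \<delta>)}.
        \<Sum>i. ennreal (diameter (C i)))"

definition hausdorff1 :: "'a::metric_space set \<Rightarrow> ennreal" where
  "hausdorff1 A = (SUP \<delta> \<in> {0<..}. hausdorff1_content \<delta> A)"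

definition measure_support :: "'a::metric_space measure \<Rightarrow> 'a set" where
  "measure_support \<mu> = {x. \<forall>\<epsilon>>0. emeasure \<mu> (ball x \<epsilon>) > 0}"

text \<open>
  Functions on \<open>[0,\<infinity>)\<close> are represented by total functions on the reals; only their values on
  \<^term>\<open>{0::real..}\<close> are used.  At 0 the derivative is one-sided.  Continuity of the derivative
  is part of its being locally Lipschitz.
\<close>

definition C11_loc :: "(real \<Rightarrow> real) \<Rightarrow> bool" where
  "C11_loc \<phi> \<longleftrightarrow>
     (\<exists>\<phi>'. (\<forall>t\<ge>0. (\<phi> has_real_derivative \<phi>' t) (at t within {0..})) \<and>
           (\<forall>t\<ge>0. \<exists>r>0. \<exists>L. L-lipschitz_on (cball t r \<inter> {0..}) \<phi>'))"

definition continua_le :: "real \<Rightarrow> 'a::metric_space set set" where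
  "continua_le l =
     {\<Sigma>. \<Sigma> \<noteq> {} \<and> compact \<Sigma> \<and> connected \<Sigma> \<and> hausdorff1 \<Sigma> \<le> ennreal l}"

definition avg_dist :: "'a::metric_space measure \<Rightarrow> (real \<Rightarrow> real) \<Rightarrow> 'a set \<Rightarrow> real" where
  "avg_dist \<mu> \<phi> \<Sigma> = (\<integral>x. \<phi> (infdist x \<Sigma>) \<partial>\<mu>)"

end

theory Submission
  imports Defs
begin

text \<open>
  Let \<open>\<Sigma>\<close> be a minimizer with more than one point. A continuum of finite length has an end \<open>e\<close> at which
  connected pieces of arbitrarily small radius \<open>r\<close> can be cut off so that a continuum remains and a length of at least
  \<open>r/2\<close> is saved (\<open>exists_small_end\<close>). The claim is that such an end is an atom. Suppose that it is not.

  Cutting the end at radius \<open>r\<close> increases the distance to \<open>\<Sigma>\<close> by at most \<open>2 * r\<close>, and only at points with a nearest point near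
  \<open>e\<close>. These have measure tending to zero with \<open>r\<close>, so a cut costs \<open>o(r)\<close>. Any deformation of \<open>\<Sigma>\<close> by a Lipschitz field is
  therefore free to first order: its additional length, of order \<open>t\<close>, is paid for by a cut. By minimality the barycentre field,
  the sum of the forces \<open>\<phi>'(d) (x - \<pi> x) / d\<close> with which points \<open>x\<close> at distance \<open>d\<close> pull at their nearest point \<open>\<pi> x\<close>, vanishes
  (\<open>field_zero\<close>). Here \<open>\<pi>\<close> is well defined at almost every point with \<open>\<phi>'(d)\<close> nonzero by the minimality against
  translations alone (\<open>AE_uniq\<close>).

  Since the field vanishes, the cost of a cut is in fact of second order (\<open>field_zero_cut\<close>, \<open>change_near_end\<close>). Let \<open>N\<close> be the integral of \<open>\<phi>'(d)\<close> over the points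
  whose nearest point is removed. The second-order error at distance \<open>d\<close> is \<open>r\<^sup>2/d\<close>, or \<open>r\<close> if this is smaller, and close to
  \<open>\<Sigma>\<close> one uses that the points concerned lie in a small ball around \<open>e\<close>, which has measure \<open>o\<close> of its radius. Altogether a
  cut costs \<open>o(1) * r * (r + N)\<close>.

  The saved length \<open>r/2\<close> is spent on two segments of length \<open>r/4\<close>. One grows at the place of the cut, in a direction in which many of the points
  counted by \<open>N\<close> pull; because the pulls balance, this gains a constant times \<open>r * N\<close>. The other grows elsewhere, at a place found by the pigeonhole principle:
  \<open>\<Sigma>\<close> is covered by of the order of \<open>1/r\<close> balls of radius of order \<open>r\<close>, so some such ball serves a set of points of measure at least of order \<open>r\<close>, and the
  gain is a constant times \<open>r\<^sup>2\<close> (\<open>exists_gain_cell\<close>). The gain \<open>r * (r + N)\<close> beats the cost (\<open>not_atomless_end\<close>).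

  Two facts keep the weights under control. A set of finite length is null for \<open>\<mu>\<close>, because balls have measure \<open>o\<close> of their radius
  (\<open>small_balls_imp_null_on_finite_length\<close>), so \<open>d\<close> is positive almost everywhere; and \<open>\<phi>'(d)\<close> cannot vanish almost everywhere, since otherwise a
  single point would do better than \<open>\<Sigma>\<close> (\<open>weight_nontrivial\<close>).
\<close>

section \<open>One-dimensional Hausdorff measure\<close>

lemma hausdorff1_content_le_sum:
  assumes "A \<subseteq> (\<Union>i. C i)" "\<And>i. bounded (C i)" "\<And>i. diameter (C i) \<le> \<delta>"
  shows "hausdorff1_content \<delta> A \<le> (\<Sum>i. ennreal (diameter (C i)))"
  unfolding hausdorff1_content_def by (rule INF_lower) (use assms in auto)

lemma hausdorff1_content_cover:
  assumes "hausdorff1_content \<delta> A < c"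
  obtains C :: "nat \<Rightarrow> 'a::metric_space set" where
    "A \<subseteq> (\<Union>i. C i)" "\<And>i. bounded (C i)" "\<And>i. diameter (C i) \<le> \<delta>"
    "(\<Sum>i. ennreal (diameter (C i))) < c"
  using assms unfolding hausdorff1_content_def INF_less_iff by auto

lemma hausdorff1_content_le: "\<delta> > 0 \<Longrightarrow> hausdorff1_content \<delta> A \<le> hausdorff1 A"
  unfolding hausdorff1_def by (rule SUP_upper) auto

lemma hausdorff1_leI: "(\<And>\<delta>. \<delta> > 0 \<Longrightarrow> hausdorff1_content \<delta> A \<le> c) \<Longrightarrow> hausdorff1 A \<le> c"
  unfolding hausdorff1_def by (rule SUP_least) auto

lemma hausdorff1_content_antimono:
  "\<delta> \<le> \<delta>' \<Longrightarrow> hausdorff1_content \<delta>' A \<le> hausdorff1_content \<delta> A"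
  unfolding hausdorff1_content_def by (rule INF_superset_mono) (auto intro: order_trans)

lemma hausdorff1_content_mono:
  "A \<subseteq> B \<Longrightarrow> hausdorff1_content \<delta> A \<le> hausdorff1_content \<delta> B"
  unfolding hausdorff1_content_def by (rule INF_superset_mono) auto

lemma hausdorff1_mono: "A \<subseteq> B \<Longrightarrow> hausdorff1 A \<le> hausdorff1 B"
  unfolding hausdorff1_def by (rule SUP_mono) (auto intro: hausdorff1_content_mono)

text \<open>
  Merges two sequences of covering sets into one, so that covers indexed by the naturals can be united.
\<close>
lemma suminf_interleave:
  fixes f g :: "nat \<Rightarrow> ennreal"
  shows "(\<Sum>n. if even n then f (n div 2) else g (n div 2)) = (\<Sum>n. f n) + (\<Sum>n. g n)"
proof (rule LIMSEQ_unique)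
  let ?h = "\<lambda>n. if even n then f (n div 2) else g (n div 2)"
  have "sum ?h {..<2 * n} = sum f {..<n} + sum g {..<n}" for n
    by (induction n) (auto simp: ac_simps)
  then show "(\<lambda>n. sum ?h {..<2 * n}) \<longlonglongrightarrow> (\<Sum>n. f n) + (\<Sum>n. g n)"
    by (simp add: tendsto_add summable_LIMSEQ)
  show "(\<lambda>n. sum ?h {..<2 * n}) \<longlonglongrightarrow> (\<Sum>n. ?h n)"
    using LIMSEQ_subseq_LIMSEQ[OF summable_LIMSEQ, of ?h "\<lambda>n. 2 * n"] by (simp add: strict_mono_def o_def)
qed

lemma hausdorff1_content_Un_le:
  "hausdorff1_content \<delta> (A \<union> B) \<le> hausdorff1_content \<delta> A + hausdorff1_content \<delta> B"
proof (rule ennreal_le_epsilon)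
  fix e :: real
  assume fin: "hausdorff1_content \<delta> A + hausdorff1_content \<delta> B < top" and e: "e > 0"
  let ?a = "hausdorff1_content \<delta> A + ennreal (e/2)" and ?b = "hausdorff1_content \<delta> B + ennreal (e/2)"
  have ab: "hausdorff1_content \<delta> A < ?a" "hausdorff1_content \<delta> B < ?b"
    using fin e ennreal_add_left_cancel_less[of _ 0] by auto
  obtain C where C: "A \<subseteq> (\<Union>i. C i)" "\<And>i::nat. bounded (C i)" "\<And>i. diameter (C i) \<le> \<delta>"
    "(\<Sum>i. ennreal (diameter (C i))) < ?a" using hausdorff1_content_cover[OF ab(1)] by metis
  obtain D where D: "B \<subseteq> (\<Union>i. D i)" "\<And>i::nat. bounded (D i)" "\<And>i. diameter (D i) \<le> \<delta>"
    "(\<Sum>i. ennreal (diameter (D i))) < ?b" using hausdorff1_content_cover[OF ab(2)] by metis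
  define E where "E = (\<lambda>n::nat. if even n then C (n div 2) else D (n div 2))"
  have "C i \<subseteq> \<Union>(range E)" for i
    unfolding E_def by (rule subsetI) (auto intro!: exI[of _ "2 * i"])
  moreover have "D i \<subseteq> \<Union>(range E)" for i
    unfolding E_def by (rule subsetI) (auto intro!: exI[of _ "2 * i + 1"])
  ultimately have "A \<union> B \<subseteq> (\<Union>i. E i)" using C(1) D(1) by (meson Un_least UN_least order_trans)
  then have "hausdorff1_content \<delta> (A \<union> B) \<le> (\<Sum>i. ennreal (diameter (E i)))"
    by (rule hausdorff1_content_le_sum) (auto simp: E_def C(2,3) D(2,3))
  also have "\<dots> = (\<Sum>i. ennreal (diameter (C i))) + (\<Sum>i. ennreal (diameter (D i)))"
    by (subst suminf_interleave[symmetric]) (auto simp: E_def if_distrib intro!: suminf_cong)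
  also have "\<dots> \<le> ?a + ?b" using C(4) D(4) by (intro add_mono) auto
  also have "\<dots> = hausdorff1_content \<delta> A + hausdorff1_content \<delta> B + (ennreal (e/2) + ennreal (e/2))"
    by (simp add: ac_simps)
  also have "ennreal (e/2) + ennreal (e/2) = ennreal e"
    using e by (simp flip: ennreal_plus)
  finally show "hausdorff1_content \<delta> (A \<union> B) \<le> hausdorff1_content \<delta> A + hausdorff1_content \<delta> B + ennreal e" .
qed

lemma hausdorff1_Un_le: "hausdorff1 (A \<union> B) \<le> hausdorff1 A + hausdorff1 B"
  by (rule hausdorff1_leI)
     (meson add_mono hausdorff1_content_Un_le hausdorff1_content_le order_trans)

text \<open>
  A covering set of diameter below the distance of the two sets meets at most one of them, so every fine
  cover splits into a cover of each set.
\<close>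
lemma hausdorff1_content_positive_distance:
  assumes s: "\<delta> < s" and AB: "\<And>x y. x \<in> A \<Longrightarrow> y \<in> B \<Longrightarrow> s \<le> dist x y"
  shows "hausdorff1_content \<delta> A + hausdorff1_content \<delta> B \<le> hausdorff1_content \<delta> (A \<union> B)"
proof -
  have "hausdorff1_content \<delta> A + hausdorff1_content \<delta> B \<le> (\<Sum>i. ennreal (diameter (C i)))"
    if C: "A \<union> B \<subseteq> (\<Union>i. C i)" "\<And>i. bounded (C i)" "\<And>i. diameter (C i) \<le> \<delta>" for C :: "nat \<Rightarrow> 'a set"
  proof -
    define CA where "CA = (\<lambda>i. if C i \<inter> A = {} then {} else C i)"
    define CB where "CB = (\<lambda>i. if C i \<inter> A = {} then C i else {})"
    have d0: "0 \<le> \<delta>" using C(2,3)[of 0] diameter_ge_0[of "C 0"] by linarith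
    have disj: "C i \<inter> A = {} \<or> C i \<inter> B = {}" for i
    proof (rule ccontr)
      assume "\<not> ?thesis"
      then obtain x y where xy: "x \<in> C i" "x \<in> A" "y \<in> C i" "y \<in> B" by auto
      then have "dist x y \<le> diameter (C i)" using C(2) by (intro diameter_bounded_bound) auto
      then show False using AB[of x y] xy s C(3)[of i] by auto
    qed
    have "A \<subseteq> (\<Union>i. CA i)"
    proof
      fix x assume x: "x \<in> A"
      then obtain i where "x \<in> C i" using C(1) by auto
      then show "x \<in> (\<Union>i. CA i)" using x by (intro UN_I[of i]) (auto simp: CA_def)
    qed
    moreover have "B \<subseteq> (\<Union>i. CB i)"
    proof
      fix x assume x: "x \<in> B"
      then obtain i where "x \<in> C i" using C(1) by auto
      then show "x \<in> (\<Union>i. CB i)" using x disj[of i] by (intro UN_I[of i]) (auto simp: CB_def)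
    qed
    ultimately have "hausdorff1_content \<delta> A + hausdorff1_content \<delta> B
        \<le> (\<Sum>i. ennreal (diameter (CA i))) + (\<Sum>i. ennreal (diameter (CB i)))"
      by (intro add_mono hausdorff1_content_le_sum) (auto simp: CA_def CB_def C(2,3) d0)
    also have "\<dots> = (\<Sum>i. ennreal (diameter (CA i)) + ennreal (diameter (CB i)))"
      by (intro suminf_add) auto
    also have "\<dots> = (\<Sum>i. ennreal (diameter (C i)))"
      by (intro suminf_cong) (auto simp: CA_def CB_def)
    finally show ?thesis .
  qed
  then show ?thesis
    unfolding hausdorff1_content_def[of _ "A \<union> B"] by (intro INF_greatest) auto
qed

lemma hausdorff1_positive_distance:
  assumes s: "0 < s" and AB: "\<And>x y. x \<in> A \<Longrightarrow> y \<in> B \<Longrightarrow> s \<le> dist x y"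
  shows "hausdorff1 A + hausdorff1 B \<le> hausdorff1 (A \<union> B)"
proof -
  have 1: "hausdorff1_content d1 A + hausdorff1_content d2 B \<le> hausdorff1 (A \<union> B)"
    if d: "d1 > 0" "d2 > 0" for d1 d2
  proof -
    define d where "d = min (s/2) (min d1 d2)"
    have "hausdorff1_content d1 A + hausdorff1_content d2 B \<le> hausdorff1_content d A + hausdorff1_content d B"
      by (intro add_mono hausdorff1_content_antimono) (auto simp: d_def)
    also have "\<dots> \<le> hausdorff1_content d (A \<union> B)"
      by (rule hausdorff1_content_positive_distance[OF _ AB]) (use s in \<open>auto simp: d_def\<close>)
    also have "\<dots> \<le> hausdorff1 (A \<union> B)"
      by (rule hausdorff1_content_le) (use s d in \<open>auto simp: d_def\<close>)
    finally show ?thesis .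
  qed
  have "hausdorff1 A + hausdorff1_content d2 B \<le> hausdorff1 (A \<union> B)" if "d2 > 0" for d2
    unfolding hausdorff1_def[of A]
    by (subst ennreal_SUP_add_left[symmetric]) (auto intro!: SUP_least 1 that)
  then show ?thesis
    unfolding hausdorff1_def[of B]
    by (subst ennreal_SUP_add_right) (auto intro!: SUP_least)
qed

text \<open>
  Disjoint compact sets have a positive distance. This case of additivity is the one that all the counting and cutting
  arguments rest on.
\<close>
lemma hausdorff1_disjoint_compact:
  fixes A B :: "'a::{heine_borel,real_normed_vector} set"
  assumes "compact A" "compact B" "A \<inter> B = {}"
  shows "hausdorff1 A + hausdorff1 B \<le> hausdorff1 (A \<union> B)"
proof -
  obtain s where "s > 0" "\<And>x y. x \<in> A \<Longrightarrow> y \<in> B \<Longrightarrow> s \<le> dist x y"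
    using separate_compact_closed[OF assms(1) compact_imp_closed[OF assms(2)] assms(3)] by metis
  then show ?thesis by (rule hausdorff1_positive_distance)
qed

lemma hausdorff1_disjoint_family:
  fixes f :: "'i \<Rightarrow> 'a::{heine_borel,real_normed_vector} set"
  assumes "finite I" "\<And>i. i \<in> I \<Longrightarrow> compact (f i)" "disjoint_family_on f I"
    "\<And>i. i \<in> I \<Longrightarrow> ennreal h \<le> hausdorff1 (f i)"
  shows "of_nat (card I) * ennreal h \<le> hausdorff1 (\<Union>i\<in>I. f i)"
  using assms
proof (induction I)
  case (insert i I)
  have "of_nat (card (insert i I)) * ennreal h = ennreal h + of_nat (card I) * ennreal h"
    using insert by (simp add: distrib_right)
  also have "\<dots> \<le> hausdorff1 (f i) + hausdorff1 (\<Union>i\<in>I. f i)"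
    using insert by (intro add_mono) (auto simp: disjoint_family_on_def)
  also have "\<dots> \<le> hausdorff1 (f i \<union> (\<Union>i\<in>I. f i))"
    using insert by (intro hausdorff1_disjoint_compact compact_UN) (auto simp: disjoint_family_on_def)
  finally show ?case by simp
qed simp

text \<open>
  Images of the traces of the covering sets cover the image, with diameters at most \<open>L\<close> times as large.
\<close>
lemma hausdorff1_lipschitz_image:
  fixes f :: "'a::metric_space \<Rightarrow> 'b::metric_space"
  assumes L: "L-lipschitz_on A f" "L > 0"
  shows "hausdorff1 (f ` A) \<le> ennreal L * hausdorff1 A"
proof (rule hausdorff1_leI)
  fix \<delta> :: real assume d: "\<delta> > 0"
  have "hausdorff1_content \<delta> (f ` A) \<le> ennreal L * hausdorff1_content (\<delta> / L) A"
  proof -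
    have LL: "ennreal L * ennreal (1/L) = 1" using L(2) by (simp flip: ennreal_mult')
    have "ennreal (1/L) * hausdorff1_content \<delta> (f ` A) \<le> hausdorff1_content (\<delta>/L) A"
      unfolding hausdorff1_content_def[of "\<delta>/L" A]
    proof (intro INF_greatest, clarsimp)
      fix C :: "nat \<Rightarrow> 'a set"
      assume C: "A \<subseteq> (\<Union>i. C i)" "\<forall>i. bounded (C i) \<and> diameter (C i) \<le> \<delta>/L"
      have dia: "bounded (f ` (C i \<inter> A)) \<and> diameter (f ` (C i \<inter> A)) \<le> L * diameter (C i)" for i
      proof
        have le: "dist (f x) (f y) \<le> L * diameter (C i)" if "x \<in> C i \<inter> A" "y \<in> C i \<inter> A" for x y
        proof -
          have "dist (f x) (f y) \<le> L * dist x y" using that L(1) by (auto dest: lipschitz_onD)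
          also have "\<dots> \<le> L * diameter (C i)"
            using that C(2) L(2) by (intro mult_left_mono diameter_bounded_bound) auto
          finally show ?thesis .
        qed
        then show "bounded (f ` (C i \<inter> A))"
          by (auto simp: bounded_two_points)
        have "0 \<le> L * diameter (C i)" using L(2) C(2) by (auto intro!: mult_nonneg_nonneg diameter_ge_0)
        then show "diameter (f ` (C i \<inter> A)) \<le> L * diameter (C i)"
          unfolding diameter_def[of "f ` (C i \<inter> A)"] using le by (auto intro!: cSUP_least)
      qed
      have "hausdorff1_content \<delta> (f ` A) \<le> (\<Sum>i. ennreal (diameter (f ` (C i \<inter> A))))"
      proof (rule hausdorff1_content_le_sum)
        show "diameter (f ` (C i \<inter> A)) \<le> \<delta>" for i
          using dia[of i] C(2) L(2) by (metis le_divide_eq mult.commute order_trans)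
        show "f ` A \<subseteq> (\<Union>i. f ` (C i \<inter> A))" using C(1) by blast
        show "bounded (f ` (C i \<inter> A))" for i using dia by blast
      qed
      also have "\<dots> \<le> (\<Sum>i. ennreal L * ennreal (diameter (C i)))"
        using dia L(2) by (intro suminf_le) (auto simp flip: ennreal_mult' intro!: ennreal_leI)
      finally have "hausdorff1_content \<delta> (f ` A) \<le> ennreal L * (\<Sum>i. ennreal (diameter (C i)))"
        by simp
      then have "ennreal (1/L) * hausdorff1_content \<delta> (f ` A) \<le> ennreal (1/L) * (ennreal L * (\<Sum>i. ennreal (diameter (C i))))"
        by (rule mult_left_mono) simp
      also have "\<dots> = (\<Sum>i. ennreal (diameter (C i)))"
        using LL by (metis mult.assoc mult.commute mult_1)
      finally show "ennreal (1/L) * hausdorff1_content \<delta> (f ` A) \<le> (\<Sum>i. ennreal (diameter (C i)))" .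
    qed
    then have "ennreal L * (ennreal (1/L) * hausdorff1_content \<delta> (f ` A)) \<le> ennreal L * hausdorff1_content (\<delta>/L) A"
      by (rule mult_left_mono) simp
    then show ?thesis by (simp only: LL mult.assoc[symmetric] mult_1_left)
  qed
  also have "\<dots> \<le> ennreal L * hausdorff1 A"
    using d L by (intro mult_left_mono hausdorff1_content_le) auto
  finally show "hausdorff1_content \<delta> (f ` A) \<le> ennreal L * hausdorff1 A" .
qed

lemma hausdorff1_singleton: "hausdorff1 {a} = 0"
proof -
  have "hausdorff1 {a} \<le> 0"
  proof (rule hausdorff1_leI)
    fix \<delta> :: real assume "\<delta> > 0"
    then have "hausdorff1_content \<delta> {a} \<le> (\<Sum>i::nat. ennreal (diameter {a}))"
      by (intro hausdorff1_content_le_sum) auto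
    then show "hausdorff1_content \<delta> {a} \<le> 0" by simp
  qed
  then show ?thesis by simp
qed

lemma hausdorff1_unit_interval: "hausdorff1 {0..1::real} \<le> 1"
proof (rule hausdorff1_leI)
  fix \<delta> :: real assume d: "\<delta> > 0"
  obtain n :: nat where n: "n > 0" "1 / real n < \<delta>"
    using real_arch_inverse d by (metis inverse_eq_divide neq0_conv)
  define C where "C = (\<lambda>i::nat. if i < n then {i / n .. (i+1) / n} else {})"
  have diam: "diameter (C i) = (if i < n then 1 / n else 0)" for i
    using n by (auto simp: C_def divide_simps)
  have cover: "{0..1::real} \<subseteq> (\<Union>i. C i)"
  proof
    fix x :: real assume x: "x \<in> {0..1}"
    show "x \<in> (\<Union>i. C i)"
    proof (cases "x = 1")
      case True
      then have "x \<in> C (n - 1)" using n by (auto simp: C_def divide_simps of_nat_diff)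
      then show ?thesis by blast
    next
      case False
      define i where "i = nat \<lfloor>x * n\<rfloor>"
      have i: "real i \<le> x * n" "x * n < real i + 1" using x by (auto simp: i_def)
      have "x * n < n" using x False n by auto
      then have "i < n" using i(1) by linarith
      then have "x \<in> C i" using i n by (auto simp: C_def divide_simps mult.commute)
      then show ?thesis by blast
    qed
  qed
  have "hausdorff1_content \<delta> {0..1::real} \<le> (\<Sum>i. ennreal (diameter (C i)))"
    by (rule hausdorff1_content_le_sum[OF cover]) (use n d in \<open>auto simp: diam, simp add: C_def\<close>)
  also have "\<dots> = (\<Sum>i<n. ennreal (diameter (C i)))"
    by (rule suminf_finite) (auto simp: diam)
  also have "\<dots> = 1"
    using n by (simp add: diam ennreal_of_nat_eq_real_of_nat flip: ennreal_mult')
  finally show "hausdorff1_content \<delta> {0..1::real} \<le> 1" .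
qed

lemma hausdorff1_closed_segment:
  fixes a b :: "'a::real_normed_vector"
  shows "hausdorff1 (closed_segment a b) \<le> ennreal (dist a b)"
proof (cases "a = b")
  case False
  have "(dist a b)-lipschitz_on {0..1} (\<lambda>u. (1 - u) *\<^sub>R a + u *\<^sub>R b)"
  proof (rule lipschitz_onI)
    fix x y :: real
    have "((1 - x) *\<^sub>R a + x *\<^sub>R b) - ((1 - y) *\<^sub>R a + y *\<^sub>R b) = (x - y) *\<^sub>R (b - a)"
      by (simp add: algebra_simps)
    then have "dist ((1 - x) *\<^sub>R a + x *\<^sub>R b) ((1 - y) *\<^sub>R a + y *\<^sub>R b) = norm ((x - y) *\<^sub>R (b - a))"
      by (simp only: dist_norm)
    then show "dist ((1 - x) *\<^sub>R a + x *\<^sub>R b) ((1 - y) *\<^sub>R a + y *\<^sub>R b) \<le> dist a b * dist x y"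
      by (simp add: dist_norm norm_minus_commute mult.commute)
  qed auto
  from hausdorff1_lipschitz_image[OF this]
  have "hausdorff1 (closed_segment a b) \<le> ennreal (dist a b) * hausdorff1 {0..1::real}"
    using False by (simp add: closed_segment_image_interval)
  also have "\<dots> \<le> ennreal (dist a b) * 1"
    by (intro mult_left_mono hausdorff1_unit_interval) auto
  finally show ?thesis by simp
qed (simp add: hausdorff1_singleton)

text \<open>
  Distance to a point is a 1-Lipschitz map to the line, and on the line the weights of a cover add up to at
  least the Lebesgue measure of what is covered. This is the only source of lower bounds for length.
\<close>
lemma hausdorff1_ge_of_dist_image:
  assumes A: "{0..t} \<subseteq> dist a ` A"
  shows "ennreal t \<le> hausdorff1 A"
proof -
  have "ennreal t \<le> (\<Sum>i. ennreal (diameter (C i)))"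
    if C: "A \<subseteq> (\<Union>i. C i)" "\<And>i. bounded (C i)" for C :: "nat \<Rightarrow> 'a set"
  proof -
    define m where "m = (\<lambda>i. Inf (dist a ` C i))"
    define I where "I = (\<lambda>i. if C i = {} then {} else {m i .. m i + diameter (C i)})"
    have inI: "dist a x \<in> I i" if "x \<in> C i" for x i
    proof -
      have "m i \<le> dist a x" unfolding m_def by (rule cINF_lower) (use that in \<open>auto intro!: bdd_belowI2[of _ 0]\<close>)
      moreover have "dist a x - diameter (C i) \<le> m i"
        unfolding m_def
      proof (rule cINF_greatest)
        fix y assume "y \<in> C i"
        then have "dist x y \<le> diameter (C i)" using that C(2) by (intro diameter_bounded_bound) auto
        then show "dist a x - diameter (C i) \<le> dist a y" using dist_triangle[of a x y] by (simp add: dist_commute)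
      qed (use that in auto)
      ultimately show ?thesis using that by (auto simp: I_def)
    qed
    have "dist a ` A \<subseteq> (\<Union>i. I i)"
    proof (rule image_subsetI)
      fix x assume "x \<in> A"
      then obtain i where "x \<in> C i" using C(1) by auto
      then show "dist a x \<in> (\<Union>i. I i)" by (intro UN_I[of i] inI) auto
    qed
    then have sub: "{0..t} \<subseteq> (\<Union>i. I i)" using A by (rule order_trans[rotated])
    have "ennreal t \<le> emeasure lborel {0..t}" by (cases "t \<ge> 0") (simp_all add: ennreal_neg)
    also have "\<dots> \<le> emeasure lborel (\<Union>i. I i)" by (rule emeasure_mono[OF sub]) (auto simp: I_def)
    also have "\<dots> \<le> (\<Sum>i. emeasure lborel (I i))" by (rule emeasure_subadditive_countably) (simp add: I_def image_subset_iff)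
    also have "\<dots> \<le> (\<Sum>i. ennreal (diameter (C i)))"
      by (rule suminf_le) (simp_all add: I_def diameter_ge_0 C(2))
    finally show ?thesis .
  qed
  then have "ennreal t \<le> hausdorff1_content 1 A"
    unfolding hausdorff1_content_def by (intro INF_greatest) auto
  also have "\<dots> \<le> hausdorff1 A" by (rule hausdorff1_content_le) simp
  finally show ?thesis .
qed

text \<open>
  A connected set that contains the centre of a ball and leaves the ball meets every sphere in between.
\<close>
lemma hausdorff1_connected_Int_cball:
  assumes "connected K" "p \<in> K" "q \<in> K" "r \<le> dist p q"
  shows "ennreal r \<le> hausdorff1 (K \<inter> cball p r)"
proof (rule hausdorff1_ge_of_dist_image[of _ p], rule subsetI)
  fix t assume t: "t \<in> {0..r}"
  have "connected (dist p ` K)" using assms(1) by (intro connected_continuous_image continuous_intros)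
  then have "t \<in> dist p ` K"
    by (rule connected_contains_Icc[THEN subsetD, of _ 0 "dist p q"]) (use assms t in \<open>auto intro: image_eqI[of _ _ p] image_eqI[of _ _ q]\<close>)
  then show "t \<in> dist p ` (K \<inter> cball p r)" using t by auto
qed

lemma hausdorff1_connected_ge_dist:
  assumes "connected K" "p \<in> K" "q \<in> K"
  shows "ennreal (dist p q) \<le> hausdorff1 K"
  by (rule order_trans[OF hausdorff1_connected_Int_cball[OF assms order_refl]]) (auto intro: hausdorff1_mono)

section \<open>Continua of finite length\<close>

text \<open>
  Boundary bumping. In a compact set a component has arbitrarily small clopen neighbourhoods (Sura-Bura); one
  that stays inside the open ball would also be clopen in all of \<open>S\<close>, which is connected.
\<close>
lemma component_Int_cball_meets_sphere:
  fixes S :: "'a::euclidean_space set"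
  assumes S: "compact S" "connected S" "\<not> S \<subseteq> ball p r"
    and Q: "Q \<in> components (S \<inter> cball p r)"
  shows "Q \<inter> sphere p r \<noteq> {}"
proof
  assume emp: "Q \<inter> sphere p r = {}"
  let ?X = "S \<inter> cball p r"
  have X: "compact ?X" using S by (intro compact_Int_closed) auto
  have Qsub: "Q \<subseteq> ?X" using Q by (rule in_components_subset)
  then have "Q \<subseteq> ball p r" using emp by force
  moreover have "compact Q" using X Q compact_components by blast
  ultimately obtain K where K: "openin (top_of_set ?X) K" "compact K" "Q \<subseteq> K" "K \<subseteq> ball p r"
    using Sura_Bura_clopen_subset[OF closed_imp_locally_compact[OF compact_imp_closed[OF X]] Q, of "ball p r"] open_ball
    by blast
  have KS: "K \<subseteq> S" using K(1) openin_imp_subset by blast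
  obtain T where T: "open T" "K = ?X \<inter> T" using K(1) by (auto simp: openin_open)
  have "K = S \<inter> (T \<inter> ball p r)" using T(2) K(4) by auto
  then have "openin (top_of_set S) K" using T(1) by (metis open_Int open_ball openin_open_Int)
  moreover have "closedin (top_of_set S) K"
    using K(2) KS by (simp add: closed_subset compact_imp_closed)
  moreover have "K \<noteq> {}" using K(3) in_components_nonempty[OF Q] by auto
  ultimately have "K = S" using S(2) unfolding connected_clopen by auto
  then show False using K(4) S(3) by auto
qed

text \<open>
  A component of \<open>S \<inter> cball x r\<close> that meets the ball of half the radius has length at least \<open>r/2\<close>, because it
  reaches the sphere. So there are only finitely many of them, and those that miss \<open>x\<close> stay at a positive distance from \<open>x\<close>.
\<close>
lemma finite_length_imp_locally_connected:
  fixes S :: "'a::euclidean_space set"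
  assumes S: "compact S" "connected S" and fin: "hausdorff1 S < top"
  shows "locally connected S"
  unfolding locally_connected_im_kleinen
proof (intro allI impI, elim conjE)
  fix v x assume v: "openin (top_of_set S) v" and x: "x \<in> v"
  obtain e where e: "e > 0" "ball x e \<inter> S \<subseteq> v"
    using v x by (metis openin_contains_ball)
  define r where "r = e / 2"
  have r: "r > 0" "S \<inter> cball x r \<subseteq> v" "S \<inter> ball x r \<subseteq> v"
    using e by (auto simp: r_def)
  have vS: "v \<subseteq> S" using v openin_imp_subset by blast
  show "\<exists>u. openin (top_of_set S) u \<and> x \<in> u \<and> u \<subseteq> v \<and>
         (\<forall>y. y \<in> u \<longrightarrow> (\<exists>c. connected c \<and> c \<subseteq> v \<and> x \<in> c \<and> y \<in> c))"
  proof (cases "S \<subseteq> ball x r")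
    case True
    then have "S = v" using r vS by auto
    then show ?thesis using S(2) x by (intro exI[of _ v]) auto
  next
    case False
    define X where "X = S \<inter> cball x r"
    have X: "compact X" unfolding X_def using S by (intro compact_Int_closed) auto
    define Q where "Q = {q \<in> components X. q \<inter> cball x (r/2) \<noteq> {}}"
    have Qcomp: "compact q" if "q \<in> components X" for q using that X compact_components by blast
    have Qlen: "ennreal (r/2) \<le> hausdorff1 q" if q: "q \<in> Q" for q
    proof -
      obtain a where a: "a \<in> q" "a \<in> cball x (r/2)" using q by (auto simp: Q_def)
      obtain b where b: "b \<in> q" "b \<in> sphere x r"
        using component_Int_cball_meets_sphere[OF S False] q by (fastforce simp: Q_def X_def)
      have "connected q" using q in_components_connected by (auto simp: Q_def)
      have "r/2 \<le> dist a b"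
        using a(2) b(2) dist_triangle[of x b a] by auto
      then have "ennreal (r/2) \<le> ennreal (dist a b)" by (rule ennreal_leI)
      also have "\<dots> \<le> hausdorff1 q" by (rule hausdorff1_connected_ge_dist) fact+
      finally show ?thesis .
    qed
    have "finite Q"
    proof (rule ccontr)
      assume inf: "infinite Q"
      obtain n :: nat where n: "hausdorff1 S < of_nat n * ennreal (r/2)"
      proof -
        obtain s where s: "hausdorff1 S = ennreal s" "s \<ge> 0" using fin by (cases "hausdorff1 S") auto
        obtain n :: nat where "s / (r/2) < real n" using reals_Archimedean2 by blast
        then have "s < real n * (r/2)" using r by (simp add: field_simps)
        then have "hausdorff1 S < of_nat n * ennreal (r/2)"
          using s r by (simp add: ennreal_of_nat_eq_real_of_nat ennreal_lessI flip: ennreal_mult')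
        then show thesis by (rule that)
      qed
      obtain I where I: "I \<subseteq> Q" "finite I" "card I = n" using inf infinite_arbitrarily_large by blast
      have "of_nat (card I) * ennreal (r/2) \<le> hausdorff1 (\<Union>i\<in>I. i)"
      proof (rule hausdorff1_disjoint_family)
        show "disjoint_family_on (\<lambda>i. i) I"
          unfolding disjoint_family_on_def
          using I(1) components_nonoverlap[of _ X] by (auto simp: Q_def)
      qed (use I Qcomp Qlen in \<open>auto simp: Q_def\<close>)
      also have "\<dots> \<le> hausdorff1 S"
      proof (rule hausdorff1_mono, rule UN_least)
        fix i assume "i \<in> I"
        then have "i \<subseteq> X" using I(1) in_components_subset[of i X] by (auto simp: Q_def)
        then show "i \<subseteq> S" by (auto simp: X_def)
      qed
      finally show False using n I(3) by simp
    qed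
    define B where "B = \<Union>{q \<in> Q. x \<notin> q}"
    have "closed B" unfolding B_def
    proof (rule closed_Union)
      show "finite {q \<in> Q. x \<notin> q}" using \<open>finite Q\<close> by simp
    qed (use Qcomp in \<open>auto simp: Q_def intro: compact_imp_closed\<close>)
    define u where "u = S \<inter> (ball x (r/2) - B)"
    have "openin (top_of_set S) u"
      unfolding u_def using \<open>closed B\<close> by (intro openin_open_Int open_Diff) auto
    moreover have "x \<in> u" using x vS r by (auto simp: u_def B_def)
    moreover have "u \<subseteq> v" using r by (auto simp: u_def)
    moreover have "\<exists>c. connected c \<and> c \<subseteq> v \<and> x \<in> c \<and> y \<in> c" if y: "y \<in> u" for y
    proof -
      have yX: "y \<in> X" using y r by (auto simp: u_def X_def)
      let ?c = "connected_component_set X y"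
      have c: "?c \<in> components X" "y \<in> ?c" using yX by (auto simp: componentsI)
      have "y \<in> cball x (r/2)" using y by (simp add: u_def)
      then have "?c \<in> Q" using c unfolding Q_def by blast
      then have "x \<in> ?c" using c y by (auto simp: u_def B_def)
      moreover have "?c \<subseteq> v" using r in_components_subset[OF c(1)] by (auto simp: X_def)
      ultimately show ?thesis using c in_components_connected by blast
    qed
    ultimately show ?thesis by blast
  qed
qed

lemma locally_connected_continuum_neighbourhood:
  fixes S :: "'a::euclidean_space set"
  assumes S: "compact S" "locally connected S" and U: "openin (top_of_set S) U" and a: "a \<in> U"
  obtains T K where "openin (top_of_set S) T" "a \<in> T" "T \<subseteq> K" "K \<subseteq> U" "compact K" "connected K"
proof -
  obtain e where e: "e > 0" "ball a e \<inter> S \<subseteq> U"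
    using U a by (metis openin_contains_ball)
  have "openin (top_of_set S) (S \<inter> ball a (e/2))" "a \<in> S \<inter> ball a (e/2)"
    using e a openin_imp_subset[OF U] by (auto simp: openin_open_Int)
  then obtain T where T: "openin (top_of_set S) T" "connected T" "a \<in> T" "T \<subseteq> S \<inter> ball a (e/2)"
    using S(2) unfolding locally_connected by metis
  have "closure T \<subseteq> S \<inter> cball a (e/2)"
    using T(4) S(1) by (intro closure_minimal closed_Int) (auto simp: compact_imp_closed)
  also have "\<dots> \<subseteq> U" using e by auto
  finally have 1: "closure T \<subseteq> U" .
  have "compact (closure T)"
    using T(4) S(1) by (meson bounded_subset compact_closure compact_imp_bounded le_inf_iff)
  then show thesis
    using that[OF T(1,3) closure_subset 1] T(2) connected_imp_connected_closure by blast
qed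

text \<open>
  Being joined by a continuum inside \<open>U\<close> is an equivalence relation with open classes. The
  continua play the role of arcs.
\<close>
lemma locally_connected_continuum_join:
  fixes S :: "'a::euclidean_space set"
  assumes S: "compact S" "locally connected S" and U: "openin (top_of_set S) U" "connected U"
    and xy: "x \<in> U" "y \<in> U"
  shows "\<exists>K. compact K \<and> connected K \<and> K \<subseteq> U \<and> x \<in> K \<and> y \<in> K"
proof (rule connected_equivalence_relation[OF U(2) xy])
  fix x y z
  assume "\<exists>K. compact K \<and> connected K \<and> K \<subseteq> U \<and> x \<in> K \<and> y \<in> K"
    "\<exists>K. compact K \<and> connected K \<and> K \<subseteq> U \<and> y \<in> K \<and> z \<in> K"
  then obtain K L where "compact K" "connected K" "K \<subseteq> U" "x \<in> K" "y \<in> K"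
     "compact L" "connected L" "L \<subseteq> U" "y \<in> L" "z \<in> L" by auto
  then show "\<exists>K. compact K \<and> connected K \<and> K \<subseteq> U \<and> x \<in> K \<and> z \<in> K"
    by (intro exI[of _ "K \<union> L"]) (auto intro!: connected_Un compact_Un)
next
  fix a assume "a \<in> U"
  then obtain T K where TK: "openin (top_of_set S) T" "a \<in> T" "T \<subseteq> K" "K \<subseteq> U" "compact K" "connected K"
    using locally_connected_continuum_neighbourhood[OF S U(1)] by metis
  have "openin (top_of_set U) T"
    using TK U(1) by (meson openin_imp_subset openin_subset_trans order_trans)
  then show "\<exists>T. openin (top_of_set U) T \<and> a \<in> T \<and>
     (\<forall>x\<in>T. \<exists>K. compact K \<and> connected K \<and> K \<subseteq> U \<and> a \<in> K \<and> x \<in> K)"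
    using TK by (intro exI[of _ T]) blast
qed auto

lemma locally_connected_continuum_superset:
  fixes S :: "'a::euclidean_space set"
  assumes S: "compact S" "locally connected S" and U: "openin (top_of_set S) U" "connected U"
    and F: "compact F" "F \<subseteq> U" "b0 \<in> U"
  obtains K where "compact K" "connected K" "K \<subseteq> U" "F \<subseteq> K" "b0 \<in> K"
proof -
  have "\<exists>T K. open T \<and> a \<in> T \<and> S \<inter> T \<subseteq> K \<and> K \<subseteq> U \<and> compact K \<and> connected K \<and> b0 \<in> K" if "a \<in> F" for a
  proof -
    have aU: "a \<in> U" using that F by auto
    obtain T K where TK: "openin (top_of_set S) T" "a \<in> T" "T \<subseteq> K" "K \<subseteq> U" "compact K" "connected K"
      using locally_connected_continuum_neighbourhood[OF S U(1) aU] by metis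
    obtain L where L: "compact L" "connected L" "L \<subseteq> U" "b0 \<in> L" "a \<in> L"
      using locally_connected_continuum_join[OF S U F(3) aU] by metis
    obtain T' where "open T'" "T = S \<inter> T'" using TK(1) by (auto simp: openin_open)
    then show ?thesis using TK L
      by (intro exI[of _ T'] exI[of _ "K \<union> L"]) (auto intro!: connected_Un compact_Un)
  qed
  then obtain T K where TK: "\<And>a. a \<in> F \<Longrightarrow> open (T a) \<and> a \<in> T a \<and> S \<inter> T a \<subseteq> K a \<and> K a \<subseteq> U
      \<and> compact (K a) \<and> connected (K a) \<and> b0 \<in> K a"
    by metis
  obtain C where C: "C \<subseteq> F" "finite C" "F \<subseteq> (\<Union>c\<in>C. T c)"
    using compactE_image[OF F(1), of F T] TK by blast
  have US: "U \<subseteq> S" using U(1) openin_imp_subset by blast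
  define M where "M = {b0} \<union> (\<Union>c\<in>C. K c)"
  have "compact M" unfolding M_def using C TK by (intro compact_Un compact_UN) auto
  moreover have "connected M"
    unfolding M_def
    using C TK by (intro connected_Un_UN) auto
  moreover have "M \<subseteq> U" using C TK F by (auto simp: M_def)
  moreover have "F \<subseteq> M"
  proof
    fix y assume y: "y \<in> F"
    then obtain c where "c \<in> C" "y \<in> T c" using C(3) by auto
    moreover have "y \<in> S" using y F US by auto
    ultimately show "y \<in> M" using TK[of c] C(1) by (auto simp: M_def)
  qed
  ultimately show thesis by (intro that[of M]) (auto simp: M_def)
qed

section \<open>Small ends\<close>

text \<open>
  Suppose that every point except the base point \<open>b\<close> is a cut point, and call a component \<open>W\<close> of \<open>S - {c}\<close> that
  misses \<open>b\<close> a branch at \<open>c\<close>. Cutting at a point of a branch produces a strictly smaller branch inside it, so no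
  branch is minimal. But Zorn's lemma gives a minimal one: along a chain without least element the closures have a common point by compactness,
  this point lies in all the branches, and a branch at this point is a lower bound.
\<close>
lemma exists_noncut_point:
  fixes S :: "'a::euclidean_space set"
  assumes S: "compact S" "connected S" "locally connected S" and b: "b \<in> S" and nd: "S \<noteq> {b}"
  obtains e where "e \<in> S" "e \<noteq> b" "connected (S - {e})"
proof (rule ccontr)
  note noncut = that
  assume no: "\<not> thesis"
  have cut: "\<not> connected (S - {e})" if e: "e \<in> S" "e \<noteq> b" for e
  proof
    assume "connected (S - {e})"
    from no noncut[OF e this] show False by contradiction
  qed
  define good where "good = (\<lambda>c W. c \<in> S \<and> c \<noteq> b \<and> W \<in> components (S - {c}) \<and> b \<notin> W)"
  have exW: "\<exists>W. good c W" if c: "c \<in> S" "c \<noteq> b" for c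
  proof (rule ccontr)
    assume no: "\<not> (\<exists>W. good c W)"
    have "connected_component (S - {c}) x b" if x: "x \<in> S - {c}" for x
      using no c componentsI[OF x] by (auto simp: good_def)
    then have "connected (S - {c})"
      unfolding connected_iff_connected_component by (meson connected_component_sym connected_component_trans)
    then show False using cut[OF c] by contradiction
  qed
  have gW: "W \<subseteq> S - {c}" "W \<noteq> {}" "closure W \<subseteq> W \<union> {c}" "connected (S - W)" "connected W" if g: "good c W" for c W
  proof -
    have comp: "W \<in> components (S - {c})" using g by (simp add: good_def)
    show sub: "W \<subseteq> S - {c}" by (rule in_components_subset[OF comp])
    show "W \<noteq> {}" by (rule in_components_nonempty[OF comp])
    show "connected W" by (rule in_components_connected[OF comp])
    have "closure W \<subseteq> S" using sub S(1) by (intro closure_minimal) (auto simp: compact_imp_closed)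
    moreover have "closedin (top_of_set (S - {c})) W" by (rule closedin_component[OF comp])
    then obtain T where "closed T" "W = (S - {c}) \<inter> T" by (auto simp: closedin_closed)
    then have "(S - {c}) \<inter> closure W \<subseteq> W" using closure_minimal[of W T] by blast
    ultimately show "closure W \<subseteq> W \<union> {c}" by blast
    show "connected (S - W)"
      by (rule component_diff_connected[OF _ S(2) _ comp]) (use g in \<open>auto simp: good_def\<close>)
  qed
  have step: "W' \<subset> W" if g: "good c W" "good e W'" "e \<in> W" for c e W W'
  proof -
    have eW': "e \<notin> W'" using gW(1)[OF g(2)] by auto
    have "W' \<inter> (S - W) = {}"
    proof (rule ccontr)
      assume "W' \<inter> (S - W) \<noteq> {}"
      then obtain z where z: "z \<in> W'" "z \<in> S - W" by auto
      have "S - W \<subseteq> W'"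
      proof (rule components_maximal[of W' "S - {e}"])
        show "W' \<in> components (S - {e})" using g(2) by (simp add: good_def)
      qed (use gW(4)[OF g(1)] g(3) z in auto)
      then show False using b g by (auto simp: good_def)
    qed
    then show ?thesis using gW(1)[OF g(2)] g(3) eW' by blast
  qed
  define A where "A = {S - W |c W. good c W}"
  have "\<exists>M\<in>A. \<forall>X\<in>A. M \<subseteq> X \<longrightarrow> X = M"
  proof (rule Zorn_Lemma2, rule ballI)
    fix C assume C: "C \<in> chains A"
    have inC: "\<exists>c W. X = S - W \<and> good c W" if "X \<in> C" for X
      using subsetD[OF chainsD2[OF C] that] unfolding A_def by blast
    obtain c0 where c0: "c0 \<in> S" "c0 \<noteq> b" using b nd by auto
    show "\<exists>U\<in>A. \<forall>X\<in>C. X \<subseteq> U"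
    proof (cases "\<exists>U\<in>C. \<forall>X\<in>C. X \<subseteq> U")
      case True
      then show ?thesis using chainsD2[OF C] by blast
    next
      case False
      define F where "F = {closure W |c W. good c W \<and> S - W \<in> C}"
      have "\<Inter>F \<noteq> {}"
      proof (rule compact_chain)
        fix T assume "T \<in> F"
        then obtain c W where T: "T = closure W" "good c W" by (auto simp: F_def)
        then have "bounded W" using gW(1)[OF T(2)] S(1) by (meson Diff_subset bounded_subset compact_imp_bounded)
        then show "compact T" using T by (simp add: compact_closure)
      next
        show "{} \<notin> F" using gW(2) unfolding F_def by (auto dest!: sym[of "{}"])
      next
        fix T U assume "T \<in> F \<and> U \<in> F"
        then obtain c W d V where TU: "T = closure W" "good c W" "S - W \<in> C" "U = closure V" "good d V" "S - V \<in> C"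
          by (auto simp: F_def)
        have "S - W \<subseteq> S - V \<or> S - V \<subseteq> S - W" using chainsD[OF C] TU by blast
        then have "V \<subseteq> W \<or> W \<subseteq> V" using gW(1)[OF TU(2)] gW(1)[OF TU(5)] by blast
        then show "T \<subseteq> U \<or> U \<subseteq> T" using TU closure_mono by blast
      qed
      then obtain e where e: "\<And>T. T \<in> F \<Longrightarrow> e \<in> T" by auto
      have eW: "e \<in> W" if W: "good c W" "S - W \<in> C" for c W
      proof -
        obtain X where X: "X \<in> C" "\<not> X \<subseteq> S - W" using False W(2) by metis
        then obtain c' W' where W': "X = S - W'" "good c' W'" using inC[OF X(1)] by blast
        have "S - W \<subseteq> X" using chainsD[OF C W(2) X(1)] X(2) by auto
        then have sub: "W' \<subset> W" using gW(1)[OF W(1)] gW(1)[OF W'(2)] W'(1) X(2) by blast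
        have "c' \<noteq> c"
        proof
          assume "c' = c"
          then have "W \<in> components (S - {c})" "W' \<in> components (S - {c})" using W W' by (auto simp: good_def)
          then have "W = W' \<or> W \<inter> W' = {}" using components_eq by blast
          then show False using sub gW(2)[OF W'(2)] by blast
        qed
        moreover have "e \<in> closure W'" using W' X by (intro e) (auto simp: F_def)
        then have "e \<in> W' \<union> {c'}" using gW(3)[OF W'(2)] by auto
        moreover have "e \<in> closure W" using W by (intro e) (auto simp: F_def)
        then have "e \<in> W \<union> {c}" using gW(3)[OF W(1)] by auto
        ultimately show ?thesis using sub by auto
      qed
      show ?thesis
      proof (cases "C = {}")
        case True
        then show ?thesis using exW[OF c0] by (auto simp: A_def)
      next
        case False
        then obtain c W where W: "good c W" "S - W \<in> C" using inC by blast
        have "e \<in> W" by (rule eW[OF W])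
        then have "e \<in> S" "e \<noteq> b" using W(1) gW(1)[OF W(1)] by (auto simp: good_def)
        then obtain W' where W': "good e W'" using exW by blast
        show ?thesis
        proof (intro bexI[of _ "S - W'"] ballI)
          show "S - W' \<in> A" using W' by (auto simp: A_def)
          fix X assume X: "X \<in> C"
          then obtain d V where V: "X = S - V" "good d V" using inC by blast
          have "W' \<subset> V" by (rule step[OF V(2) W']) (use eW V X in auto)
          then show "X \<subseteq> S - W'" using V by auto
        qed
      qed
    qed
  qed
  then obtain c W where W: "good c W" and max: "\<And>X. X \<in> A \<Longrightarrow> S - W \<subseteq> X \<Longrightarrow> X = S - W"
    by (auto simp: A_def)
  obtain e where e: "e \<in> W" using gW(2)[OF W] by auto
  then have "e \<in> S" "e \<noteq> b" using W gW(1)[OF W] by (auto simp: good_def)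
  then obtain W' where W': "good e W'" using exW by blast
  have ps: "W' \<subset> W" by (rule step[OF W W' e])
  have "S - W' = S - W" by (rule max) (use W' ps in \<open>auto simp: A_def\<close>)
  then show False using ps gW(1)[OF W] by blast
qed

text \<open>
  Arbitrarily small pieces near \<open>e\<close> can be removed so that a continuum \<open>T\<close> remains and the length saved is comparable to
  the radius \<open>r\<close> of a ball that contains the piece. The comparability is what the later estimates live on. The point \<open>e'\<close> is the
  substitute for the nearest points that are removed.
\<close>
definition small_end :: "'a::metric_space set \<Rightarrow> 'a \<Rightarrow> bool" where
  "small_end S e \<longleftrightarrow> (\<forall>\<delta>>0. \<exists>r T e'. 0 < r \<and> r \<le> \<delta> \<and> compact T \<and> connected T \<and> T \<subseteq> S \<and> S - T \<subseteq> cball e r \<and>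
       e' \<in> T \<and> dist e' e \<le> r \<and> hausdorff1 T + ennreal (r/2) \<le> hausdorff1 S)"

text \<open>
  Let \<open>e\<close> be a noncut point. Everything outside a small ball around \<open>e\<close> lies in one continuum \<open>C\<close> that avoids
  \<open>e\<close>; the component \<open>V\<close> of \<open>S - C\<close> around \<open>e\<close> is the piece to remove. Its complement is connected because it is the complement of a
  component of the complement of a connected set, and the length saved is comparable to the radius of \<open>V\<close> because \<open>V\<close> is itself connected.
\<close>
lemma exists_small_end:
  fixes S :: "'a::euclidean_space set"
  assumes S: "compact S" "connected S" and fin: "hausdorff1 S < top" and b: "b \<in> S" and nd: "S \<noteq> {b}"
  obtains e where "e \<in> S" "small_end S e"
proof -
  have lc: "locally connected S" by (rule finite_length_imp_locally_connected[OF S fin])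
  obtain e where e: "e \<in> S" "e \<noteq> b" "connected (S - {e})"
    using exists_noncut_point[OF S lc b nd] by blast
  have opn: "openin (top_of_set S) (S - {e})"
    by (metis closed_singleton closedin_closed_Int Int_insert_right_if1 Int_empty_right e(1) openin_diff openin_subtopology_self)
  show thesis
  proof (rule that[OF e(1)], unfold small_end_def, intro allI impI)
    fix \<delta>0 :: real assume d0: "\<delta>0 > 0"
    define \<delta> where "\<delta> = \<delta>0 / 2"
    have d: "\<delta> > 0" using d0 by (simp add: \<delta>_def)
    have "compact (S - ball e \<delta>)" using S by (intro compact_diff) auto
    moreover have "S - ball e \<delta> \<subseteq> S - {e}" using d by auto
    moreover have "b \<in> S - {e}" using b e by auto
    ultimately obtain C where C: "compact C" "connected C" "C \<subseteq> S - {e}" "S - ball e \<delta> \<subseteq> C" "b \<in> C"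
      using locally_connected_continuum_superset[OF S(1) lc opn e(3)] by metis
    define V where "V = connected_component_set (S - C) e"
    have eSC: "e \<in> S - C" using e C by auto
    have Vc: "V \<in> components (S - C)" unfolding V_def by (rule componentsI[OF eSC])
    have eV: "e \<in> V" using eSC by (simp add: V_def)
    have Vsub: "V \<subseteq> S - C" by (rule in_components_subset[OF Vc])
    have opC: "openin (top_of_set S) (S - C)"
      using C by (intro openin_diff) (auto intro!: closed_subset compact_imp_closed)
    have opV: "openin (top_of_set S) V"
      using locally_connected_open_component[of S] lc opC Vc by blast
    have conV: "connected V" by (rule in_components_connected[OF Vc])
    define T where "T = S - V"
    have "closedin (top_of_set S) T" unfolding T_def using opV by (intro closedin_diff) auto
    then have cT: "compact T" using S(1) closedin_compact by blast
    have conT: "connected T" unfolding T_def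
      by (rule component_diff_connected[OF C(2) S(2) _ Vc]) (use C in auto)
    have Vball: "V \<subseteq> ball e \<delta>" using Vsub C(4) by auto
    define r where "r = (SUP y\<in>V. dist e y)"
    have bdd: "bdd_above (dist e ` V)" using Vball by (auto intro!: bdd_aboveI[of _ \<delta>])
    have Vr: "dist e y \<le> r" if "y \<in> V" for y unfolding r_def by (rule cSUP_upper[OF that bdd])
    have r_le: "r \<le> \<delta>" unfolding r_def using eV Vball by (intro cSUP_least) auto
    have "V \<noteq> {e}"
    proof
      assume "V = {e}"
      then have "openin (top_of_set S) {e}" using opV by simp
      moreover have "closedin (top_of_set S) {e}" using e by (intro closed_subset) auto
      ultimately have "S = {e}" using S(2) unfolding connected_clopen by blast
      then show False using b e by auto
    qed
    then obtain y0 where y0: "y0 \<in> V" "y0 \<noteq> e" using eV by auto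
    have rpos: "r > 0" using Vr[OF y0(1)] y0(2) by (metis dist_pos_lt order_less_le_trans)
    obtain y where y: "y \<in> V" "r/2 < dist e y"
      using less_cSUP_iff[of V "dist e" "r/2"] bdd eV rpos unfolding r_def[symmetric] by auto
    obtain K where K: "compact K" "connected K" "K \<subseteq> V" "e \<in> K" "y \<in> K"
      using locally_connected_continuum_join[OF S(1) lc opV conV eV y(1)] by metis
    have "hausdorff1 T + ennreal (r/2) \<le> hausdorff1 T + ennreal (dist e y)"
      using y by (intro add_left_mono ennreal_leI) auto
    also have "\<dots> \<le> hausdorff1 T + hausdorff1 K"
      using K by (intro add_left_mono hausdorff1_connected_ge_dist)
    also have "\<dots> \<le> hausdorff1 (T \<union> K)"
      using K cT by (intro hausdorff1_disjoint_compact) (auto simp: T_def)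
    also have "\<dots> \<le> hausdorff1 S"
      using K Vsub by (intro hausdorff1_mono) (auto simp: T_def)
    finally have len: "hausdorff1 T + ennreal (r/2) \<le> hausdorff1 S" .
    have "T \<inter> closure V \<noteq> {}"
    proof
      assume emp: "T \<inter> closure V = {}"
      have VS: "V \<subseteq> S" using Vsub by auto
      have "closure V \<subseteq> S" using VS S(1) by (intro closure_minimal) (auto simp: compact_imp_closed)
      then have "closure V = V" using emp closure_subset[of V] by (auto simp: T_def)
      then have "closedin (top_of_set S) V" using VS by (metis closed_closure closed_subset)
      then have "V = S" using S(2) opV eV unfolding connected_clopen by blast
      then show False using Vsub C(5) b by auto
    qed
    then obtain e' where e': "e' \<in> T" "e' \<in> closure V" by auto
    have "closure V \<subseteq> cball e r" by (rule closure_minimal) (use Vr in auto)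
    then have "dist e' e \<le> r" using e' by (auto simp: dist_commute)
    moreover have "S - T \<subseteq> cball e r" using Vr by (auto simp: T_def)
    moreover have "r \<le> \<delta>0" using r_le d0 by (simp add: \<delta>_def)
    ultimately show "\<exists>r T e'. 0 < r \<and> r \<le> \<delta>0 \<and> compact T \<and> connected T \<and> T \<subseteq> S \<and> S - T \<subseteq> cball e r \<and>
       e' \<in> T \<and> dist e' e \<le> r \<and> hausdorff1 T + ennreal (r/2) \<le> hausdorff1 S"
      using rpos cT conT e' len by (intro exI[of _ r] exI[of _ T] exI[of _ e']) (auto simp: T_def)
  qed
qed

section \<open>Measures that are small on balls\<close>

text \<open>
  The complement of the support is a union of open null balls, of which countably many suffice (Lindelof).
\<close>
lemma AE_in_measure_support:
  fixes \<mu> :: "'a::{metric_space,second_countable_topology} measure"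
  assumes "sets \<mu> = sets borel"
  shows "AE x in \<mu>. x \<in> measure_support \<mu>"
proof -
  have "\<exists>\<epsilon>>0. emeasure \<mu> (ball x \<epsilon>) = 0" if "x \<notin> measure_support \<mu>" for x
    using that by (auto simp: measure_support_def)
  then obtain \<epsilon> where \<epsilon>: "\<And>x. x \<notin> measure_support \<mu> \<Longrightarrow> \<epsilon> x > 0 \<and> emeasure \<mu> (ball x (\<epsilon> x)) = 0"
    by metis
  define F where "F = (\<lambda>x. ball x (\<epsilon> x)) ` (- measure_support \<mu>)"
  obtain F' where F': "F' \<subseteq> F" "countable F'" "\<Union>F' = \<Union>F"
    using Lindelof[of F] by (auto simp: F_def)
  have "(\<Union>B\<in>F'. B) \<in> null_sets \<mu>"
  proof (rule null_sets_UN')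
    fix B assume "B \<in> F'"
    then obtain x where "x \<notin> measure_support \<mu>" "B = ball x (\<epsilon> x)" using F'(1) by (auto simp: F_def)
    then show "B \<in> null_sets \<mu>" using \<epsilon> assms by (auto simp: null_sets_def)
  qed (rule F'(2))
  moreover have "{x \<in> space \<mu>. x \<notin> measure_support \<mu>} \<subseteq> (\<Union>B\<in>F'. B)"
  proof clarsimp
    fix x assume "x \<notin> measure_support \<mu>"
    then have "x \<in> \<Union>F" using \<epsilon>[of x] unfolding F_def by (intro UnionI[of "ball x (\<epsilon> x)"]) auto
    then show "\<exists>B\<in>F'. x \<in> B" using F'(3) by auto
  qed
  ultimately show ?thesis by (rule AE_I')
qed

text \<open>
  Replace each set of a fine cover by a ball whose radius is about twice its diameter around a point of \<open>A\<close>. The summand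
  \<open>(h/3) * (1/2)^i\<close> in the radius takes care of covering sets of diameter zero.
\<close>
lemma small_ball_cover:
  fixes \<mu> :: "'a::metric_space measure"
  assumes sets: "sets \<mu> = sets borel" and "finite_measure \<mu>"
    and len: "hausdorff1 S \<le> ennreal l" "l \<ge> 0" and \<tau>: "\<tau> > 0" and h: "h > 0"
    and A: "A \<subseteq> S" "\<And>x s. x \<in> A \<Longrightarrow> 0 < s \<Longrightarrow> s \<le> h \<Longrightarrow> measure \<mu> (ball x s) \<le> \<tau> * s"
  obtains U where "U \<in> sets \<mu>" "A \<subseteq> U" "emeasure \<mu> U \<le> ennreal (\<tau> * (2 * l + 4 + 2 * h))"
proof -
  interpret finite_measure \<mu> by fact
  have "hausdorff1_content (h/3) S \<le> hausdorff1 S" using h by (intro hausdorff1_content_le) auto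
  also have "\<dots> < ennreal (l + 1)" using len by (simp add: ennreal_lessI order_le_less_trans)
  finally obtain C where C: "S \<subseteq> (\<Union>i::nat. C i)" "\<And>i. bounded (C i)" "\<And>i. diameter (C i) \<le> h/3"
     "(\<Sum>i. ennreal (diameter (C i))) < ennreal (l + 1)"
    using hausdorff1_content_cover by metis
  define \<rho> where "\<rho> = (\<lambda>i. 2 * diameter (C i) + (h/3) * (1/2)^i)"
  have dge: "diameter (C i) \<ge> 0" for i using C(2) by (rule diameter_ge_0)
  have \<rho>: "0 < \<rho> i" "\<rho> i \<le> h" for i
  proof -
    show "0 < \<rho> i" unfolding \<rho>_def using h dge by (intro add_nonneg_pos) auto
    have "(h/3) * (1/2)^i \<le> (h/3) * 1" using h by (intro mult_left_mono power_le_one) auto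
    then show "\<rho> i \<le> h" unfolding \<rho>_def using C(3)[of i] by linarith
  qed
  define y where "y = (\<lambda>i. SOME x. x \<in> C i \<inter> A)"
  have y: "y i \<in> C i \<inter> A" if "C i \<inter> A \<noteq> {}" for i
    unfolding y_def using that by (metis someI_ex ex_in_conv)
  define B where "B = (\<lambda>i. if C i \<inter> A = {} then {} else ball (y i) (\<rho> i))"
  have Bsets: "B i \<in> sets \<mu>" for i by (auto simp: B_def sets)
  have Bm: "emeasure \<mu> (B i) \<le> ennreal (2 * \<tau>) * ennreal (diameter (C i)) + ennreal (\<tau> * (h/3) * (1/2)^i)" for i
  proof (cases "C i \<inter> A = {}")
    case False
    have "emeasure \<mu> (B i) = ennreal (measure \<mu> (ball (y i) (\<rho> i)))"
      using False by (simp add: B_def emeasure_eq_measure)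
    also have "\<dots> \<le> ennreal (\<tau> * \<rho> i)" using A(2)[of "y i" "\<rho> i"] y[OF False] \<rho> by (intro ennreal_leI) auto
    also have "\<tau> * \<rho> i = 2 * \<tau> * diameter (C i) + \<tau> * (h/3) * (1/2)^i" by (simp add: \<rho>_def algebra_simps)
    also have "ennreal \<dots> = ennreal (2 * \<tau>) * ennreal (diameter (C i)) + ennreal (\<tau> * (h/3) * (1/2)^i)"
      using \<tau> h dge by (simp add: ennreal_plus ennreal_mult)
    finally show ?thesis .
  qed (simp add: B_def)
  show thesis
  proof (rule that[of "\<Union>i. B i"])
    show "(\<Union>i. B i) \<in> sets \<mu>" using Bsets by auto
    show "A \<subseteq> (\<Union>i. B i)"
    proof
      fix x assume x: "x \<in> A"
      then obtain i where i: "x \<in> C i" using A(1) C(1) by auto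
      then have ne: "C i \<inter> A \<noteq> {}" using x by auto
      have "dist (y i) x \<le> diameter (C i)" using i y[OF ne] C(2) by (intro diameter_bounded_bound) auto
      also have "\<dots> < \<rho> i" unfolding \<rho>_def using dge[of i] h by (simp add: add_nonneg_pos)
      finally have "x \<in> B i" using ne by (simp add: B_def)
      then show "x \<in> (\<Union>i. B i)" by blast
    qed
    have "(\<lambda>i. (1/2::real)^i) sums 2" using geometric_sums[of "1/2::real"] by simp
    then have geo: "(\<lambda>i. \<tau> * (h/3) * (1/2)^i) sums (\<tau> * (h/3) * 2)" by (rule sums_mult)
    have "emeasure \<mu> (\<Union>i. B i) \<le> (\<Sum>i. emeasure \<mu> (B i))"
      using Bsets by (intro emeasure_subadditive_countably) auto
    also have "\<dots> \<le> (\<Sum>i. ennreal (2 * \<tau>) * ennreal (diameter (C i)) + ennreal (\<tau> * (h/3) * (1/2)^i))"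
      using Bm by (intro suminf_le) auto
    also have "\<dots> = (\<Sum>i. ennreal (2 * \<tau>) * ennreal (diameter (C i))) + (\<Sum>i. ennreal (\<tau> * (h/3) * (1/2)^i))"
      by (intro suminf_add[symmetric]) auto
    also have "(\<Sum>i. ennreal (2 * \<tau>) * ennreal (diameter (C i))) = ennreal (2 * \<tau>) * (\<Sum>i. ennreal (diameter (C i)))"
      by (rule ennreal_suminf_cmult)
    also have "(\<Sum>i. ennreal (\<tau> * (h/3) * (1/2)^i)) = ennreal (\<tau> * (h/3) * 2)"
      using geo \<tau> h by (intro suminf_ennreal_eq) auto
    also have "ennreal (2 * \<tau>) * (\<Sum>i. ennreal (diameter (C i))) + ennreal (\<tau> * (h/3) * 2)
        \<le> ennreal (2 * \<tau>) * ennreal (l + 1) + ennreal (\<tau> * (h/3) * 2)"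
      using C(4) by (intro add_mono mult_left_mono) auto
    also have "\<dots> = ennreal (2 * \<tau> * (l + 1) + \<tau> * (h/3) * 2)"
      using \<tau> len h by (simp add: ennreal_plus ennreal_mult)
    also have "\<dots> \<le> ennreal (\<tau> * (2 * l + 4 + 2 * h))"
    proof (rule ennreal_leI)
      have "2 * (l + 1) + (h/3) * 2 \<le> 2 * l + 4 + 2 * h" using h by simp
      then have "\<tau> * (2 * (l + 1) + (h/3) * 2) \<le> \<tau> * (2 * l + 4 + 2 * h)" using \<tau> by (intro mult_left_mono) auto
      then show "2 * \<tau> * (l + 1) + \<tau> * (h/3) * 2 \<le> \<tau> * (2 * l + 4 + 2 * h)" by (simp add: algebra_simps)
    qed
    finally show "emeasure \<mu> (\<Union>i. B i) \<le> ennreal (\<tau> * (2 * l + 4 + 2 * h))" .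
  qed
qed

text \<open>
  A density argument. Fix \<open>\<tau> > 0\<close>. The points at which balls of radius at most \<open>1/(k+1)\<close> have measure at most
  \<open>\<tau>\<close> times their radius increase to \<open>S\<close>, and each of these sets lies in an open set of measure at most a constant times \<open>\<tau>\<close>. These sets
  are not known to be measurable, hence the passage through the measurable sets \<open>V k\<close>.
\<close>
lemma small_balls_imp_null_on_finite_length:
  fixes \<mu> :: "'a::metric_space measure"
  assumes sets: "sets \<mu> = sets borel" and fin: "finite_measure \<mu>"
    and small: "\<And>x. (\<lambda>\<epsilon>. measure \<mu> (ball x \<epsilon>)) \<in> o[at_right 0](\<lambda>\<epsilon>. \<epsilon>)"
    and len: "hausdorff1 S \<le> ennreal l" "l \<ge> 0" and S: "S \<in> sets borel"
  shows "emeasure \<mu> S = 0"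
proof -
  interpret finite_measure \<mu> by fact
  have bound: "emeasure \<mu> S \<le> ennreal (\<tau> * (2 * l + 6))" if \<tau>: "\<tau> > 0" for \<tau>
  proof -
    define A where "A = (\<lambda>k::nat. {x \<in> S. \<forall>s. 0 < s \<longrightarrow> s \<le> 1 / Suc k \<longrightarrow> measure \<mu> (ball x s) \<le> \<tau> * s})"
    have "\<exists>U. U \<in> sets \<mu> \<and> A k \<subseteq> U \<and> emeasure \<mu> U \<le> ennreal (\<tau> * (2 * l + 6))" for k
    proof -
      obtain U where U: "U \<in> sets \<mu>" "A k \<subseteq> U" "emeasure \<mu> U \<le> ennreal (\<tau> * (2 * l + 4 + 2 * (1 / Suc k)))"
        by (rule small_ball_cover[OF sets fin len \<tau>, of "1 / Suc k" "A k"]) (auto simp: A_def)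
      have "\<tau> * (2 * l + 4 + 2 * (1 / Suc k)) \<le> \<tau> * (2 * l + 6)" 
      proof (rule mult_left_mono)
        have "1 / real (Suc k) \<le> 1" by simp
        then show "2 * l + 4 + 2 * (1 / Suc k) \<le> 2 * l + 6" by linarith
      qed (use \<tau> in auto)
      then have "ennreal (\<tau> * (2 * l + 4 + 2 * (1 / Suc k))) \<le> ennreal (\<tau> * (2 * l + 6))" by (rule ennreal_leI)
      then show ?thesis using U by (meson order_trans)
    qed
    then obtain U where U: "\<And>k. U k \<in> sets \<mu>" "\<And>k. A k \<subseteq> U k" "\<And>k. emeasure \<mu> (U k) \<le> ennreal (\<tau> * (2 * l + 6))"
      by metis
    define V where "V = (\<lambda>k. \<Inter>j\<in>{k..}. U j)"
    have Vs: "V k \<in> sets \<mu>" for k unfolding V_def using U(1) by (intro sets.countable_INT') auto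
    have inc: "incseq V" unfolding V_def incseq_def by (auto intro!: INT_anti_mono)
    have mono: "A k \<subseteq> A j" if "k \<le> j" for k j
    proof -
      have "1 / real (Suc j) \<le> 1 / real (Suc k)" using that by (intro divide_left_mono) auto
      then show ?thesis unfolding A_def by force
    qed
    have "S \<subseteq> (\<Union>k. V k)"
    proof
      fix x assume x: "x \<in> S"
      have "eventually (\<lambda>s. norm (measure \<mu> (ball x s)) \<le> \<tau> * norm s) (at_right 0)"
        using landau_o.smallD[OF small \<tau>] by blast
      then obtain s0 where s0: "s0 > 0" "\<And>s. 0 < s \<Longrightarrow> s < s0 \<Longrightarrow> measure \<mu> (ball x s) \<le> \<tau> * s"
        unfolding eventually_at_right_field by auto
      obtain k where "inverse (real (Suc k)) < s0" using reals_Archimedean s0(1) by blast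
      then have "x \<in> A k" using x s0(2) by (auto simp: A_def inverse_eq_divide)
      then have "x \<in> V k" unfolding V_def using mono U(2) by fastforce
      then show "x \<in> (\<Union>k. V k)" by blast
    qed
    then have "emeasure \<mu> S \<le> emeasure \<mu> (\<Union>k. V k)" by (rule emeasure_mono) (use Vs in auto)
    also have "\<dots> = (SUP k. emeasure \<mu> (V k))" using Vs inc by (intro SUP_emeasure_incseq[symmetric]) auto
    also have "\<dots> \<le> ennreal (\<tau> * (2 * l + 6))"
    proof (rule SUP_least)
      fix k have "emeasure \<mu> (V k) \<le> emeasure \<mu> (U k)" by (rule emeasure_mono) (auto simp: V_def U)
      then show "emeasure \<mu> (V k) \<le> ennreal (\<tau> * (2 * l + 6))" using U(3) by (rule order_trans)
    qed
    finally show ?thesis .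
  qed
  have "emeasure \<mu> S \<le> 0"
  proof (rule ennreal_le_epsilon)
    fix e :: real assume "e > 0"
    then show "emeasure \<mu> S \<le> 0 + ennreal e" using bound[of "e / (2 * l + 6)"] len by simp
  qed
  then show ?thesis by simp
qed

section \<open>The penalty function\<close>

text \<open>
  A locally Lipschitz function is Lipschitz on the compact interval, and the mean value theorem turns this into the
  quadratic bound.
\<close>
lemma C11_loc_uniform:
  assumes der: "\<And>t. t \<ge> 0 \<Longrightarrow> (\<phi> has_real_derivative \<phi>' t) (at t within {0..})"
    and lip: "\<And>t. t \<ge> 0 \<Longrightarrow> \<exists>r>0. \<exists>L. L-lipschitz_on (cball t r \<inter> {0..}) \<phi>'"
  obtains K where "K \<ge> 0"
    "\<And>s t. s \<in> {0..D} \<Longrightarrow> t \<in> {0..D} \<Longrightarrow> \<bar>\<phi> t - \<phi> s - \<phi>' s * (t - s)\<bar> \<le> K * (t - s)\<^sup>2"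
    "\<And>s t. s \<in> {0..D} \<Longrightarrow> t \<in> {0..D} \<Longrightarrow> \<bar>\<phi>' s - \<phi>' t\<bar> \<le> K * \<bar>s - t\<bar>"
proof -
  have ll: "local_lipschitz {0::real} {0..D} (\<lambda>_. \<phi>')"
  proof (rule local_lipschitzI)
    fix x :: real and t :: real assume x: "x \<in> {0..D}"
    obtain r L where r: "r > 0" "L-lipschitz_on (cball x r \<inter> {0..}) \<phi>'" using lip[of x] x by auto
    have "L-lipschitz_on (cball x r \<inter> {0..D}) \<phi>'" by (rule lipschitz_on_subset[OF r(2)]) auto
    then show "\<exists>u>0. \<exists>L. \<forall>t\<in>cball t u \<inter> {0}. L-lipschitz_on (cball x u \<inter> {0..D}) \<phi>'" using r(1) by blast
  qed
  obtain L where L: "\<And>t. t \<in> {0::real} \<Longrightarrow> L-lipschitz_on {0..D} \<phi>'"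
    by (rule local_lipschitz_compact_implies_lipschitz[OF ll compact_Icc compact_sing]) auto
  then have L': "L-lipschitz_on {0..D} \<phi>'" by simp
  then have L0: "L \<ge> 0" by (rule lipschitz_on_nonneg)
  have lipL: "\<bar>\<phi>' s - \<phi>' t\<bar> \<le> L * \<bar>s - t\<bar>" if "s \<in> {0..D}" "t \<in> {0..D}" for s t
    using lipschitz_onD[OF L' that] by (simp add: dist_real_def)
  have cont: "continuous_on {0..} \<phi>"
    by (rule DERIV_continuous_on) (use der in auto)
  have der': "(\<phi> has_real_derivative \<phi>' z) (at z)" if "z > 0" for z
  proof -
    have "at z within {0..} = at z" by (rule at_within_open_subset[of z "{0<..}"]) (use that in auto)
    then show ?thesis using der[of z] that by simp
  qed
  have "\<bar>\<phi> t - \<phi> s - \<phi>' s * (t - s)\<bar> \<le> L * (t - s)\<^sup>2" if st: "s \<in> {0..D}" "t \<in> {0..D}" for s t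
  proof (cases "s = t")
    case False
    define a b where "a = min s t" and "b = max s t"
    have ab: "a < b" "a \<ge> 0" "b \<le> D" using False st by (auto simp: a_def b_def)
    have "\<exists>l z. a < z \<and> z < b \<and> DERIV \<phi> z :> l \<and> \<phi> b - \<phi> a = (b - a) * l"
    proof (rule MVT[OF ab(1)])
      show "continuous_on {a..b} \<phi>" using ab by (intro continuous_on_subset[OF cont]) auto
      fix x assume "a < x" "x < b"
      then show "\<phi> differentiable (at x)" using der'[of x] ab by (auto simp: real_differentiable_def)
    qed
    then obtain l z where z: "a < z" "z < b" "DERIV \<phi> z :> l" "\<phi> b - \<phi> a = (b - a) * l" by metis
    have "l = \<phi>' z" using z ab der'[of z] DERIV_unique by fastforce
    then have "\<phi> t - \<phi> s = (t - s) * \<phi>' z" using z(4) False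
      by (auto simp: a_def b_def min_def max_def algebra_simps split: if_splits)
    then have "\<phi> t - \<phi> s - \<phi>' s * (t - s) = (\<phi>' z - \<phi>' s) * (t - s)" by (simp add: algebra_simps)
    then have "\<bar>\<phi> t - \<phi> s - \<phi>' s * (t - s)\<bar> = \<bar>\<phi>' z - \<phi>' s\<bar> * \<bar>t - s\<bar>" by (simp add: abs_mult)
    also have "\<dots> \<le> (L * \<bar>z - s\<bar>) * \<bar>t - s\<bar>" using z ab st by (intro mult_right_mono lipL) auto
    also have "\<dots> \<le> (L * \<bar>t - s\<bar>) * \<bar>t - s\<bar>"
      using z L0 by (intro mult_right_mono mult_left_mono) (auto simp: a_def b_def)
    finally show ?thesis by (simp add: power2_eq_square abs_mult_self_eq mult.assoc)
  qed auto
  then show thesis using that[OF L0] lipL by blast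
qed

section \<open>First variation of the average distance\<close>

text \<open>
  A minimizer \<open>S\<close> with the hypotheses in the form in which they are used. Measure and minimizer lie in the ball of
  radius \<open>\<rho>\<close>, and all competitors will lie in the ball of radius \<open>\<rho> + 3\<close>, so that only the distances in \<open>{0..2*\<rho>+3}\<close> matter; on this
  range \<open>K\<close> bounds the second-order error and \<open>W\<close> the slope.
\<close>
locale avg_dist_minimizer = prob_space \<mu> for \<mu> :: "'a::euclidean_space measure" +
  fixes \<phi> \<phi>' :: "real \<Rightarrow> real" and S :: "'a set" and l \<rho> K W :: real
  assumes sets_borel: "sets \<mu> = sets borel"
    and AE_bounded: "AE x in \<mu>. norm x \<le> \<rho>"
    and S_bounded: "S \<subseteq> cball 0 \<rho>"
    and mono: "\<And>s t. 0 \<le> s \<Longrightarrow> s \<le> t \<Longrightarrow> \<phi> s \<le> \<phi> t"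
    and deriv: "\<And>t. t \<ge> 0 \<Longrightarrow> (\<phi> has_real_derivative \<phi>' t) (at t within {0..})"
    and K_nonneg: "K \<ge> 0"
    and taylor: "\<And>s t. s \<in> {0..2*\<rho>+3} \<Longrightarrow> t \<in> {0..2*\<rho>+3} \<Longrightarrow> \<phi> t - \<phi> s \<le> \<phi>' s * (t - s) + K * (t - s)\<^sup>2"
    and lipschitz: "\<And>s t. 0 \<le> s \<Longrightarrow> s \<le> t \<Longrightarrow> t \<le> 2*\<rho>+3 \<Longrightarrow> \<phi> t - \<phi> s \<le> W * (t - s)"
    and deriv_bounds: "\<And>s. s \<in> {0..2*\<rho>+3} \<Longrightarrow> 0 \<le> \<phi>' s \<and> \<phi>' s \<le> W"
    and deriv_cont: "continuous_on {0..} \<phi>'"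
    and admissible: "S \<in> continua_le l"
    and minimal: "\<And>T. T \<in> continua_le l \<Longrightarrow> avg_dist \<mu> \<phi> S \<le> avg_dist \<mu> \<phi> T"
    and AE_notin: "AE x in \<mu>. x \<notin> S"
begin

lemma S_props: "S \<noteq> {}" "compact S" "connected S" "hausdorff1 S \<le> ennreal l"
  using admissible by (auto simp: continua_le_def)

lemma S_closed: "closed S" using S_props by (simp add: compact_imp_closed)

lemma space_UNIV [simp]: "space \<mu> = UNIV"
  using sets_eq_imp_space_eq[OF sets_borel] by simp

lemma prob_UNIV [simp]: "prob UNIV = 1"
  using prob_space by simp

lemma measurable_borel: "(f \<in> borel_measurable \<mu>) = (f \<in> borel_measurable borel)"
  by (rule measurable_cong_sets[OF sets_borel refl, THEN arg_cong])

lemma \<rho>_nonneg: "\<rho> \<ge> 0"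
proof -
  obtain s where "s \<in> S" using S_props by auto
  then have "norm s \<le> \<rho>" using S_bounded by auto
  then show ?thesis using norm_ge_zero order_trans by blast
qed

lemma W_nonneg: "W \<ge> 0" using deriv_bounds[of 0] \<rho>_nonneg by auto

text \<open>
  The rate at which the integrand grows with the distance to the minimizer. It may vanish, so it has to be carried
  through all estimates.
\<close>
definition weight :: "'a \<Rightarrow> real" where "weight x = \<phi>' (infdist x S)"

abbreviation dS :: "'a \<Rightarrow> real" where "dS x \<equiv> infdist x S"

lemma phi_cont: "continuous_on {0..} \<phi>"
  by (rule DERIV_continuous_on) (use deriv in auto)

lemma continuous_infdist_comp:
  assumes "continuous_on {0..} f"
  shows "continuous_on UNIV (\<lambda>x. f (infdist x T))"
  by (rule continuous_on_compose2[OF assms]) (auto intro!: continuous_intros simp: infdist_nonneg)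

lemma measurable_infdist_comp:
  "continuous_on {0..} f \<Longrightarrow> (\<lambda>x. f (infdist x T)) \<in> borel_measurable borel"
  by (intro borel_measurable_continuous_onI continuous_infdist_comp)

lemma weight_measurable [measurable]: "weight \<in> borel_measurable borel"
  unfolding weight_def[abs_def] by (rule measurable_infdist_comp[OF deriv_cont])

lemma infdist_le_bound:
  assumes "norm x \<le> \<rho>" "T \<noteq> {}" "T \<subseteq> cball 0 (\<rho> + 3)"
  shows "infdist x T \<le> 2 * \<rho> + 3"
proof -
  obtain y where y: "y \<in> T" using assms by auto
  have "infdist x T \<le> dist x y" by (rule infdist_le[OF y])
  also have "\<dots> \<le> norm x + norm y" by (simp add: dist_norm norm_triangle_ineq4)
  also have "\<dots> \<le> \<rho> + (\<rho> + 3)" using assms y by (intro add_mono) auto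
  finally show ?thesis by simp
qed

lemma S_bounded_plus: "S \<subseteq> cball 0 (\<rho> + 3)"
  using S_bounded subset_cball[of \<rho> "\<rho> + 3" 0] by auto

lemma infdist_S_bound: "norm x \<le> \<rho> \<Longrightarrow> dS x \<in> {0..2*\<rho>+3}"
  using infdist_le_bound[OF _ S_props(1) S_bounded_plus] by (auto simp: infdist_nonneg)

lemma weight_bounds: "norm x \<le> \<rho> \<Longrightarrow> 0 \<le> weight x \<and> weight x \<le> W"
  unfolding weight_def using deriv_bounds infdist_S_bound by blast

lemma integrable_bounded:
  fixes f :: "'a \<Rightarrow> real"
  assumes "f \<in> borel_measurable borel" "AE x in \<mu>. \<bar>f x\<bar> \<le> B"
  shows "integrable \<mu> f"
  by (rule integrable_const_bound[of _ B]) (use assms in \<open>auto simp: measurable_borel\<close>)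

lemma integrable_phi_infdist:
  assumes "T \<noteq> {}" "T \<subseteq> cball 0 (\<rho> + 3)"
  shows "integrable \<mu> (\<lambda>x. \<phi> (infdist x T))"
proof (rule integrable_bounded)
  show "(\<lambda>x. \<phi> (infdist x T)) \<in> borel_measurable borel" by (rule measurable_infdist_comp[OF phi_cont])
  show "AE x in \<mu>. \<bar>\<phi> (infdist x T)\<bar> \<le> \<bar>\<phi> 0\<bar> + \<bar>\<phi> (2*\<rho>+3)\<bar>"
    using AE_bounded
  proof eventually_elim
    case (elim x)
    have "\<phi> 0 \<le> \<phi> (infdist x T)" by (intro mono) (auto simp: infdist_nonneg)
    moreover have "\<phi> (infdist x T) \<le> \<phi> (2*\<rho>+3)"
      using infdist_le_bound[OF elim assms] by (intro mono) (auto simp: infdist_nonneg)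
    ultimately show ?case by linarith
  qed
qed

lemma integrable_increment:
  assumes "T \<noteq> {}" "T \<subseteq> cball 0 (\<rho> + 3)"
  shows "integrable \<mu> (\<lambda>x. \<phi> (infdist x T) - \<phi> (dS x))"
  using integrable_phi_infdist[OF assms] integrable_phi_infdist[OF S_props(1) S_bounded_plus]
  by (rule Bochner_Integration.integrable_diff)

lemma increment_nonneg:
  assumes "T \<in> continua_le l" "T \<subseteq> cball 0 (\<rho> + 3)"
  shows "0 \<le> (\<integral>x. \<phi> (infdist x T) - \<phi> (dS x) \<partial>\<mu>)"
proof -
  have "T \<noteq> {}" using assms by (simp add: continua_le_def)
  then have "(\<integral>x. \<phi> (infdist x T) - \<phi> (dS x) \<partial>\<mu>) = avg_dist \<mu> \<phi> T - avg_dist \<mu> \<phi> S"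
    unfolding avg_dist_def
    using integrable_phi_infdist assms(2) S_props(1) S_bounded_plus by (intro Bochner_Integration.integral_diff) auto
  then show ?thesis using minimal[OF assms(1)] by simp
qed

lemma nearest_exists: obtains \<sigma> where "\<sigma> \<in> S" "dist x \<sigma> = dS x"
  using infdist_attains_inf[OF S_closed S_props(1), of x] by metis

lemma nearest_le: "\<sigma> \<in> S \<Longrightarrow> dS x \<le> dist x \<sigma>" by (rule infdist_le)

lemma DERIV_phi_norm:
  fixes v \<xi> :: 'a
  assumes v: "v \<noteq> 0"
  shows "((\<lambda>t. \<phi> (norm (v - t *\<^sub>R \<xi>))) has_real_derivative (- (\<phi>' (norm v) * ((v \<bullet> \<xi>) / norm v)))) (at 0)"
proof -
  have "((\<lambda>t. norm (v - t *\<^sub>R \<xi>)) has_derivative (\<lambda>h. (- (h *\<^sub>R \<xi>)) \<bullet> sgn v)) (at 0)"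
  proof -
    have "((\<lambda>t. v - t *\<^sub>R \<xi>) has_derivative (\<lambda>h. - (h *\<^sub>R \<xi>))) (at 0)"
      by (auto intro!: derivative_eq_intros)
    moreover have "(norm has_derivative (\<lambda>h. h \<bullet> sgn v)) (at (v - 0 *\<^sub>R \<xi>))"
      using v has_derivative_norm by (metis diff_zero scaleR_zero_left)
    ultimately show ?thesis using has_derivative_compose by blast
  qed
  then have 1: "((\<lambda>t. norm (v - t *\<^sub>R \<xi>)) has_real_derivative (- ((v \<bullet> \<xi>) / norm v))) (at 0)"
    unfolding has_field_derivative_def
    by (rule has_derivative_eq_rhs) (auto simp: fun_eq_iff sgn_div_norm inner_commute field_simps)
  have "norm v > 0" using v by simp
  then have "at (norm v) within {0..} = at (norm v)"
    by (intro at_within_open_subset[of _ "{0<..}"]) auto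
  then have "(\<phi> has_real_derivative \<phi>' (norm v)) (at (norm (v - 0 *\<^sub>R \<xi>)))"
    using deriv[of "norm v"] by simp
  from DERIV_chain2[OF this 1] show ?thesis by simp
qed

text \<open>
  The variation inequality in a form that fits all uses. Competitors \<open>T n\<close> at distance of order \<open>t n\<close> move a nearest point
  \<open>\<sigma>\<close> of almost every \<open>x\<close> by \<open>t n *\<^sub>R \<xi> \<sigma>\<close>, so the difference quotient of the integrand is at most a quantity that tends to
  \<open>- weight x * g x\<close>, whereas its integral is nonnegative by minimality. Only an upper bound on the quotients is available, so the limit is taken
  by Fatou's lemma for \<open>B\<close> minus the quotients. The nearest point \<open>\<sigma>\<close> may depend on \<open>x\<close> in a non-measurable way.
\<close>
lemma first_variation:
  fixes T :: "nat \<Rightarrow> 'a set"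
  assumes t: "\<And>n. t n > 0" "t \<longlonglongrightarrow> 0"
    and T: "\<And>n. T n \<in> continua_le l" "\<And>n. T n \<subseteq> cball 0 (\<rho> + 3)"
    and near: "\<And>n x. x \<in> S \<Longrightarrow> infdist x (T n) \<le> C * t n"
    and g: "g \<in> borel_measurable borel" "AE x in \<mu>. \<bar>g x\<bar> \<le> G"
    and move: "AE x in \<mu>. \<exists>\<sigma>\<in>S. dist x \<sigma> = dS x \<and> eventually (\<lambda>n. \<sigma> + t n *\<^sub>R \<xi> \<sigma> \<in> T n) sequentially \<and>
        weight x * g x = weight x * (((x - \<sigma>) \<bullet> \<xi> \<sigma>) / dS x)"
  shows "(\<integral>x. weight x * g x \<partial>\<mu>) \<le> 0"
proof -
  have C: "C \<ge> 0"
  proof -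
    obtain s where "s \<in> S" using S_props by auto
    then have "0 \<le> C * t 0" using near[of s 0] infdist_nonneg order_trans by blast
    then show ?thesis using t(1)[of 0] by (simp add: zero_le_mult_iff)
  qed
  have wg: "AE x in \<mu>. \<bar>weight x * g x\<bar> \<le> W * \<bar>G\<bar>"
    using AE_bounded g(2)
  proof eventually_elim
    case (elim x)
    then show ?case using weight_bounds[of x] by (auto simp: abs_mult intro!: mult_mono)
  qed
  have wgm: "(\<lambda>x. weight x * g x) \<in> borel_measurable borel" using g(1) by measurable
  \<comment> \<open>Dominates both the difference quotients and the limit \<open>weight x * g x\<close>.\<close>
  define B where "B = W * C + W * \<bar>G\<bar>"
  have B: "B \<ge> 0" unfolding B_def using C W_nonneg by auto
  define h where "h = (\<lambda>n x. (\<phi> (infdist x (T n)) - \<phi> (dS x)) / t n)"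
  have Tne: "T n \<noteq> {}" for n using T(1)[of n] by (simp add: continua_le_def)
  have hint: "integrable \<mu> (h n)" for n
    unfolding h_def using integrable_increment[OF Tne T(2)] by (intro integrable_divide)
  have hle: "AE x in \<mu>. h n x \<le> W * C" for n
    using AE_bounded
  proof eventually_elim
    case (elim x)
    obtain \<sigma> where \<sigma>: "\<sigma> \<in> S" "dist x \<sigma> = dS x" by (rule nearest_exists)
    have le: "infdist x (T n) \<le> dS x + C * t n"
      using infdist_triangle[of x "T n" \<sigma>] near[OF \<sigma>(1), of n] \<sigma>(2) by linarith
    have "\<phi> (infdist x (T n)) - \<phi> (dS x) \<le> W * (C * t n)"
    proof (cases "infdist x (T n) \<le> dS x")
      case True
      then have "\<phi> (infdist x (T n)) \<le> \<phi> (dS x)" by (intro mono) (auto simp: infdist_nonneg)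
      moreover have "0 \<le> W * (C * t n)" using W_nonneg C t(1)[of n] by (intro mult_nonneg_nonneg) auto
      ultimately show ?thesis by linarith
    next
      case False
      then have "\<phi> (infdist x (T n)) - \<phi> (dS x) \<le> W * (infdist x (T n) - dS x)"
        using infdist_le_bound[OF elim Tne T(2)] by (intro lipschitz) (auto simp: infdist_nonneg)
      also have "\<dots> \<le> W * (C * t n)" using le W_nonneg by (intro mult_left_mono) auto
      finally show ?thesis .
    qed
    then show ?case unfolding h_def using t(1)[of n] by (simp add: divide_simps mult_ac)
  qed
  have hm: "h n \<in> borel_measurable \<mu>" for n using hint by auto
  have "(\<integral>\<^sup>+x. liminf (\<lambda>n. ennreal (B - h n x)) \<partial>\<mu>) \<le> liminf (\<lambda>n. \<integral>\<^sup>+x. ennreal (B - h n x) \<partial>\<mu>)"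
    using hm by (intro nn_integral_liminf) auto
  also have "\<dots> \<le> ennreal B"
  proof -
    have "(\<integral>\<^sup>+x. ennreal (B - h n x) \<partial>\<mu>) \<le> ennreal B" for n
    proof -
      have "(\<integral>\<^sup>+x. ennreal (B - h n x) \<partial>\<mu>) = ennreal (\<integral>x. B - h n x \<partial>\<mu>)"
      proof (rule nn_integral_eq_integral)
        show "AE x in \<mu>. 0 \<le> B - h n x" using hle[of n]
        proof eventually_elim
          case (elim x)
          have "0 \<le> W * \<bar>G\<bar>" using W_nonneg by simp
          then show ?case using elim unfolding B_def by linarith
        qed
      qed (use hint in auto)
      also have "(\<integral>x. B - h n x \<partial>\<mu>) = B - (\<integral>x. h n x \<partial>\<mu>)"
        using hint by simp
      also have "(\<integral>x. h n x \<partial>\<mu>) \<ge> 0"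
        unfolding h_def using increment_nonneg[OF T] t(1)[of n] by (simp add: zero_le_divide_iff)
      then have "B - (\<integral>x. h n x \<partial>\<mu>) \<le> B" by simp
      then have "ennreal (B - (\<integral>x. h n x \<partial>\<mu>)) \<le> ennreal B" by (rule ennreal_leI)
      finally show ?thesis .
    qed
    then show ?thesis by (intro Liminf_le always_eventually) auto
  qed
  finally have upper: "(\<integral>\<^sup>+x. liminf (\<lambda>n. ennreal (B - h n x)) \<partial>\<mu>) \<le> ennreal B" .
  have "AE x in \<mu>. ennreal (B + weight x * g x) \<le> liminf (\<lambda>n. ennreal (B - h n x))"
    using move AE_notin AE_bounded
  proof eventually_elim
    case (elim x)
    then obtain \<sigma> where \<sigma>: "\<sigma> \<in> S" "dist x \<sigma> = dS x" and ev: "eventually (\<lambda>n. \<sigma> + t n *\<^sub>R \<xi> \<sigma> \<in> T n) sequentially"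
      and eq: "weight x * g x = weight x * (((x - \<sigma>) \<bullet> \<xi> \<sigma>) / dS x)" by blast
    define v where "v = x - \<sigma>"
    have nv: "norm v = dS x" using \<sigma> by (simp add: v_def dist_norm)
    have v0: "v \<noteq> 0" using elim \<sigma> by (auto simp: v_def)
    define q where "q = (\<lambda>n. (\<phi> (norm (v - t n *\<^sub>R \<xi> \<sigma>)) - \<phi> (norm v)) / t n)"
    have eq': "weight x * g x = \<phi>' (norm v) * ((v \<bullet> \<xi> \<sigma>) / norm v)"
      unfolding eq unfolding nv unfolding weight_def v_def ..
    have "((\<lambda>h. (\<phi> (norm (v - h *\<^sub>R \<xi> \<sigma>)) - \<phi> (norm v)) / h) \<longlongrightarrow> - (weight x * g x)) (at 0)"
      using DERIV_phi_norm[OF v0, of "\<xi> \<sigma>"] unfolding DERIV_def eq' by simp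
    moreover have "filterlim t (at 0) sequentially"
    proof (rule filterlim_atI[OF t(2)])
      have "t n \<noteq> 0" for n using t(1)[of n] by simp
      then show "\<forall>\<^sub>F n in sequentially. t n \<noteq> 0" by simp
    qed
    ultimately have "q \<longlonglongrightarrow> - (weight x * g x)"
      unfolding q_def by (rule filterlim_compose)
    then have "(\<lambda>n. ennreal (B - q n)) \<longlonglongrightarrow> ennreal (B - (- (weight x * g x)))"
      by (intro tendsto_ennrealI tendsto_intros)
    then have "liminf (\<lambda>n. ennreal (B - q n)) = ennreal (B + weight x * g x)"
      by (simp add: lim_imp_Liminf)
    moreover have "liminf (\<lambda>n. ennreal (B - q n)) \<le> liminf (\<lambda>n. ennreal (B - h n x))"
    proof (rule Liminf_mono)
      show "\<forall>\<^sub>F n in sequentially. ennreal (B - q n) \<le> ennreal (B - h n x)"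
        using ev
      proof eventually_elim
        case (elim n)
        have "infdist x (T n) \<le> dist x (\<sigma> + t n *\<^sub>R \<xi> \<sigma>)" by (rule infdist_le[OF elim])
        also have "\<dots> = norm (v - t n *\<^sub>R \<xi> \<sigma>)" by (simp add: dist_norm v_def algebra_simps)
        finally have "\<phi> (infdist x (T n)) \<le> \<phi> (norm (v - t n *\<^sub>R \<xi> \<sigma>))" by (intro mono) (auto simp: infdist_nonneg)
        then have "h n x \<le> q n" unfolding h_def q_def nv using t(1)[of n] by (intro divide_right_mono) auto
        then show ?case by (intro ennreal_leI) auto
      qed
    qed
    ultimately show ?case by simp
  qed
  then have "(\<integral>\<^sup>+x. ennreal (B + weight x * g x) \<partial>\<mu>) \<le> (\<integral>\<^sup>+x. liminf (\<lambda>n. ennreal (B - h n x)) \<partial>\<mu>)"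
    by (rule nn_integral_mono_AE)
  also note upper
  finally have le: "(\<integral>\<^sup>+x. ennreal (B + weight x * g x) \<partial>\<mu>) \<le> ennreal B" .
  have int: "integrable \<mu> (\<lambda>x. weight x * g x)" by (rule integrable_bounded[OF wgm wg])
  have "(\<integral>\<^sup>+x. ennreal (B + weight x * g x) \<partial>\<mu>) = ennreal (\<integral>x. B + weight x * g x \<partial>\<mu>)"
  proof (rule nn_integral_eq_integral)
    have "0 \<le> W * C" using W_nonneg C by simp
    show "AE x in \<mu>. 0 \<le> B + weight x * g x" using wg
    proof eventually_elim
      case (elim x)
      then show ?case using \<open>0 \<le> W * C\<close> unfolding B_def abs_le_iff by linarith
    qed
  qed (use int in auto)
  also have "(\<integral>x. B + weight x * g x \<partial>\<mu>) = B + (\<integral>x. weight x * g x \<partial>\<mu>)" using int by simp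
  finally show ?thesis using le B by (simp add: ennreal_le_iff)
qed

end

section \<open>Uniqueness of the nearest point\<close>

context avg_dist_minimizer
begin

abbreviation nearest :: "'a \<Rightarrow> 'a set" where
  "nearest x \<equiv> {\<sigma>\<in>S. dist x \<sigma> = dS x}"

text \<open>
  The largest height of a nearest point in direction \<open>c\<close>. It is a measurable function of \<open>x\<close>, and coordinates of this
  kind replace a measurable selection of nearest points.
\<close>
definition height :: "'a \<Rightarrow> 'a \<Rightarrow> real" where
  "height c x = (SUP \<sigma>\<in>nearest x. \<sigma> \<bullet> c)"

lemma height_attained:
  "\<exists>\<sigma>\<in>S. dist x \<sigma> = dS x \<and> \<sigma> \<bullet> c = height c x \<and>
     (\<forall>\<sigma>'\<in>S. dist x \<sigma>' = dS x \<longrightarrow> \<sigma>' \<bullet> c \<le> height c x)"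
proof -
  have "nearest x = S \<inter> sphere x (dS x)" by auto
  then have "compact (nearest x)" using S_props(2) by (simp add: compact_Int_closed)
  moreover have "nearest x \<noteq> {}" using nearest_exists[of x] by blast
  moreover have "continuous_on (nearest x) (\<lambda>\<sigma>. \<sigma> \<bullet> c)" by (intro continuous_intros)
  ultimately have "\<exists>\<sigma>\<in>nearest x. \<forall>\<sigma>'\<in>nearest x. \<sigma>' \<bullet> c \<le> \<sigma> \<bullet> c" by (rule continuous_attains_sup)
  then obtain \<sigma> where \<sigma>: "\<sigma> \<in> nearest x" "\<And>\<sigma>'. \<sigma>' \<in> nearest x \<Longrightarrow> \<sigma>' \<bullet> c \<le> \<sigma> \<bullet> c" by blast
  then have "height c x = \<sigma> \<bullet> c" unfolding height_def by (intro cSup_eq_maximum) auto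
  then show ?thesis using \<sigma> by (intro bexI[of _ \<sigma>]) auto
qed

lemma height_upper: "\<sigma> \<in> S \<Longrightarrow> dist x \<sigma> = dS x \<Longrightarrow> \<sigma> \<bullet> c \<le> height c x"
  using height_attained[of x c] by blast

text \<open>
  This description makes the superlevel sets closed.
\<close>
lemma height_ge_iff:
  "a \<le> height c x \<longleftrightarrow> S \<inter> {\<sigma>. a \<le> \<sigma> \<bullet> c} \<noteq> {} \<and> infdist x (S \<inter> {\<sigma>. a \<le> \<sigma> \<bullet> c}) \<le> dS x"
proof -
  let ?H = "S \<inter> {\<sigma>. a \<le> \<sigma> \<bullet> c}"
  obtain \<sigma> where \<sigma>: "\<sigma> \<in> S" "dist x \<sigma> = dS x" "\<sigma> \<bullet> c = height c x" using height_attained[of x c] by blast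
  show ?thesis
  proof
    assume "a \<le> height c x"
    then have "\<sigma> \<in> ?H" using \<sigma> by auto
    then show "?H \<noteq> {} \<and> infdist x ?H \<le> dS x" using infdist_le[of \<sigma> ?H x] \<sigma>(2) by auto
  next
    assume H: "?H \<noteq> {} \<and> infdist x ?H \<le> dS x"
    have "closed {\<sigma>. a \<le> \<sigma> \<bullet> c}" by (intro closed_Collect_le continuous_intros)
    then have "closed ?H" using S_closed by blast
    then obtain \<tau> where \<tau>: "\<tau> \<in> ?H" "infdist x ?H = dist x \<tau>" using infdist_attains_inf H by blast
    then have "dist x \<tau> = dS x" using H nearest_le[of \<tau> x] by auto
    then show "a \<le> height c x" using height_upper[of \<tau> x c] \<tau>(1) by auto
  qed
qed

lemma height_measurable [measurable]: "height c \<in> borel_measurable borel"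
proof (subst borel_measurable_iff_ge, intro allI)
  fix a
  let ?H = "S \<inter> {\<sigma>. a \<le> \<sigma> \<bullet> c}"
  have "closed {x. infdist x ?H \<le> dS x}" by (intro closed_Collect_le continuous_intros)
  then show "{x \<in> space borel. a \<le> height c x} \<in> sets borel"
    unfolding height_ge_iff by (cases "?H = {}") auto
qed

lemma infdist_pos_iff: "0 < dS x \<longleftrightarrow> x \<notin> S"
  using in_closed_iff_infdist_zero[OF S_closed S_props(1), of x] infdist_nonneg[of x S] by auto

lemma infdist_S_measurable [measurable]: "(\<lambda>x. dS x) \<in> borel_measurable borel"
  by (intro borel_measurable_continuous_onI continuous_intros)

text \<open>
  Translations keep the length, so they are admissible in both directions. Among the nearest points of \<open>x\<close> the
  competitor may use the one for which the motion helps most.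
\<close>
lemma translation_variation:
  assumes c: "norm c \<le> 1"
  shows "integrable \<mu> (\<lambda>x. weight x * ((x \<bullet> c + height (-c) x) / dS x))" (is ?I)
    and "(\<integral>x. weight x * ((x \<bullet> c + height (-c) x) / dS x) \<partial>\<mu>) \<le> 0" (is ?L)
proof -
  define g where "g = (\<lambda>x. (x \<bullet> c + height (-c) x) / dS x)"
  have gm: "g \<in> borel_measurable borel" unfolding g_def by measurable
  have gle: "\<bar>g x\<bar> \<le> 1" if "x \<notin> S" for x
  proof -
    obtain \<sigma> where \<sigma>: "\<sigma> \<in> S" "dist x \<sigma> = dS x" "\<sigma> \<bullet> (-c) = height (-c) x" using height_attained[of x "-c"] by blast
    have "x \<bullet> c + height (-c) x = (x - \<sigma>) \<bullet> c" using \<sigma>(3) by (simp add: inner_diff_left)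
    then have "\<bar>x \<bullet> c + height (-c) x\<bar> \<le> norm (x - \<sigma>) * norm c" by (simp add: Cauchy_Schwarz_ineq2)
    also have "\<dots> \<le> norm (x - \<sigma>) * 1" using c by (intro mult_left_mono) auto
    also have "\<dots> = dS x" using \<sigma>(2) by (simp add: dist_norm)
    finally show ?thesis unfolding g_def using infdist_pos_iff[of x] that by (simp add: abs_divide)
  qed
  have gAE: "AE x in \<mu>. \<bar>g x\<bar> \<le> 1" using AE_notin gle by auto
  have "AE x in \<mu>. \<bar>weight x * g x\<bar> \<le> W * 1"
    using AE_bounded gAE
  proof eventually_elim
    case (elim x)
    then show ?case using weight_bounds[of x] by (simp only: abs_mult) (intro mult_mono, auto)
  qed
  then have "integrable \<mu> (\<lambda>x. weight x * g x)" using gm by (intro integrable_bounded) measurable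
  then show ?I by (simp add: g_def)
  have "(\<integral>x. weight x * g x \<partial>\<mu>) \<le> 0"
  proof (rule first_variation[where t = "\<lambda>n. 1 / Suc n" and \<xi> = "\<lambda>_. c" and C = 1 and G = 1])
    show "(\<lambda>n. 1 / real (Suc n)) \<longlonglongrightarrow> 0" by (rule LIMSEQ_Suc[OF lim_1_over_n])
    fix n :: nat
    let ?f = "\<lambda>s. s + (1 / Suc n) *\<^sub>R c"
    have t1: "norm ((1 / Suc n) *\<^sub>R c) \<le> 1 / Suc n" using c by (simp add: divide_simps)
    show "?f ` S \<in> continua_le l"
      unfolding continua_le_def
    proof (intro CollectI conjI)
      show "compact (?f ` S)" using S_props by (intro compact_continuous_image continuous_intros)
      show "connected (?f ` S)" using S_props by (intro connected_continuous_image continuous_intros)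
      have "1-lipschitz_on S ?f" by (intro lipschitz_onI) auto
      then show "hausdorff1 (?f ` S) \<le> ennreal l"
        using hausdorff1_lipschitz_image[of 1 S ?f] S_props(4) by simp
    qed (use S_props in auto)
    show "?f ` S \<subseteq> cball 0 (\<rho> + 3)"
    proof (rule image_subsetI)
      fix s assume "s \<in> S"
      then have "norm s \<le> \<rho>" using S_bounded by auto
      moreover have "1 / real (Suc n) \<le> 1" by simp
      ultimately have "norm (?f s) \<le> \<rho> + 3" using norm_triangle_ineq[of s "(1 / Suc n) *\<^sub>R c"] t1 by linarith
      then show "?f s \<in> cball 0 (\<rho> + 3)" by simp
    qed
    show "infdist x (?f ` S) \<le> 1 * (1 / real (Suc n))" if "x \<in> S" for x
    proof -
      have "infdist x (?f ` S) \<le> dist x (?f x)" using that by (intro infdist_le) auto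
      also have "\<dots> \<le> 1 * (1 / real (Suc n))" using t1 by (simp add: dist_norm)
      finally show ?thesis .
    qed
  next
    show "AE x in \<mu>. \<exists>\<sigma>\<in>S. dist x \<sigma> = dS x \<and>
       (\<forall>\<^sub>F n in sequentially. \<sigma> + (1 / Suc n) *\<^sub>R c \<in> (\<lambda>s. s + (1 / Suc n) *\<^sub>R c) ` S) \<and>
       weight x * g x = weight x * ((x - \<sigma>) \<bullet> c / dS x)" (is "AE x in \<mu>. ?P x")
    proof (rule AE_I2)
      fix x
      obtain \<sigma> where \<sigma>: "\<sigma> \<in> S" "dist x \<sigma> = dS x" "\<sigma> \<bullet> (-c) = height (-c) x" using height_attained[of x "-c"] by blast
      have "x \<bullet> c + height (-c) x = (x - \<sigma>) \<bullet> c" using \<sigma>(3) by (simp add: inner_diff_left)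
      then show "?P x"
        using \<sigma> by (intro bexI[of _ \<sigma>]) (auto simp: g_def)
    qed
  qed (use gm gAE in auto)
  then show ?L by (simp add: g_def)
qed

text \<open>
  All nearest points of \<open>x\<close> have the same coordinates; written in this way the condition is measurable.
\<close>
definition uniq :: "'a \<Rightarrow> bool" where
  "uniq x \<longleftrightarrow> (\<forall>b\<in>Basis. height b x + height (-b) x = 0)"

definition proj :: "'a \<Rightarrow> 'a" where
  "proj x = (\<Sum>b\<in>Basis. height b x *\<^sub>R b)"

lemma uniq_measurable [measurable]: "Measurable.pred borel uniq"
  unfolding uniq_def[abs_def] by measurable

lemma proj_measurable [measurable]: "proj \<in> borel_measurable borel"
  unfolding proj_def[abs_def] by measurable

lemma height_add_nonneg: "0 \<le> height c x + height (-c) x"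
proof -
  obtain \<sigma> where \<sigma>: "\<sigma> \<in> S" "dist x \<sigma> = dS x" "\<sigma> \<bullet> c = height c x" using height_attained[of x c] by blast
  then show ?thesis using height_upper[OF \<sigma>(1,2), of "-c"] by simp
qed

lemma uniq_nearest:
  assumes "uniq x" "\<sigma> \<in> S" "dist x \<sigma> = dS x"
  shows "\<sigma> = proj x"
proof (rule euclidean_eqI)
  fix b :: 'a assume b: "b \<in> Basis"
  have "proj x \<bullet> b = height b x" using b unfolding proj_def by simp
  moreover have "\<sigma> \<bullet> b \<le> height b x"
    by (rule height_upper[OF assms(2,3)])
  moreover have "\<sigma> \<bullet> (-b) \<le> height (-b) x"
    by (rule height_upper[OF assms(2,3)])
  moreover have "height b x + height (-b) x = 0" using assms(1) b by (simp add: uniq_def)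
  ultimately show "\<sigma> \<bullet> b = proj x \<bullet> b" by simp
qed

lemma uniq_proj: "uniq x \<Longrightarrow> proj x \<in> S \<and> dist x (proj x) = dS x"
  using nearest_exists[of x] uniq_nearest[of x] by metis

text \<open>
  Adding the variations for the translations by \<open>b\<close> and \<open>-b\<close> shows that the spread of the nearest points in direction
  \<open>b\<close>, which is nonnegative, has weighted integral at most zero.
\<close>
lemma AE_uniq: "AE x in \<mu>. weight x \<noteq> 0 \<longrightarrow> uniq x"
proof -
  have "AE x in \<mu>. weight x * ((height b x + height (-b) x) / dS x) = 0" if b: "b \<in> Basis" for b
  proof -
    have nb: "norm b \<le> 1" "norm (-b) \<le> 1" using b by auto
    let ?f = "\<lambda>x. weight x * ((x \<bullet> b + height (-b) x) / dS x) + weight x * ((x \<bullet> (-b) + height (-(-b)) x) / dS x)"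
    have eq: "?f x = weight x * ((height b x + height (-b) x) / dS x)" for x
      by (simp add: add_divide_distrib diff_divide_distrib algebra_simps)
    have int: "integrable \<mu> ?f"
      by (intro Bochner_Integration.integrable_add translation_variation nb)
    have "(\<integral>x. ?f x \<partial>\<mu>) \<le> 0"
      using translation_variation[OF nb(1)] translation_variation[OF nb(2)]
      by (subst Bochner_Integration.integral_add) auto
    moreover have nn: "AE x in \<mu>. 0 \<le> ?f x"
      using AE_bounded
    proof eventually_elim
      case (elim x)
      then show ?case unfolding eq using weight_bounds[OF elim] height_add_nonneg[of b x] infdist_nonneg[of x S]
        by (intro mult_nonneg_nonneg divide_nonneg_nonneg) auto
    qed
    ultimately have "(\<integral>x. ?f x \<partial>\<mu>) = 0" using integral_nonneg_AE[OF nn] by linarith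
    then have "AE x in \<mu>. ?f x = 0" using integral_nonneg_eq_0_iff_AE[OF int nn] by simp
    then show ?thesis unfolding eq .
  qed
  then have "AE x in \<mu>. \<forall>b\<in>Basis. weight x * ((height b x + height (-b) x) / dS x) = 0"
    by (intro AE_finite_allI) auto
  then show ?thesis using AE_notin
  proof eventually_elim
    case (elim x)
    then have "dS x \<noteq> 0" using infdist_pos_iff[of x] by auto
    then show ?case using elim by (auto simp: uniq_def)
  qed
qed

definition active :: "'a \<Rightarrow> bool" where "active x \<longleftrightarrow> weight x \<noteq> 0 \<and> uniq x"

lemma active_measurable [measurable]: "Measurable.pred borel active"
  unfolding active_def[abs_def] by measurable

text \<open>
  The force with which \<open>x\<close> pulls at its nearest point. Summed over the \<open>x\<close> that have their nearest point in a given part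
  of \<open>S\<close>, this is the barycentre field.
\<close>
definition pull :: "'a \<Rightarrow> 'a" where
  "pull x = (if active x then (weight x / dS x) *\<^sub>R (x - proj x) else 0)"

lemma pull_measurable [measurable]: "pull \<in> borel_measurable borel"
  unfolding pull_def[abs_def] by measurable

lemma norm_pull: "AE x in \<mu>. norm (pull x) = (if active x then weight x else 0)"
  using AE_notin AE_bounded
proof eventually_elim
  case (elim x)
  then show ?case using weight_bounds[of x] infdist_pos_iff[of x] uniq_proj[of x]
    by (auto simp: pull_def active_def dist_norm)
qed

lemma norm_pull_le: "AE x in \<mu>. norm (pull x) \<le> W"
  using norm_pull AE_bounded
proof eventually_elim
  case (elim x)
  then show ?case using weight_bounds[of x] W_nonneg by auto
qed

end

section \<open>The barycentre field\<close>

text \<open>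
  A small end that is not an atom; the aim is a contradiction.
\<close>
locale avg_dist_minimizer_end = avg_dist_minimizer +
  fixes e :: 'a
  assumes l_pos: "l > 0"
    and e_in: "e \<in> S"
    and no_atom: "AE x in \<mu>. infdist x S \<noteq> dist x e"
    and ends: "small_end S e"
begin

lemma shortened_length:
  assumes "hausdorff1 T + ennreal (r/2) \<le> hausdorff1 S" "r > 0"
  shows "hausdorff1 T \<le> ennreal (l - r/2)" "r/2 \<le> l"
proof -
  have le: "hausdorff1 T + ennreal (r/2) \<le> ennreal l" using assms S_props(4) by (rule_tac order_trans)
  then have "hausdorff1 T < top" by (metis ennreal_add_eq_top ennreal_less_top less_top order_le_less_trans)
  then obtain h where h: "hausdorff1 T = ennreal h" "h \<ge> 0" by (cases "hausdorff1 T") auto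
  then have "ennreal (h + r/2) \<le> ennreal l" using le assms(2) by (simp add: ennreal_plus)
  then have "h + r/2 \<le> l" using l_pos by (simp add: ennreal_le_iff)
  then show "hausdorff1 T \<le> ennreal (l - r/2)" "r/2 \<le> l" using h by (auto intro: ennreal_leI)
qed

text \<open>
  A Lipschitz deformation \<open>\<sigma> + t *\<^sub>R \<xi> \<sigma>\<close> lengthens \<open>S\<close> by at most the order of \<open>t\<close>. This is paid for by cutting
  the end at a radius proportional to \<open>t\<close>, and the cut is invisible to first order: almost every \<open>x\<close> has a nearest point other than \<open>e\<close>, which
  eventually survives the cut.
\<close>
lemma field_nonpos:
  assumes cont: "continuous_on UNIV \<xi>" and lip: "L-lipschitz_on S \<xi>"
    and bdd: "\<And>\<sigma>. \<sigma> \<in> S \<Longrightarrow> norm (\<xi> \<sigma>) \<le> G"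
  shows "(\<integral>x. pull x \<bullet> \<xi> (proj x) \<partial>\<mu>) \<le> 0"
proof -
  have L0: "L \<ge> 0" using lip by (rule lipschitz_on_nonneg)
  have G0: "G \<ge> 0" using bdd[OF e_in] norm_ge_zero order_trans by blast
  \<comment> \<open>Large enough to exceed the Lipschitz constant and to keep the displacements bounded by 1.\<close>
  define L' where "L' = L + 1 + (G + 1) / l"
  have "(G + 1) / l \<ge> 0" using G0 l_pos by simp
  then have L': "L' > 0" "L \<le> L'" using L0 by (auto simp: L'_def)
  have "(G + 1) / l * l = G + 1" using l_pos by simp
  then have "L' * l = (L + 1) * l + (G + 1)" by (simp add: L'_def distrib_right del: times_divide_eq_left)
  moreover have "0 \<le> (L + 1) * l" using L0 l_pos by simp
  ultimately have L'l: "G + 1 \<le> L' * l" by linarith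
  have "0 < 1 / real (Suc n)" for n by simp
  note ends[unfolded small_end_def, rule_format, OF this]
  then obtain r T e' where r: "\<And>n. 0 < r n" "\<And>n. r n \<le> 1 / real (Suc n)"
    and T: "\<And>n. compact (T n)" "\<And>n. connected (T n)" "\<And>n. T n \<subseteq> S" "\<And>n. S - T n \<subseteq> cball e (r n)"
    and e': "\<And>n. e' n \<in> T n" "\<And>n. dist (e' n) e \<le> r n"
    and len: "\<And>n. hausdorff1 (T n) + ennreal (r n / 2) \<le> hausdorff1 S"
    by metis
  have r1: "r n \<le> 1" for n using r(2)[of n] by (rule order_trans) simp
  have r0: "r \<longlonglongrightarrow> 0"
  proof (rule tendsto_sandwich[of "\<lambda>_. 0" r sequentially "\<lambda>n. 1 / real (Suc n)"])
    show "(\<lambda>n. 1 / real (Suc n)) \<longlonglongrightarrow> 0" by (rule LIMSEQ_Suc[OF lim_1_over_n])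
    show "\<forall>\<^sub>F n in sequentially. 0 \<le> r n" using less_imp_le[OF r(1)] by simp
  qed (use r in auto)
  \<comment> \<open>The lengthening by the factor \<open>1 + t * L'\<close> then consumes at most the saved \<open>r/2\<close>.\<close>
  define t where "t = (\<lambda>n. r n / (2 * L' * l))"
  have t: "t n > 0" "r n = 2 * L' * l * t n" for n using r L' l_pos by (auto simp: t_def)
  have tG: "t n * G \<le> 1" for n
  proof -
    have "2 * (t n * G) \<le> 2 * (L' * l * t n)" using L'l t(1)[of n] by (simp add: mult.commute mult_left_mono)
    then show ?thesis using r1[of n] t(2)[of n] by (simp add: mult_ac)
  qed
  define f where "f = (\<lambda>n \<sigma>. \<sigma> + t n *\<^sub>R \<xi> \<sigma>)"
  have moved: "norm (t n *\<^sub>R \<xi> \<sigma>) \<le> t n * G" if "\<sigma> \<in> S" for n \<sigma>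
    using bdd[OF that] t(1)[of n] by simp
  define g where "g = (\<lambda>x. if active x then ((x - proj x) \<bullet> \<xi> (proj x)) / dS x else 0)"
  have \<xi>m [measurable]: "\<xi> \<in> borel_measurable borel" using cont by (rule borel_measurable_continuous_onI)
  have gm: "g \<in> borel_measurable borel" unfolding g_def by measurable
  have "(\<integral>x. weight x * g x \<partial>\<mu>) \<le> 0"
  proof (rule first_variation[where t = t and \<xi> = \<xi> and T = "\<lambda>n. f n ` T n" and C = "4 * L' * l + G" and G = G])
    show "t \<longlonglongrightarrow> 0" unfolding t_def using tendsto_divide[OF r0 tendsto_const, of "2 * L' * l"] L' l_pos by simp
    fix n
    have cf: "continuous_on A (f n)" for A
      unfolding f_def using cont by (intro continuous_intros) (auto intro: continuous_on_subset)
    show "f n ` T n \<in> continua_le l"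
      unfolding continua_le_def
    proof (intro CollectI conjI)
      have "(1 + t n * L')-lipschitz_on (T n) (f n)"
      proof (rule lipschitz_onI)
        fix x y assume xy: "x \<in> T n" "y \<in> T n"
        have "dist (\<xi> x) (\<xi> y) \<le> L * dist x y" using lipschitz_onD[OF lip] xy T(3) by blast
        also have "\<dots> \<le> L' * dist x y" using L' by (intro mult_right_mono) auto
        finally have "t n * dist (\<xi> x) (\<xi> y) \<le> t n * (L' * dist x y)" using t(1)[of n] by (intro mult_left_mono) auto
        moreover have "dist (f n x) (f n y) \<le> dist x y + t n * dist (\<xi> x) (\<xi> y)"
        proof -
          have "f n x - f n y = (x - y) + t n *\<^sub>R (\<xi> x - \<xi> y)" by (simp add: f_def algebra_simps)
          then show ?thesis using norm_triangle_ineq[of "x - y" "t n *\<^sub>R (\<xi> x - \<xi> y)"] t(1)[of n] by (simp add: dist_norm)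
        qed
        ultimately show "dist (f n x) (f n y) \<le> (1 + t n * L') * dist x y" by (simp add: algebra_simps)
      qed (use t(1)[of n] L' in auto)
      then have "hausdorff1 (f n ` T n) \<le> ennreal (1 + t n * L') * hausdorff1 (T n)"
        using t(1)[of n] L' by (intro hausdorff1_lipschitz_image) (auto intro: add_pos_pos)
      also have "\<dots> \<le> ennreal (1 + t n * L') * ennreal (l - r n / 2)"
        by (intro mult_left_mono shortened_length(1)[OF len r(1)]) auto
      also have "\<dots> = ennreal ((1 + t n * L') * (l - r n / 2))"
        using t(1)[of n] L' shortened_length(2)[OF len r(1), of n] by (intro ennreal_mult[symmetric]) (auto intro: add_nonneg_nonneg)
      also have "(1 + t n * L') * (l - r n / 2) \<le> l"
      proof -
        have "(1 + t n * L') * (l - r n / 2) = l + t n * L' * l - r n / 2 - t n * L' * (r n / 2)" by (simp add: algebra_simps)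
        moreover have "t n * L' * (r n / 2) \<ge> 0" using t(1)[of n] L' r(1)[of n] by simp
        moreover have "t n * L' * l = r n / 2" using t(2)[of n] by simp
        ultimately show ?thesis by linarith
      qed
      then have "ennreal ((1 + t n * L') * (l - r n / 2)) \<le> ennreal l" by (rule ennreal_leI)
      finally show "hausdorff1 (f n ` T n) \<le> ennreal l" .
    qed (use T[of n] e'[of n] cf in \<open>auto intro: compact_continuous_image connected_continuous_image\<close>)
    show "f n ` T n \<subseteq> cball 0 (\<rho> + 3)"
    proof (rule image_subsetI)
      fix s assume "s \<in> T n"
      then have s: "s \<in> S" using T(3) by blast
      then have "norm s \<le> \<rho>" using S_bounded by auto
      then have "norm (f n s) \<le> \<rho> + 3"
        unfolding f_def using norm_triangle_ineq[of s "t n *\<^sub>R \<xi> s"] moved[OF s, of n] tG[of n] by linarith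
      then show "f n s \<in> cball 0 (\<rho> + 3)" by simp
    qed
    show "infdist x (f n ` T n) \<le> (4 * L' * l + G) * t n" if x: "x \<in> S" for x
    proof -
      have fm: "dist y (f n y) \<le> t n * G" if "y \<in> S" for y using moved[OF that, of n] by (simp add: f_def dist_norm)
      have pos: "0 \<le> 4 * L' * l * t n" using L' l_pos t(1)[of n] by simp
      show ?thesis
      proof (cases "x \<in> T n")
        case True
        then have "infdist x (f n ` T n) \<le> dist x (f n x)" by (intro infdist_le) auto
        then show ?thesis using fm[OF x] pos by (simp add: algebra_simps)
      next
        case False
        then have "x \<in> cball e (r n)" using T(4) x by blast
        then have "dist x (e' n) \<le> 2 * r n" using e'(2)[of n] dist_triangle[of x "e' n" e] by (simp add: dist_commute)
        moreover have "infdist x (f n ` T n) \<le> dist x (f n (e' n))" using e'(1) by (intro infdist_le) auto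
        moreover have "dist x (f n (e' n)) \<le> dist x (e' n) + t n * G"
          using dist_triangle[of x "f n (e' n)" "e' n"] fm[of "e' n"] e'(1) T(3) by fastforce
        ultimately have "infdist x (f n ` T n) \<le> 2 * r n + t n * G" by linarith
        then show ?thesis unfolding t(2)[of n] by (simp add: algebra_simps)
      qed
    qed
  next
    show "AE x in \<mu>. \<bar>g x\<bar> \<le> G"
      using AE_notin
    proof eventually_elim
      case (elim x)
      show ?case
      proof (cases "active x")
        case True
        then have p: "proj x \<in> S" "norm (x - proj x) = dS x" using uniq_proj[of x] by (auto simp: active_def dist_norm)
        have "\<bar>(x - proj x) \<bullet> \<xi> (proj x)\<bar> \<le> norm (x - proj x) * norm (\<xi> (proj x))" by (rule Cauchy_Schwarz_ineq2)
        also have "\<dots> \<le> dS x * G" using p bdd infdist_nonneg by (intro mult_mono) auto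
        finally show ?thesis using True infdist_pos_iff[of x] elim by (simp add: g_def abs_divide divide_simps mult.commute)
      qed (simp add: g_def G0)
    qed
    show "AE x in \<mu>. \<exists>\<sigma>\<in>S. dist x \<sigma> = dS x \<and> (\<forall>\<^sub>F n in sequentially. \<sigma> + t n *\<^sub>R \<xi> \<sigma> \<in> f n ` T n) \<and>
       weight x * g x = weight x * ((x - \<sigma>) \<bullet> \<xi> \<sigma> / dS x)"
      using no_atom AE_uniq
    proof eventually_elim
      case (elim x)
      define \<sigma> where "\<sigma> = (if active x then proj x else (SOME s. s \<in> nearest x))"
      have "(SOME s. s \<in> nearest x) \<in> nearest x" using nearest_exists[of x] by (intro someI_ex[of "\<lambda>s. s \<in> nearest x"]) auto
      then have \<sigma>: "\<sigma> \<in> S" "dist x \<sigma> = dS x" using uniq_proj[of x] by (auto simp: \<sigma>_def active_def)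
      have "\<sigma> \<noteq> e" using \<sigma> elim by auto
      then have "dist e \<sigma> > 0" by simp
      then have "eventually (\<lambda>n. r n < dist e \<sigma>) sequentially" using r0 by (rule order_tendstoD(2)[rotated])
      then have "eventually (\<lambda>n. \<sigma> + t n *\<^sub>R \<xi> \<sigma> \<in> f n ` T n) sequentially"
      proof eventually_elim
        case (elim n)
        then have "\<sigma> \<in> T n" using T(4)[of n] \<sigma>(1) by auto
        then show ?case by (auto simp: f_def)
      qed
      moreover have "weight x * g x = weight x * ((x - \<sigma>) \<bullet> \<xi> \<sigma> / dS x)"
        using elim by (cases "active x") (auto simp: g_def \<sigma>_def active_def)
      ultimately show ?case using \<sigma> by blast
    qed
  qed (use t gm in auto)
  also have "(\<lambda>x. weight x * g x) = (\<lambda>x. pull x \<bullet> \<xi> (proj x))"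
    by (auto simp: fun_eq_iff g_def pull_def)
  finally show ?thesis .
qed

lemma field_zero:
  assumes "continuous_on UNIV \<xi>" "L-lipschitz_on S \<xi>" "\<And>\<sigma>. \<sigma> \<in> S \<Longrightarrow> norm (\<xi> \<sigma>) \<le> G"
  shows "(\<integral>x. pull x \<bullet> \<xi> (proj x) \<partial>\<mu>) = 0"
proof -
  have "(\<integral>x. pull x \<bullet> (- \<xi> (proj x)) \<partial>\<mu>) \<le> 0"
  proof (rule field_nonpos)
    show "continuous_on UNIV (\<lambda>x. - \<xi> x)" by (intro continuous_intros assms)
    show "L-lipschitz_on S (\<lambda>x. - \<xi> x)" using assms(2) by (simp add: lipschitz_on_def dist_minus)
  qed (use assms(3) in auto)
  then show ?thesis using field_nonpos[OF assms] by simp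
qed

text \<open>
  The indicator of a closed set is a decreasing limit of Lipschitz functions, so the field also vanishes when tested against the
  discontinuous field that moves only the part of \<open>S\<close> in \<open>F\<close>, along the rays from \<open>c\<close>.
\<close>
lemma field_zero_closed:
  assumes F: "closed F" "F \<noteq> {}" and c: "c \<in> S"
  shows "integrable \<mu> (\<lambda>x. indicat_real F (proj x) * (pull x \<bullet> (proj x - c)))"
    and "(\<integral>x. indicat_real F (proj x) * (pull x \<bullet> (proj x - c)) \<partial>\<mu>) = 0"
proof -
  define \<eta> where "\<eta> = (\<lambda>n::nat. \<lambda>\<sigma>. max 0 (1 - real n * infdist \<sigma> F))"
  let ?I = "\<lambda>n x. pull x \<bullet> (\<eta> n (proj x) *\<^sub>R (proj x - c))" and ?J = "\<lambda>x. indicat_real F (proj x) * (pull x \<bullet> (proj x - c))"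
  have \<eta>01: "0 \<le> \<eta> n \<sigma>" "\<eta> n \<sigma> \<le> 1" for n \<sigma> by (auto simp: \<eta>_def infdist_nonneg)
  have \<eta>lip: "\<bar>\<eta> n a - \<eta> n b\<bar> \<le> real n * dist a b" for n a b
  proof -
    have "\<bar>infdist a F - infdist b F\<bar> \<le> dist a b" by (rule infdist_triangle_abs)
    then have "\<bar>real n * infdist a F - real n * infdist b F\<bar> \<le> real n * dist a b"
      by (metis abs_mult abs_of_nat mult_left_mono of_nat_0_le_iff right_diff_distrib)
    then show ?thesis by (auto simp: \<eta>_def max_def)
  qed
  have Sd: "norm (\<sigma> - c) \<le> 2 * \<rho>" if "\<sigma> \<in> S" for \<sigma>
  proof -
    have "norm \<sigma> \<le> \<rho>" "norm c \<le> \<rho>" using S_bounded that c by auto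
    then show ?thesis using norm_triangle_ineq4[of \<sigma> c] by linarith
  qed
  have zero: "(\<integral>x. ?I n x \<partial>\<mu>) = 0" for n
  proof (rule field_zero)
    show "continuous_on UNIV (\<lambda>\<sigma>. \<eta> n \<sigma> *\<^sub>R (\<sigma> - c))" unfolding \<eta>_def by (intro continuous_intros)
    show "norm (\<eta> n \<sigma> *\<^sub>R (\<sigma> - c)) \<le> 2 * \<rho>" if "\<sigma> \<in> S" for \<sigma>
    proof -
      have "norm (\<eta> n \<sigma> *\<^sub>R (\<sigma> - c)) \<le> 1 * norm (\<sigma> - c)"
        using \<eta>01 by (simp only: norm_scaleR) (intro mult_right_mono, auto)
      then show ?thesis using Sd[OF that] by simp
    qed
    show "(real n * (2 * \<rho>) + 1)-lipschitz_on S (\<lambda>\<sigma>. \<eta> n \<sigma> *\<^sub>R (\<sigma> - c))"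
    proof (rule lipschitz_onI)
      fix a b assume ab: "a \<in> S" "b \<in> S"
      have "\<eta> n a *\<^sub>R (a - c) - \<eta> n b *\<^sub>R (b - c) = (\<eta> n a - \<eta> n b) *\<^sub>R (a - c) + \<eta> n b *\<^sub>R (a - b)"
        by (simp add: algebra_simps)
      then have "dist (\<eta> n a *\<^sub>R (a - c)) (\<eta> n b *\<^sub>R (b - c)) \<le> \<bar>\<eta> n a - \<eta> n b\<bar> * norm (a - c) + \<bar>\<eta> n b\<bar> * norm (a - b)"
        by (metis dist_norm norm_scaleR norm_triangle_ineq)
      also have "\<dots> \<le> (real n * dist a b) * (2 * \<rho>) + 1 * norm (a - b)"
        using \<eta>lip \<eta>01 Sd[OF ab(1)] \<rho>_nonneg by (intro add_mono mult_mono) auto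
      also have "\<dots> = (real n * (2 * \<rho>) + 1) * dist a b" by (simp add: dist_norm algebra_simps)
      finally show "dist (\<eta> n a *\<^sub>R (a - c)) (\<eta> n b *\<^sub>R (b - c)) \<le> (real n * (2 * \<rho>) + 1) * dist a b" .
    qed (use \<rho>_nonneg in auto)
  qed
  have Fs: "F \<in> sets borel" using F by simp
  have meas: "(\<lambda>x. ?J x) \<in> borel_measurable borel"
    using Fs by measurable
  have \<eta>m [measurable]: "\<eta> n \<in> borel_measurable borel" for n
    unfolding \<eta>_def by (intro borel_measurable_continuous_onI continuous_intros)
  have main: "AE x in \<mu>. \<bar>pull x \<bullet> (proj x - c)\<bar> \<le> W * (2 * \<rho>)"
    using norm_pull_le
  proof eventually_elim
    case (elim x)
    show ?case
    proof (cases "active x")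
      case True
      then have p: "proj x \<in> S" using uniq_proj[of x] by (auto simp: active_def)
      have "\<bar>pull x \<bullet> (proj x - c)\<bar> \<le> norm (pull x) * norm (proj x - c)" by (rule Cauchy_Schwarz_ineq2)
      also have "\<dots> \<le> W * (2 * \<rho>)" using elim Sd[OF p] W_nonneg by (intro mult_mono) auto
      finally show ?thesis .
    qed (use W_nonneg \<rho>_nonneg in \<open>simp add: pull_def\<close>)
  qed
  have dom: "integrable \<mu> (\<lambda>x. W * (2 * \<rho>))" by simp
  have lim: "AE x in \<mu>. (\<lambda>n. ?I n x) \<longlonglongrightarrow> ?J x"
  proof (rule AE_I2)
    fix x
    have "(\<lambda>n. \<eta> n (proj x)) \<longlonglongrightarrow> indicat_real F (proj x)"
    proof (cases "proj x \<in> F")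
      case True
      then show ?thesis by (simp add: \<eta>_def)
    next
      case False
      then have pos: "infdist (proj x) F > 0" using in_closed_iff_infdist_zero[OF F, of "proj x"] infdist_nonneg[of "proj x" F] by auto
      obtain N :: nat where N: "1 / infdist (proj x) F < real N" using reals_Archimedean2 by blast
      have "eventually (\<lambda>n. \<eta> n (proj x) = 0) sequentially"
        using eventually_ge_at_top[of N]
      proof eventually_elim
        case (elim n)
        then have "1 / infdist (proj x) F \<le> real n" using N by linarith
        then have "1 \<le> real n * infdist (proj x) F" using pos by (simp add: field_simps)
        then show ?case by (simp add: \<eta>_def)
      qed
      then show ?thesis using False by (simp add: tendsto_eventually)
    qed
    then show "(\<lambda>n. ?I n x) \<longlonglongrightarrow> ?J x"
      unfolding inner_scaleR_right by (intro tendsto_intros)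
  qed
  have bnd: "AE x in \<mu>. norm (?I n x) \<le> W * (2 * \<rho>)" for n
    using main
  proof eventually_elim
    case (elim x)
    have "norm (?I n x) = \<eta> n (proj x) * \<bar>pull x \<bullet> (proj x - c)\<bar>"
      using \<eta>01 by (simp add: abs_mult)
    also have "\<dots> \<le> 1 * \<bar>pull x \<bullet> (proj x - c)\<bar>" using \<eta>01 by (intro mult_right_mono) auto
    finally show ?case using elim by simp
  qed
  have m1: "(\<lambda>x. ?J x) \<in> borel_measurable \<mu>"
    using meas by (simp add: measurable_borel)
  have m2: "(\<lambda>x. ?I n x) \<in> borel_measurable \<mu>" for n
    unfolding measurable_borel by measurable
  show "integrable \<mu> (\<lambda>x. ?J x)"
    by (rule integrable_dominated_convergence[OF m1 m2 dom lim bnd])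
  have "(\<lambda>n. \<integral>x. ?I n x \<partial>\<mu>) \<longlonglongrightarrow> (\<integral>x. ?J x \<partial>\<mu>)"
    by (rule integral_dominated_convergence[OF m1 m2 dom lim bnd])
  then have "(\<lambda>n::nat. 0::real) \<longlonglongrightarrow> (\<integral>x. ?J x \<partial>\<mu>)"
    by (simp only: zero)
  then show "(\<integral>x. ?J x \<partial>\<mu>) = 0"
    by (simp add: LIMSEQ_const_iff)
qed

text \<open>
  To first order, collapsing the removed piece \<open>S - T\<close> to a point costs nothing. This is what makes the cut cheaper than
  what the saved length can buy.
\<close>
lemma field_zero_cut:
  assumes T: "closed T" "T \<noteq> {}" and c: "c \<in> S"
  shows "integrable \<mu> (\<lambda>x. indicat_real (S - T) (proj x) * (pull x \<bullet> (proj x - c)))"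
    and "(\<integral>x. indicat_real (S - T) (proj x) * (pull x \<bullet> (proj x - c)) \<partial>\<mu>) = 0"
proof -
  have eq: "indicat_real (S - T) (proj x) * (pull x \<bullet> (proj x - c)) =
    indicat_real UNIV (proj x) * (pull x \<bullet> (proj x - c)) - indicat_real T (proj x) * (pull x \<bullet> (proj x - c))" for x
    using uniq_proj[of x] by (cases "active x") (auto simp: active_def pull_def indicator_def)
  show "integrable \<mu> (\<lambda>x. indicat_real (S - T) (proj x) * (pull x \<bullet> (proj x - c)))"
    unfolding eq by (intro Bochner_Integration.integrable_diff field_zero_closed T c) auto
  show "(\<integral>x. indicat_real (S - T) (proj x) * (pull x \<bullet> (proj x - c)) \<partial>\<mu>) = 0"
    unfolding eq using field_zero_closed[OF T c] field_zero_closed[of UNIV c] c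
    by (subst Bochner_Integration.integral_diff) auto
qed

end

section \<open>Shortening an end and growing two segments\<close>

text \<open>
  From \<open>2 * a * b \<le> a\<^sup>2 + b\<^sup>2\<close> for the two norms.
\<close>
lemma norm_add_le_second_order:
  fixes v z :: "'a::real_inner"
  assumes "v \<noteq> 0"
  shows "norm (v + z) \<le> norm v + (v \<bullet> z) / norm v + (norm z)\<^sup>2 / (2 * norm v)"
proof -
  have v: "norm v > 0" using assms by simp
  have sq: "(norm (v + z))\<^sup>2 = (norm v)\<^sup>2 + 2 * (v \<bullet> z) + (norm z)\<^sup>2"
    by (simp add: power2_norm_eq_inner inner_add_left inner_add_right inner_commute)
  have "2 * norm v * norm (v + z) \<le> (norm v)\<^sup>2 + (norm (v + z))\<^sup>2"
    using sum_squares_bound[of "norm v" "norm (v + z)"] by simp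
  also have "\<dots> = 2 * norm v * (norm v + (v \<bullet> z) / norm v + (norm z)\<^sup>2 / (2 * norm v))"
    unfolding sq using v by (simp add: field_simps power2_eq_square)
  finally show ?thesis using v by simp
qed

context avg_dist_minimizer_end
begin

text \<open>
  The points that have a nearest point within distance \<open>r\<close> of \<open>e\<close>, in a form that shows that the set is closed.
\<close>
definition near_end :: "real \<Rightarrow> 'a set" where
  "near_end r = {x. infdist x (S \<inter> cball e r) \<le> dS x}"

lemma near_end_iff:
  assumes "r \<ge> 0"
  shows "x \<in> near_end r \<longleftrightarrow> (\<exists>\<sigma>\<in>S. dist x \<sigma> = dS x \<and> dist \<sigma> e \<le> r)"
proof
  assume x: "x \<in> near_end r"
  have "closed (S \<inter> cball e r)" "S \<inter> cball e r \<noteq> {}" using S_closed e_in assms by auto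
  then obtain \<sigma> where \<sigma>: "\<sigma> \<in> S \<inter> cball e r" "infdist x (S \<inter> cball e r) = dist x \<sigma>"
    using infdist_attains_inf by blast
  then have "dist x \<sigma> = dS x" using x nearest_le[of \<sigma> x] by (auto simp: near_end_def)
  then show "\<exists>\<sigma>\<in>S. dist x \<sigma> = dS x \<and> dist \<sigma> e \<le> r" using \<sigma>(1) by (auto simp: dist_commute)
next
  assume "\<exists>\<sigma>\<in>S. dist x \<sigma> = dS x \<and> dist \<sigma> e \<le> r"
  then obtain \<sigma> where \<sigma>: "\<sigma> \<in> S" "dist x \<sigma> = dS x" "dist \<sigma> e \<le> r" by blast
  then have "infdist x (S \<inter> cball e r) \<le> dist x \<sigma>" by (intro infdist_le) (auto simp: dist_commute)
  then show "x \<in> near_end r" using \<sigma> by (simp add: near_end_def)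
qed

lemma near_end_sets [measurable]: "near_end r \<in> sets borel"
proof -
  have "closed (near_end r)" unfolding near_end_def by (intro closed_Collect_le continuous_intros)
  then show ?thesis by simp
qed

lemma near_end_mono: "0 \<le> r \<Longrightarrow> r \<le> r' \<Longrightarrow> near_end r \<subseteq> near_end r'"
  by (auto simp: near_end_iff) (meson order_trans)

text \<open>
  The sets \<open>near_end r\<close> shrink to the set of points that have \<open>e\<close> as a nearest point, which is null.
\<close>
lemma measure_near_end_small:
  assumes "\<eta> > 0"
  obtains \<delta> where "\<delta> > 0" "\<And>r. 0 \<le> r \<Longrightarrow> r \<le> \<delta> \<Longrightarrow> measure \<mu> (near_end r) < \<eta>"
proof -
  let ?B = "\<lambda>n::nat. near_end (1 / Suc n)"
  have "(\<lambda>n. measure \<mu> (?B n)) \<longlonglongrightarrow> measure \<mu> (\<Inter>n. ?B n)"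
  proof (rule finite_Lim_measure_decseq)
    show "range ?B \<subseteq> sets \<mu>" by (auto simp: sets_borel)
    show "decseq ?B" unfolding decseq_def by (intro allI impI near_end_mono) (auto simp: divide_simps)
  qed
  moreover have "measure \<mu> (\<Inter>n. ?B n) = 0"
  proof -
    have "(\<Inter>n. ?B n) \<subseteq> {x. dS x = dist x e}"
    proof
      fix x assume x: "x \<in> (\<Inter>n. ?B n)"
      have "dist x e \<le> dS x + 1 / Suc n" for n
      proof -
        have "x \<in> ?B n" using x by blast
        then obtain \<sigma> where "\<sigma> \<in> S" "dist x \<sigma> = dS x" "dist \<sigma> e \<le> 1 / Suc n" by (subst (asm) near_end_iff) auto
        then show ?thesis using dist_triangle[of x e \<sigma>] by linarith
      qed
      moreover have "(\<lambda>n. dS x + 1 / real (Suc n)) \<longlonglongrightarrow> dS x + 0"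
        by (intro tendsto_add tendsto_const LIMSEQ_Suc[OF lim_1_over_n])
      ultimately have "dist x e \<le> dS x + 0" by (intro LIMSEQ_le_const) auto
      then show "x \<in> {x. dS x = dist x e}" using nearest_le[OF e_in, of x] by auto
    qed
    then have "AE x in \<mu>. x \<notin> (\<Inter>n. ?B n)" using no_atom by (auto elim!: eventually_mono)
    moreover have "(\<Inter>n. ?B n) \<in> sets \<mu>" using near_end_sets by (auto simp: sets_borel)
    ultimately have "emeasure \<mu> (\<Inter>n. ?B n) = 0" by (subst (asm) AE_iff_measurable[of "\<Inter>n. ?B n"]) auto
    then show ?thesis by (simp add: measure_def)
  qed
  ultimately have "eventually (\<lambda>n. measure \<mu> (?B n) < \<eta>) sequentially"
    using assms by (intro order_tendstoD(2)) auto
  then obtain n where n: "measure \<mu> (?B n) < \<eta>" by (auto simp: eventually_sequentially)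
  show thesis
  proof (rule that[of "1 / Suc n"])
    fix r :: real assume "0 \<le> r" "r \<le> 1 / Suc n"
    then have "measure \<mu> (near_end r) \<le> measure \<mu> (?B n)" using near_end_mono by (intro finite_measure_mono) (auto simp: sets_borel)
    then show "measure \<mu> (near_end r) < \<eta>" using n by simp
  qed simp
qed

text \<open>
  Points at which weight and distance are bounded below and whose nearest point is not close to the end.
\<close>
definition robust :: "real \<Rightarrow> 'a set" where
  "robust c = {x. norm x \<le> \<rho> \<and> uniq x \<and> c \<le> weight x \<and> c \<le> dS x \<and> c \<le> dist (proj x) e}"

lemma robust_sets [measurable]: "robust c \<in> sets borel"
  unfolding robust_def by measurable

lemma exists_robust:
  assumes "\<not> (AE x in \<mu>. weight x = 0)"
  obtains c where "c > 0" "measure \<mu> (robust c) > 0"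
proof (rule ccontr)
  assume no: "\<not> thesis"
  have "measure \<mu> (robust (1 / Suc n)) = 0" for n
  proof (rule ccontr)
    assume "measure \<mu> (robust (1 / Suc n)) \<noteq> 0"
    then have "measure \<mu> (robust (1 / Suc n)) > 0" using measure_nonneg[of \<mu>] by (simp add: less_le)
    then show False using no that[of "1 / Suc n"] by simp
  qed
  then have "robust (1 / Suc n) \<in> null_sets \<mu>" for n
    by (simp add: null_sets_def emeasure_eq_measure sets_borel)
  then have "AE x in \<mu>. x \<notin> robust (1 / Suc n)" for n by (rule AE_not_in)
  then have "AE x in \<mu>. \<forall>n. x \<notin> robust (1 / Suc n)" unfolding AE_all_countable by blast
  then have "AE x in \<mu>. weight x = 0"
    using AE_bounded AE_uniq AE_notin no_atom
  proof eventually_elim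
    case (elim x)
    show ?case
    proof (rule ccontr)
      assume w0: "weight x \<noteq> 0"
      then have u: "uniq x" using elim by blast
      have "weight x > 0" using w0 weight_bounds[of x] elim by (simp add: less_le)
      moreover have "dS x > 0" using elim infdist_pos_iff by blast
      moreover have "dist (proj x) e > 0" using elim uniq_proj[OF u] by auto
      ultimately have "min (weight x) (min (dS x) (dist (proj x) e)) > 0" by simp
      then obtain n where "inverse (real (Suc n)) < min (weight x) (min (dS x) (dist (proj x) e))"
        using reals_Archimedean by blast
      then have "1 / Suc n \<le> weight x" "1 / Suc n \<le> dS x" "1 / Suc n \<le> dist (proj x) e"
        unfolding inverse_eq_divide by linarith+
      then have "x \<in> robust (1 / Suc n)" using elim u unfolding robust_def by blast
      then show False using elim by blast
    qed
  qed
  then show False using assms by blast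
qed

text \<open>
  A maximal \<open>h\<close>-separated set. Around each of its points \<open>S\<close> has length at least \<open>h/3\<close> in a ball of radius \<open>h/3\<close>, and these
  balls are disjoint, so there are at most \<open>3 * l / h\<close> points.
\<close>
lemma separated_cover:
  assumes c: "c > 0" and h: "0 < h" "h \<le> c"
  obtains P where "finite P" "P \<subseteq> {\<sigma>\<in>S. c \<le> dist \<sigma> e}" "{\<sigma>\<in>S. c \<le> dist \<sigma> e} \<subseteq> (\<Union>p\<in>P. cball p h)"
    "real (card P) * h \<le> 3 * l"
proof -
  let ?S = "{\<sigma>\<in>S. c \<le> dist \<sigma> e}"
  define sep where "sep = (\<lambda>P. finite P \<and> P \<subseteq> ?S \<and> (\<forall>p\<in>P. \<forall>q\<in>P. p \<noteq> q \<longrightarrow> h < dist p q))"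
  have bound: "real (card P) * h \<le> 3 * l" if P: "sep P" for P
  proof -
    have "of_nat (card P) * ennreal (h/3) \<le> hausdorff1 (\<Union>p\<in>P. S \<inter> cball p (h/3))"
    proof (rule hausdorff1_disjoint_family)
      show "disjoint_family_on (\<lambda>p. S \<inter> cball p (h/3)) P"
        unfolding disjoint_family_on_def
      proof (intro ballI impI equals0I)
        fix p q z assume pq: "p \<in> P" "q \<in> P" "p \<noteq> q" and z: "z \<in> (S \<inter> cball p (h/3)) \<inter> (S \<inter> cball q (h/3))"
        have "h < dist p q" using P pq by (auto simp: sep_def)
        moreover have "dist p q \<le> h/3 + h/3" using z dist_triangle2[of p q z] by (auto simp: dist_commute)
        ultimately show False using h by linarith
      qed
      fix p assume p: "p \<in> P"
      then have pS: "p \<in> S" "c \<le> dist p e" using P by (auto simp: sep_def)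
      show "compact (S \<inter> cball p (h/3))" using S_props(2) by (simp add: compact_Int_closed)
      show "ennreal (h/3) \<le> hausdorff1 (S \<inter> cball p (h/3))"
        using hausdorff1_connected_Int_cball[OF S_props(3) pS(1) e_in, of "h/3"] pS h by simp
    qed (use P in \<open>auto simp: sep_def\<close>)
    also have "\<dots> \<le> hausdorff1 S" by (rule hausdorff1_mono) auto
    also have "\<dots> \<le> ennreal l" by (rule S_props(4))
    finally have "ennreal (real (card P) * (h/3)) \<le> ennreal l"
      using h by (subst ennreal_mult) (auto simp: ennreal_of_nat_eq_real_of_nat)
    then have "real (card P) * (h/3) \<le> l" using l_pos by (simp add: ennreal_le_iff)
    then show ?thesis by simp
  qed
  have "sep {}" by (simp add: sep_def)
  moreover have "\<forall>P. sep P \<longrightarrow> card P < nat \<lceil>3 * l / h\<rceil> + 1"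
  proof (intro allI impI)
    fix P assume "sep P"
    then have "real (card P) \<le> 3 * l / h" using bound h by (simp add: pos_le_divide_eq)
    then show "card P < nat \<lceil>3 * l / h\<rceil> + 1" by linarith
  qed
  ultimately obtain P where P: "sep P" "\<And>Q. sep Q \<Longrightarrow> card Q \<le> card P"
    using ex_has_greatest_nat[of sep "{}" card] by blast
  have "?S \<subseteq> (\<Union>p\<in>P. cball p h)"
  proof (rule ccontr)
    assume "\<not> ?thesis"
    then obtain \<sigma> where \<sigma>: "\<sigma> \<in> ?S" "\<And>p. p \<in> P \<Longrightarrow> h < dist p \<sigma>" by fastforce
    then have "\<sigma> \<notin> P" using h by force
    moreover have "sep (insert \<sigma> P)" using P(1) \<sigma> by (auto simp: sep_def dist_commute)
    ultimately show False using P(1) P(2)[of "insert \<sigma> P"] by (simp add: sep_def)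
  qed
  then show thesis using that[of P] P(1) bound[OF P(1)] by (simp add: sep_def)
qed

lemma exists_coordinate_direction:
  fixes v :: 'a
  shows "\<exists>b \<in> Basis \<union> uminus ` Basis. norm v \<le> real DIM('a) * (v \<bullet> b)"
proof (rule ccontr)
  assume no: "\<not> ?thesis"
  have "\<bar>v \<bullet> b\<bar> < norm v / real DIM('a)" if b: "b \<in> Basis" for b
  proof -
    have no': "real DIM('a) * (v \<bullet> a) < norm v" if "a \<in> Basis \<union> uminus ` Basis" for a using no that by (auto simp: not_le)
    have "real DIM('a) * (v \<bullet> b) < norm v" "real DIM('a) * (v \<bullet> (-b)) < norm v"
      by (rule no'; use b in blast)+
    then have "real DIM('a) * \<bar>v \<bullet> b\<bar> < norm v" by (simp add: abs_if)
    then show ?thesis by (simp add: pos_less_divide_eq mult.commute)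
  qed
  then have "(\<Sum>b\<in>Basis. \<bar>v \<bullet> b\<bar>) < (\<Sum>b\<in>(Basis::'a set). norm v / real DIM('a))"
    by (intro sum_strict_mono) auto
  then show False using norm_le_l1[of v] by simp
qed

definition gain_cell :: "real \<Rightarrow> real \<Rightarrow> real \<Rightarrow> bool" where
  "gain_cell c \<kappa> h \<longleftrightarrow> (\<exists>p b X. p \<in> S \<and> c \<le> dist p e \<and> norm b = 1 \<and> X \<in> sets borel \<and> \<kappa> * h \<le> measure \<mu> X \<and>
       (\<forall>x\<in>X. active x \<and> c \<le> dist (proj x) e \<and>
          \<phi> (dist x (p + (4 * real DIM('a) * h) *\<^sub>R b)) - \<phi> (dS x) \<le> - (\<kappa> * h)))"

text \<open>
  A segment of length \<open>4 * DIM('a) * h\<close> attached far from the end can gain at least a constant times \<open>h\<^sup>2\<close>. Sort the robust points by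
  the position of their nearest point, up to \<open>h\<close>, and by a coordinate direction along which they pull. There are only of the order of \<open>1/h\<close> classes,
  so some class has measure at least of the order of \<open>h\<close>. A segment in its direction beats the error \<open>h\<close> in the position and brings all points of the
  class closer by \<open>h\<close>.
\<close>
lemma exists_gain_cell:
  assumes "\<not> (AE x in \<mu>. weight x = 0)"
  obtains c \<kappa> h0 where "c > 0" "\<kappa> > 0" "h0 > 0"
    "\<And>h. 0 < h \<Longrightarrow> h \<le> h0 \<Longrightarrow> gain_cell c \<kappa> h"
proof -
  obtain c where c: "c > 0" "measure \<mu> (robust c) > 0" using exists_robust[OF assms] .
  define n where "n = real DIM('a)"
  have n1: "n \<ge> 1" unfolding n_def using DIM_positive[where 'a='a] by (simp add: Suc_le_eq)
  define m where "m = measure \<mu> (robust c)"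
  define \<kappa> where "\<kappa> = min (m / (6 * l * n)) (c / 2)"
  \<comment> \<open>The three bounds keep \<open>h\<close> below the distance, the curvature of the distance function below the gain, and the second-order term of \<open>\<phi>\<close> below half of its first-order term.\<close>
  define h0 where "h0 = min c (min (c / (4 * n * n)) (c / (2 * (K + 1))))"
  show thesis
  proof (rule that[of c \<kappa> h0])
    show "\<kappa> > 0" using c n1 l_pos by (simp add: \<kappa>_def m_def)
    show "h0 > 0" using c n1 K_nonneg by (simp add: h0_def)
    fix h assume h: "0 < h" "h \<le> h0"
    define \<tau> where "\<tau> = 4 * n * h"
    have hc: "h \<le> c" using h by (simp add: h0_def)
    have "h * (4 * n * n) \<le> c" using h n1 by (simp add: h0_def pos_le_divide_eq)
    then have \<tau>c: "\<tau> * n \<le> c" by (simp add: \<tau>_def algebra_simps)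
    have "h * (2 * (K + 1)) \<le> c" using h K_nonneg by (simp add: h0_def pos_le_divide_eq)
    then have Kh: "K * h \<le> c / 2" using h by (simp add: algebra_simps)
    obtain P where P: "finite P" "P \<subseteq> {\<sigma>\<in>S. c \<le> dist \<sigma> e}" "{\<sigma>\<in>S. c \<le> dist \<sigma> e} \<subseteq> (\<Union>p\<in>P. cball p h)"
      "real (card P) * h \<le> 3 * l" using separated_cover[OF c(1) h(1) hc] .
    define D where "D = Basis \<union> uminus ` (Basis :: 'a set)"
    have D: "finite D" "real (card D) \<le> 2 * n"
    proof -
      show "finite D" by (simp add: D_def)
      have "card D \<le> card (Basis :: 'a set) + card (uminus ` (Basis :: 'a set))" unfolding D_def by (rule card_Un_le)
      also have "\<dots> \<le> DIM('a) + DIM('a)" by (intro add_mono card_image_le) auto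
      finally show "real (card D) \<le> 2 * n" by (simp add: n_def)
    qed
    define X where "X = (\<lambda>(p, b). {x \<in> robust c. proj x \<in> cball p h \<and> dS x \<le> n * ((x - proj x) \<bullet> b)})"
    have Xs: "X q \<in> sets borel" for q
      unfolding X_def by (cases q) (simp, measurable)
    have cover: "robust c \<subseteq> (\<Union>q\<in>P\<times>D. X q)"
    proof
      fix x assume x: "x \<in> robust c"
      then have pr: "proj x \<in> S" "norm (x - proj x) = dS x" using uniq_proj[of x] by (auto simp: robust_def dist_norm)
      then have "proj x \<in> {\<sigma>\<in>S. c \<le> dist \<sigma> e}" using x by (auto simp: robust_def)
      then obtain p where "p \<in> P" "proj x \<in> cball p h" using P(3) by blast
      moreover obtain b where "b \<in> D" "dS x \<le> n * ((x - proj x) \<bullet> b)"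
        using exists_coordinate_direction[of "x - proj x"] pr(2) by (auto simp: D_def n_def)
      ultimately show "x \<in> (\<Union>q\<in>P\<times>D. X q)" using x by (intro UN_I[of "(p, b)"]) (auto simp: X_def)
    qed
    have "\<exists>q\<in>P\<times>D. \<kappa> * h \<le> measure \<mu> (X q)"
    proof (rule ccontr)
      assume "\<not> ?thesis"
      then have lt: "measure \<mu> (X q) < \<kappa> * h" if "q \<in> P\<times>D" for q using that by (auto simp: not_le)
      have "m \<le> measure \<mu> (\<Union>q\<in>P\<times>D. X q)"
        unfolding m_def using cover Xs P(1) D(1) by (intro finite_measure_mono) (auto simp: sets_borel)
      also have "\<dots> \<le> (\<Sum>q\<in>P\<times>D. measure \<mu> (X q))"
        using Xs P(1) D(1) by (intro finite_measure_subadditive_finite) (auto simp: sets_borel)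
      finally have ms: "m \<le> (\<Sum>q\<in>P\<times>D. measure \<mu> (X q))" .
      then have "P \<times> D \<noteq> {}" using c(2) by (auto simp: m_def)
      then have "(\<Sum>q\<in>P\<times>D. measure \<mu> (X q)) < (\<Sum>q\<in>P\<times>D. \<kappa> * h)"
        using P(1) D(1) lt by (intro sum_strict_mono) auto
      also have "\<dots> = (real (card P) * h) * real (card D) * \<kappa>" by (simp add: card_cartesian_product)
      also have "\<dots> \<le> (3 * l) * (2 * n) * (m / (6 * l * n))"
      proof (rule mult_mono)
        show "real (card P) * h * real (card D) \<le> 3 * l * (2 * n)"
          using P(4) D(2) l_pos h by (intro mult_mono[of "real (card P) * h"]) auto
      qed (use l_pos n1 c in \<open>auto simp: \<kappa>_def m_def\<close>)
      also have "\<dots> = m" using l_pos n1 by simp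
      finally show False using ms by simp
    qed
    then obtain p b where q: "p \<in> P" "b \<in> D" "\<kappa> * h \<le> measure \<mu> (X (p, b))" by auto
    have nb: "norm b = 1" using q(2) by (auto simp: D_def)
    have "active x \<and> c \<le> dist (proj x) e \<and> \<phi> (dist x (p + (4 * n * h) *\<^sub>R b)) - \<phi> (dS x) \<le> - (\<kappa> * h)"
      if "x \<in> X (p, b)" for x
    proof -
      have x: "norm x \<le> \<rho>" "uniq x" "c \<le> weight x" "c \<le> dS x" "c \<le> dist (proj x) e"
        "dist (proj x) p \<le> h" "dS x \<le> n * ((x - proj x) \<bullet> b)"
        using that by (auto simp: X_def robust_def dist_commute)
      define v where "v = x - proj x"
      have nv: "norm v = dS x" using uniq_proj[OF x(2)] by (simp add: v_def dist_norm)
      have v0: "v \<noteq> 0" using nv x(4) c(1) by auto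
      have nvpos: "norm v > 0" using v0 by simp
      have vb: "1 / n \<le> (v \<bullet> b) / norm v" using x(7) n1 nvpos by (simp add: v_def[symmetric] nv[symmetric] field_simps)
      have \<tau>0: "\<tau> > 0" using h n1 by (simp add: \<tau>_def)
      have "norm (v + (- \<tau>) *\<^sub>R b) \<le> norm v + (v \<bullet> ((- \<tau>) *\<^sub>R b)) / norm v + (norm ((- \<tau>) *\<^sub>R b))\<^sup>2 / (2 * norm v)"
        by (rule norm_add_le_second_order[OF v0])
      also have "\<dots> = norm v - \<tau> * ((v \<bullet> b) / norm v) + \<tau>\<^sup>2 / (2 * norm v)" using nb by simp
      also have "\<dots> \<le> norm v - \<tau> * (1 / n) + \<tau>\<^sup>2 / (2 * c)"
        using vb \<tau>0 c x(4) nv nvpos by (intro add_mono diff_mono mult_left_mono divide_left_mono) auto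
      also have "\<tau>\<^sup>2 / (2 * c) \<le> \<tau> * (1 / n) / 2"
      proof -
        have "\<tau> * (\<tau> * n) \<le> \<tau> * c" using \<tau>c \<tau>0 by (intro mult_left_mono) auto
        then show ?thesis using c n1 by (simp add: field_simps power2_eq_square)
      qed
      finally have 1: "norm (v + (- \<tau>) *\<^sub>R b) \<le> norm v - \<tau> * (1 / n) / 2" by simp
      have "\<tau> * (1 / n) / 2 = 2 * h" using n1 by (simp add: \<tau>_def)
      then have 2: "norm (v + (- \<tau>) *\<^sub>R b) \<le> norm v - 2 * h" using 1 by simp
      have "x - (p + \<tau> *\<^sub>R b) = (v + (- \<tau>) *\<^sub>R b) + (proj x - p)" by (simp add: v_def)
      then have "dist x (p + \<tau> *\<^sub>R b) \<le> norm (v + (- \<tau>) *\<^sub>R b) + dist (proj x) p"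
        unfolding dist_norm by (metis norm_triangle_ineq)
      then have le: "dist x (p + \<tau> *\<^sub>R b) \<le> dS x - h" using 2 x(6) nv by linarith
      have inb: "dS x \<in> {0..2*\<rho>+3}" by (rule infdist_S_bound[OF x(1)])
      have "\<phi> (dist x (p + \<tau> *\<^sub>R b)) \<le> \<phi> (dS x - h)" using le by (intro mono) auto
      moreover have "\<phi> (dS x - h) - \<phi> (dS x) \<le> weight x * (dS x - h - dS x) + K * (dS x - h - dS x)\<^sup>2"
        unfolding weight_def using inb x(4) hc h by (intro taylor) auto
      moreover have "weight x * (dS x - h - dS x) + K * (dS x - h - dS x)\<^sup>2 = - (weight x * h) + (K * h) * h"
        by (simp add: power2_eq_square)
      moreover have "c * h \<le> weight x * h" "(K * h) * h \<le> (c / 2) * h" "\<kappa> * h \<le> (c/2) * h"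
        using x(3) Kh h by (auto intro!: mult_right_mono simp: \<kappa>_def)
      ultimately have "\<phi> (dist x (p + \<tau> *\<^sub>R b)) - \<phi> (dS x) \<le> - (\<kappa> * h)" by linarith
      then show ?thesis using x c by (auto simp: \<tau>_def active_def)
    qed
    then show "gain_cell c \<kappa> h"
      using q nb Xs P(2) unfolding n_def gain_cell_def by (intro exI[of _ p] exI[of _ b] exI[of _ "X (p, b)"]) auto
  qed (rule c(1))
qed

text \<open>
  The two segments together use up exactly the saved length \<open>r/2\<close>.
\<close>
lemma competitor_admissible:
  assumes T: "compact T" "connected T" "T \<subseteq> S" "e' \<in> T" "p \<in> T" and r: "r > 0" "r \<le> 1"
    and len: "hausdorff1 T + ennreal (r/2) \<le> hausdorff1 S" and b: "norm b = 1" "norm b' = 1"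
  defines "T' \<equiv> T \<union> closed_segment e' (e' + (r/4) *\<^sub>R b) \<union> closed_segment p (p + (r/4) *\<^sub>R b')"
  shows "T' \<in> continua_le l" "T' \<subseteq> cball 0 (\<rho> + 3)"
proof -
  have seg: "hausdorff1 (closed_segment a (a + (r/4) *\<^sub>R c)) \<le> ennreal (r/4)" if "norm c = 1" for a c :: 'a
    using hausdorff1_closed_segment[of a "a + (r/4) *\<^sub>R c"] that r by (simp add: dist_norm)
  have "hausdorff1 T' \<le> hausdorff1 (T \<union> closed_segment e' (e' + (r/4) *\<^sub>R b)) + ennreal (r/4)"
    unfolding T'_def by (rule order_trans[OF hausdorff1_Un_le add_left_mono[OF seg[OF b(2)]]])
  also have "\<dots> \<le> hausdorff1 T + ennreal (r/4) + ennreal (r/4)"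
    by (intro add_right_mono order_trans[OF hausdorff1_Un_le add_left_mono[OF seg[OF b(1)]]])
  also have "\<dots> \<le> ennreal (l - r/2) + ennreal (r/4) + ennreal (r/4)"
    by (intro add_mono order_refl shortened_length(1)[OF len r(1)])
  also have "\<dots> = ennreal l"
    using shortened_length(2)[OF len r(1)] r by (simp add: ennreal_plus[symmetric] del: ennreal_plus)
  finally have "hausdorff1 T' \<le> ennreal l" .
  moreover have "compact T'" unfolding T'_def using T by (intro compact_Un) auto
  moreover have "connected T'"
    unfolding T'_def using T by (intro connected_Un) auto
  ultimately show "T' \<in> continua_le l" using T(4) by (auto simp: continua_le_def T'_def)
  have end_in: "a \<in> cball 0 (\<rho> + 3)" "a + (r/4) *\<^sub>R c \<in> cball 0 (\<rho> + 3)" if "a \<in> T" "norm c = 1" for a c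
  proof -
    have a: "norm a \<le> \<rho>" using that T(3) S_bounded by auto
    then show "a \<in> cball 0 (\<rho> + 3)" by simp
    have "norm (a + (r/4) *\<^sub>R c) \<le> norm a + r/4" using norm_triangle_ineq[of a "(r/4) *\<^sub>R c"] that r by simp
    then show "a + (r/4) *\<^sub>R c \<in> cball 0 (\<rho> + 3)" using a r by simp
  qed
  show "T' \<subseteq> cball 0 (\<rho> + 3)"
    unfolding T'_def using T(3) S_bounded_plus end_in[OF T(4) b(1)] end_in[OF T(5) b(2)]
    by (intro Un_least closed_segment_subset convex_cball) auto
qed

text \<open>
  The effect on a point whose nearest point was removed. It may go to \<open>e'\<close> or to the tip of the segment there, whichever
  side of the segment the pull prefers; this yields the gain \<open>max 0 (pull x \<bullet> b)\<close>. The error of the linear term is of order \<open>r\<^sup>2\<close>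
  divided by the distance for points at distance at least \<open>s0\<close>. For closer points it is only of order \<open>r\<close>, but these lie in a small ball around \<open>e\<close>.
\<close>
lemma change_near_end:
  assumes x: "norm x \<le> \<rho>" "active x" "proj x \<in> cball e r" "x \<notin> S"
    and r: "0 < r" "r \<le> 1" and e': "e' \<in> S" "dist e' e \<le> r" and b: "norm b = 1" and s0: "s0 > 0"
    and near: "infdist x T' \<le> dist x e'" "infdist x T' \<le> dist x (e' + (r/4) *\<^sub>R b)"
  shows "\<phi> (infdist x T') - \<phi> (dS x) \<le> pull x \<bullet> (proj x - e') - (r/4) * max 0 (pull x \<bullet> b)
     + 6 * W * r * indicat_real (ball e (s0 + 2 * r)) x + 9 * r\<^sup>2 / (2 * s0) * weight x + 9 * K * r\<^sup>2"
proof -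
  \<comment> \<open>Use the tip only if the segment points in a direction in which \<open>x\<close> pulls.\<close>
  define \<theta> where "\<theta> = (if pull x \<bullet> b > 0 then r/4 else 0)"
  define y where "y = e' + \<theta> *\<^sub>R b"
  define v where "v = x - proj x"
  define z where "z = proj x - y"
  have pr: "proj x \<in> S" "norm v = dS x" using uniq_proj[of x] x(2) by (auto simp: active_def dist_norm v_def)
  have d0: "dS x > 0" using infdist_pos_iff x(4) by blast
  have v0: "v \<noteq> 0" using pr(2) d0 by auto
  have wb: "0 \<le> weight x" "weight x \<le> W" using weight_bounds[OF x(1)] by auto
  have near_y: "infdist x T' \<le> dist x y" using near by (auto simp: y_def \<theta>_def)
  have \<theta>: "0 \<le> \<theta>" "\<theta> \<le> r" using r by (auto simp: \<theta>_def)
  have nz: "norm z \<le> 3 * r"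
  proof -
    have "z = (proj x - e) + (e - e') - \<theta> *\<^sub>R b" by (simp add: z_def y_def)
    then have "norm z \<le> norm (proj x - e) + norm (e - e') + norm (\<theta> *\<^sub>R b)"
      by (metis norm_triangle_ineq norm_triangle_ineq4 add_mono_thms_linordered_semiring(3) order_trans)
    then show ?thesis using x(3) e'(2) b \<theta> by (simp add: dist_norm norm_minus_commute)
  qed
  have xy: "dist x y = norm (v + z)" by (simp add: v_def z_def dist_norm)
  have nvz: "norm (v + z) \<le> norm v + norm z" "norm v - norm z \<le> norm (v + z)"
    using norm_triangle_ineq[of v z] norm_diff_ineq[of v z] by auto
  have uz: "pull x \<bullet> z = weight x * ((v \<bullet> z) / norm v)" using x(2) by (simp add: pull_def v_def pr(2)[unfolded v_def])
  have uz': "pull x \<bullet> z = pull x \<bullet> (proj x - e') - (r/4) * max 0 (pull x \<bullet> b)"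
    by (auto simp: z_def y_def \<theta>_def inner_diff_right inner_add_right)
  have first: "weight x * (norm (v + z) - norm v) \<le> pull x \<bullet> z + weight x * ((norm z)\<^sup>2 / (2 * norm v))"
  proof -
    have "weight x * (norm (v + z) - norm v) \<le> weight x * ((v \<bullet> z) / norm v + (norm z)\<^sup>2 / (2 * norm v))"
      using norm_add_le_second_order[OF v0, of z] wb by (intro mult_left_mono) auto
    then show ?thesis by (simp add: uz distrib_left)
  qed
  have second: "weight x * (norm (v + z) - norm v) \<le> pull x \<bullet> z + 6 * W * r"
  proof -
    have "(- norm z) * norm v \<le> v \<bullet> z" using Cauchy_Schwarz_ineq2[of v z] by (simp add: abs_le_iff mult.commute)
    then have "- norm z \<le> (v \<bullet> z) / norm v" using v0 by (simp add: pos_le_divide_eq)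
    then have "norm (v + z) - norm v \<le> (v \<bullet> z) / norm v + 2 * norm z" using nvz(1) by linarith
    then have "weight x * (norm (v + z) - norm v) \<le> weight x * ((v \<bullet> z) / norm v + 2 * norm z)"
      using wb by (intro mult_left_mono)
    also have "\<dots> = pull x \<bullet> z + weight x * (2 * norm z)" by (simp add: uz distrib_left)
    also have "weight x * (2 * norm z) \<le> W * (2 * (3 * r))" using wb nz by (intro mult_mono) auto
    finally show ?thesis by simp
  qed
  have third: "weight x * (norm (v + z) - norm v) \<le> pull x \<bullet> z + 6 * W * r * indicat_real (ball e (s0 + 2 * r)) x + 9 * r\<^sup>2 / (2 * s0) * weight x"
  proof (cases "dS x < s0")
    case True
    have "dist e x \<le> r + dS x"
      using dist_triangle[of e x "proj x"] x(3) pr(2) by (simp add: v_def dist_norm norm_minus_commute)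
    then have "x \<in> ball e (s0 + 2 * r)" using True r by simp
    moreover have "0 \<le> 9 * r\<^sup>2 / (2 * s0) * weight x" using s0 wb by simp
    ultimately show ?thesis using second by simp
  next
    case False
    have "(norm z)\<^sup>2 \<le> (3 * r)\<^sup>2" using nz by (intro power_mono) auto
    then have "(norm z)\<^sup>2 / (2 * norm v) \<le> (3 * r)\<^sup>2 / (2 * s0)"
      using False pr(2) s0 by (intro frac_le) auto
    then have "weight x * ((norm z)\<^sup>2 / (2 * norm v)) \<le> weight x * ((3 * r)\<^sup>2 / (2 * s0))" using wb by (intro mult_left_mono)
    moreover have "0 \<le> 6 * W * r * indicat_real (ball e (s0 + 2 * r)) x" using W_nonneg r by (simp add: indicator_def)
    moreover have "weight x * ((3 * r)\<^sup>2 / (2 * s0)) = 9 * r\<^sup>2 / (2 * s0) * weight x" by (simp add: power_mult_distrib)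
    ultimately show ?thesis using first by linarith
  qed
  have "norm y \<le> \<rho> + 3"
  proof -
    have "norm e' \<le> \<rho>" using e'(1) S_bounded by auto
    then show ?thesis using norm_triangle_ineq[of e' "\<theta> *\<^sub>R b"] \<theta> r b by (simp add: y_def)
  qed
  then have "norm (v + z) \<le> 2 * \<rho> + 3" using norm_triangle_ineq4[of x y] x(1) xy by (simp add: dist_norm)
  then have "\<phi> (norm (v + z)) - \<phi> (norm v) \<le> weight x * (norm (v + z) - norm v) + K * (norm (v + z) - norm v)\<^sup>2"
    unfolding weight_def pr(2) using infdist_S_bound[OF x(1)] by (intro taylor) auto
  moreover have "K * (norm (v + z) - norm v)\<^sup>2 \<le> K * (3 * r)\<^sup>2"
  proof (intro mult_left_mono K_nonneg)
    have "\<bar>norm (v + z) - norm v\<bar> \<le> \<bar>3 * r\<bar>" using nvz nz r by linarith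
    then show "(norm (v + z) - norm v)\<^sup>2 \<le> (3 * r)\<^sup>2" by (simp only: abs_le_square_iff)
  qed
  moreover have "\<phi> (infdist x T') \<le> \<phi> (norm (v + z))" using near_y xy by (intro mono) (auto simp: infdist_nonneg)
  ultimately show ?thesis using third unfolding uz' pr(2) by (simp add: power_mult_distrib)
qed

text \<open>
  The positive parts in the directions \<open>b\<close> and \<open>-b\<close> add up to the modulus of a coordinate, and the moduli of
  the coordinates add up to at least the norm. So one of the \<open>2 * DIM('a)\<close> directions has its share.
\<close>
lemma exists_positive_direction:
  fixes F :: "'a \<Rightarrow> 'a"
  assumes [measurable]: "F \<in> borel_measurable borel" and bd: "AE x in \<mu>. norm (F x) \<le> B"
  shows "\<exists>b::'a. norm b = 1 \<and> (\<integral>x. norm (F x) \<partial>\<mu>) / (2 * DIM('a)) \<le> (\<integral>x. max 0 (F x \<bullet> b) \<partial>\<mu>)"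
proof (rule ccontr)
  assume no: "\<not> ?thesis"
  let ?N = "\<integral>x. norm (F x) \<partial>\<mu>" and ?I = "\<lambda>b. \<integral>x. max 0 (F x \<bullet> b) \<partial>\<mu>"
  have lt: "?I b < ?N / (2 * DIM('a))" if "norm b = 1" for b using no that by (auto simp: not_le)
  have int: "integrable \<mu> (\<lambda>x. max 0 (F x \<bullet> b))" if "norm b = 1" for b
  proof (rule integrable_bounded)
    show "AE x in \<mu>. \<bar>max 0 (F x \<bullet> b)\<bar> \<le> B"
      using bd
    proof eventually_elim
      case (elim x)
      have "F x \<bullet> b \<le> norm (F x)" using norm_cauchy_schwarz[of "F x" b] that by simp
      then show ?case using elim norm_ge_zero[of "F x"] by linarith
    qed
  qed measurable
  have intN: "integrable \<mu> (\<lambda>x. norm (F x))" using bd by (intro integrable_bounded[of _ B]) auto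
  have nb: "norm b = 1" "norm (-b) = 1" if "b \<in> Basis" for b :: 'a using that by auto
  have "?N \<le> (\<integral>x. (\<Sum>b\<in>Basis. max 0 (F x \<bullet> b) + max 0 (F x \<bullet> (-b))) \<partial>\<mu>)"
  proof (rule integral_mono[OF intN])
    show "integrable \<mu> (\<lambda>x. \<Sum>b\<in>Basis. max 0 (F x \<bullet> b) + max 0 (F x \<bullet> (-b)))"
      by (intro Bochner_Integration.integrable_sum Bochner_Integration.integrable_add int nb)
    fix x
    have "norm (F x) \<le> (\<Sum>b\<in>Basis. \<bar>F x \<bullet> b\<bar>)" by (rule norm_le_l1)
    also have "\<dots> = (\<Sum>b\<in>Basis. max 0 (F x \<bullet> b) + max 0 (F x \<bullet> (-b)))" by (intro sum.cong) auto
    finally show "norm (F x) \<le> (\<Sum>b\<in>Basis. max 0 (F x \<bullet> b) + max 0 (F x \<bullet> (-b)))" .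
  qed
  also have "\<dots> = (\<Sum>b\<in>Basis. ?I b + ?I (-b))"
  proof (subst Bochner_Integration.integral_sum)
    show "(\<Sum>b\<in>Basis. \<integral>x. max 0 (F x \<bullet> b) + max 0 (F x \<bullet> (-b)) \<partial>\<mu>) = (\<Sum>b\<in>Basis. ?I b + ?I (-b))"
      by (intro sum.cong refl Bochner_Integration.integral_add int nb)
  qed (intro Bochner_Integration.integrable_add int nb)
  also have "\<dots> < (\<Sum>b\<in>(Basis::'a set). ?N / DIM('a))"
  proof (intro sum_strict_mono)
    fix b :: 'a assume "b \<in> Basis"
    then show "?I b + ?I (-b) < ?N / DIM('a)" using lt[OF nb(1)] lt[OF nb(2)] by (fastforce simp: field_simps)
  qed auto
  also have "\<dots> = ?N" by simp
  finally show False by simp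
qed

text \<open>
  Four kinds of points: those of the gain cell; those whose nearest point is removed; those whose nearest point
  stays; and those of weight zero, where even a change of the distance by \<open>2 * r\<close> has an effect of order \<open>r\<^sup>2\<close> only.
\<close>
lemma competitor_pointwise:
  assumes T: "closed T" "T \<subseteq> S" "S - T \<subseteq> cball e r" "e' \<in> T" "dist e' e \<le> r" and r: "0 < r" "r \<le> 1" "r < c"
    and b0: "norm b0 = 1" and s0: "s0 > 0"
    and X: "\<And>x. x \<in> X \<Longrightarrow> active x \<and> c \<le> dist (proj x) e \<and> \<phi> (dist x y1) - \<phi> (dS x) \<le> - g"
    and T': "T \<subseteq> T'" "e' + (r/4) *\<^sub>R b0 \<in> T'" "y1 \<in> T'" "T' \<subseteq> cball 0 (\<rho> + 3)"
  defines "F \<equiv> \<lambda>x. indicat_real (S - T) (proj x) *\<^sub>R pull x"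
  shows "AE x in \<mu>. \<phi> (infdist x T') - \<phi> (dS x) \<le>
     indicat_real (S - T) (proj x) * (pull x \<bullet> (proj x - e')) - (r/4) * max 0 (F x \<bullet> b0)
     + 6 * W * r * indicat_real (ball e (s0 + 2 * r)) x + 9 * r\<^sup>2 / (2 * s0) * norm (F x)
     + 9 * K * r\<^sup>2 * indicat_real (near_end r) x - g * indicat_real X x"
  using AE_bounded AE_notin AE_uniq norm_pull
proof eventually_elim
  case (elim x)
  have pos: "0 \<le> 6 * W * r * indicat_real (ball e (s0 + 2 * r)) x" "0 \<le> 9 * K * r\<^sup>2 * indicat_real (near_end r) x"
    using W_nonneg K_nonneg r by (auto simp: indicator_def)
  have T'ne: "T' \<noteq> {}" using T' by auto
  have notin_cut: "z \<in> T" if "z \<in> S" "r < dist z e" for z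
    using T(3) that by (auto simp: dist_commute subset_iff not_le)
  have nonpos: "\<phi> (infdist x T') - \<phi> (dS x) \<le> 0" if "z \<in> T" "dist x z = dS x" for z
  proof -
    have "infdist x T' \<le> dist x z" using that(1) T'(1) by (intro infdist_le) auto
    then have "\<phi> (infdist x T') \<le> \<phi> (dS x)" using that(2) by (intro mono) (auto simp: infdist_nonneg)
    then show ?thesis by simp
  qed
  consider (cell) "x \<in> X" | (cut) "x \<notin> X" "active x" "proj x \<in> S - T"
    | (keep) "x \<notin> X" "active x" "proj x \<notin> S - T" | (flat) "x \<notin> X" "\<not> active x" by blast
  then show ?case
  proof cases
    case cell
    then have gx: "active x" "c \<le> dist (proj x) e" "\<phi> (dist x y1) - \<phi> (dS x) \<le> - g" using X by auto
    have "proj x \<in> T" using gx r uniq_proj[of x] by (intro notin_cut) (auto simp: active_def)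
    moreover have "\<phi> (infdist x T') \<le> \<phi> (dist x y1)" using T'(3) by (intro mono infdist_le infdist_nonneg)
    ultimately show ?thesis using gx(3) pos cell by (simp add: F_def)
  next
    case cut
    have "x \<in> near_end r"
    proof -
      have "proj x \<in> S" "dist x (proj x) = dS x" using uniq_proj[of x] cut by (auto simp: active_def)
      moreover have "dist (proj x) e \<le> r" using cut(3) T(3) by (auto simp: dist_commute subset_iff)
      ultimately show ?thesis using r by (subst near_end_iff) auto
    qed
    have "\<phi> (infdist x T') - \<phi> (dS x) \<le> pull x \<bullet> (proj x - e') - (r/4) * max 0 (pull x \<bullet> b0)
     + 6 * W * r * indicat_real (ball e (s0 + 2 * r)) x + 9 * r\<^sup>2 / (2 * s0) * weight x + 9 * K * r\<^sup>2"
    proof (rule change_near_end)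
      show "infdist x T' \<le> dist x e'" "infdist x T' \<le> dist x (e' + (r/4) *\<^sub>R b0)"
        using T(4) T' by (auto intro: infdist_le)
    qed (use elim cut T r b0 s0 in auto)
    moreover have "norm (F x) = weight x" using elim cut by (simp add: F_def)
    ultimately show ?thesis using cut \<open>x \<in> near_end r\<close> by (simp add: F_def)
  next
    case keep
    have "proj x \<in> T" "dist x (proj x) = dS x" using keep uniq_proj[of x] by (auto simp: active_def)
    from nonpos[OF this] show ?thesis using keep pos by (simp add: F_def)
  next
    case flat
    then have w0: "weight x = 0" and u0: "pull x = 0" using elim by (auto simp: active_def pull_def)
    have "\<phi> (infdist x T') - \<phi> (dS x) \<le> 9 * K * r\<^sup>2 * indicat_real (near_end r) x"
    proof (cases "x \<in> near_end r")
      case True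
      then obtain \<sigma> where \<sigma>: "\<sigma> \<in> S" "dist x \<sigma> = dS x" "dist \<sigma> e \<le> r" using r by (subst (asm) near_end_iff) auto
      have "infdist x T' \<le> dist x e'" using T(4) T'(1) by (intro infdist_le) auto
      also have "\<dots> \<le> dist x \<sigma> + dist \<sigma> e + dist e e'"
        using dist_triangle[of x e' \<sigma>] dist_triangle[of \<sigma> e' e] by linarith
      finally have le: "infdist x T' \<le> dS x + 2 * r" using \<sigma> T(5) by (simp add: dist_commute)
      show ?thesis
      proof (cases "infdist x T' \<le> dS x")
        case True
        then have "\<phi> (infdist x T') \<le> \<phi> (dS x)" by (intro mono) (auto simp: infdist_nonneg)
        then show ?thesis using pos(2) by linarith
      next
        case False
        have "\<phi> (infdist x T') - \<phi> (dS x) \<le> weight x * (infdist x T' - dS x) + K * (infdist x T' - dS x)\<^sup>2"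
          unfolding weight_def using infdist_S_bound infdist_le_bound[OF _ T'ne T'(4)] elim
          by (intro taylor) (auto simp: infdist_nonneg)
        also have "\<dots> = K * (infdist x T' - dS x)\<^sup>2" by (simp add: w0)
        also have "\<dots> \<le> K * (3 * r)\<^sup>2"
          using False le r(1) K_nonneg by (intro mult_left_mono power_mono) auto
        finally show ?thesis using True by (simp add: power_mult_distrib)
      qed
    next
      case False
      obtain \<sigma> where \<sigma>: "\<sigma> \<in> S" "dist x \<sigma> = dS x" by (rule nearest_exists)
      then have "r < dist \<sigma> e" using False r near_end_iff[of r x] by (auto simp: not_le)
      then have "\<sigma> \<in> T" using \<sigma>(1) by (intro notin_cut)
      from nonpos[OF this \<sigma>(2)] show ?thesis using pos(2) by linarith
    qed
    then show ?thesis using flat pos(1) by (simp add: F_def u0)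
  qed
qed

text \<open>
  Let \<open>N\<close> be the total weight of the points whose nearest point is removed. The segments gain at least a constant times
  \<open>r * N + r\<^sup>2\<close>. The errors are \<open>r\<^sup>2 * N / s0\<close>, the measure of a ball of radius \<open>s0 + 2 * r\<close> times \<open>r\<close>, and \<open>r\<^sup>2\<close> times the small measure of
  \<open>near_end r\<close>. With \<open>s0\<close> a large multiple of \<open>r + N\<close> the first is a small multiple of \<open>r\<^sup>2\<close>, and the second is a small multiple of
  \<open>r * (r + N)\<close> because balls around \<open>e\<close> of radius \<open>s\<close> have measure \<open>o(s)\<close> and \<open>N\<close> tends to zero with \<open>r\<close>.
\<close>
lemma not_atomless_end:
  assumes nontriv: "\<not> (AE x in \<mu>. weight x = 0)"
    and small: "(\<lambda>\<epsilon>. measure \<mu> (ball e \<epsilon>)) \<in> o[at_right 0](\<lambda>\<epsilon>. \<epsilon>)"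
  shows False
proof -
  obtain c \<kappa> h0 where c: "c > 0" "\<kappa> > 0" "h0 > 0" and
    cell: "\<And>h. 0 < h \<Longrightarrow> h \<le> h0 \<Longrightarrow> gain_cell c \<kappa> h"
    using exists_gain_cell[OF nontriv] by blast
  define n where "n = real DIM('a)"
  have n1: "n \<ge> 1" unfolding n_def using DIM_positive[where 'a='a] by (simp add: Suc_le_eq)
  \<comment> \<open>The second segment gains at least \<open>\<gamma> * r\<^sup>2\<close>; three error terms of a quarter of this are allowed.\<close>
  define \<gamma> where "\<gamma> = (\<kappa> / (16 * n))\<^sup>2"
  have \<gamma>: "\<gamma> > 0" using c n1 by (simp add: \<gamma>_def)
  define \<theta> where "\<theta> = min (\<gamma> / 4) (1 / (16 * n))"
  have \<theta>: "\<theta> > 0" "\<theta> \<le> \<gamma> / 4" "\<theta> \<le> 1 / (16 * n)" using \<gamma> n1 by (auto simp: \<theta>_def)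
  \<comment> \<open>The multiple of \<open>r + N\<close> that serves as \<open>s0\<close>.\<close>
  define Q where "Q = 18 / \<gamma>"
  have Q: "Q > 0" using \<gamma> by (simp add: Q_def)
  define \<eta> where "\<eta> = \<theta> / (6 * (W + 1) * (Q + 2))"
  have \<eta>: "\<eta> > 0" unfolding \<eta>_def using \<theta> W_nonneg Q by (intro divide_pos_pos mult_pos_pos) auto
  obtain s1 where s1: "s1 > 0" "\<And>s. 0 < s \<Longrightarrow> s < s1 \<Longrightarrow> measure \<mu> (ball e s) \<le> \<eta> * s"
  proof -
    have "eventually (\<lambda>s. norm (measure \<mu> (ball e s)) \<le> \<eta> * norm s) (at_right 0)"
      using landau_o.smallD[OF small \<eta>] by blast
    then obtain s1 where "s1 > 0" "\<And>s. 0 < s \<Longrightarrow> s < s1 \<Longrightarrow> norm (measure \<mu> (ball e s)) \<le> \<eta> * norm s"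
      unfolding eventually_at_right_field by auto
    then show thesis by (intro that[of s1]) auto
  qed
  define \<alpha> where "\<alpha> = min (\<gamma> / (36 * (K + 1))) (s1 / (2 * Q * (W + 1)))"
  have \<alpha>: "\<alpha> > 0" using \<gamma> s1 K_nonneg Q W_nonneg by (simp add: \<alpha>_def)
  obtain \<delta>1 where \<delta>1: "\<delta>1 > 0" "\<And>r. 0 \<le> r \<Longrightarrow> r \<le> \<delta>1 \<Longrightarrow> measure \<mu> (near_end r) < \<alpha>" using measure_near_end_small[OF \<alpha>] by metis
  define \<delta> where "\<delta> = min \<delta>1 (min 1 (min (c/2) (min (16 * n * h0) (s1 / (4 * (Q + 2))))))"
  have "\<delta> > 0" using \<delta>1 c n1 s1 Q by (simp add: \<delta>_def)
  then obtain r T e' where r: "0 < r" "r \<le> \<delta>" and T: "compact T" "connected T" "T \<subseteq> S" "S - T \<subseteq> cball e r"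
    and e': "e' \<in> T" "dist e' e \<le> r" and len: "hausdorff1 T + ennreal (r/2) \<le> hausdorff1 S"
    using ends unfolding small_end_def by blast
  have rs: "r \<le> \<delta>1" "r \<le> 1" "r < c" "r \<le> 16 * n * h0" "r \<le> s1 / (4 * (Q + 2))" using r c by (auto simp: \<delta>_def)
  \<comment> \<open>With this \<open>h\<close> the second segment has length \<open>4 * n * h = r/4\<close>.\<close>
  define h where "h = r / (16 * n)"
  have h: "0 < h" "h \<le> h0" "4 * n * h = r / 4" using r rs n1 by (auto simp: h_def field_simps)
  obtain p b1 X where p: "p \<in> S" "c \<le> dist p e" "norm b1 = 1" and X: "X \<in> sets borel" "\<kappa> * h \<le> measure \<mu> X"
    and gain: "\<And>x. x \<in> X \<Longrightarrow> active x \<and> c \<le> dist (proj x) e \<and> \<phi> (dist x (p + (r/4) *\<^sub>R b1)) - \<phi> (dS x) \<le> - (\<kappa> * h)"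
    using cell[OF h(1,2)] unfolding gain_cell_def n_def[symmetric] h(3) by blast
  have pT: "p \<in> T" using p T(4) rs(3) by (auto simp: dist_commute subset_iff)
  have clT: "closed T" "T \<noteq> {}" using T e' by (auto simp: compact_imp_closed)
  have e'S: "e' \<in> S" using e' T by auto
  define F where "F = (\<lambda>x. indicat_real (S - T) (proj x) *\<^sub>R pull x)"
  have STs [measurable]: "S - T \<in> sets borel" using S_closed clT by auto
  have Fm [measurable]: "F \<in> borel_measurable borel" unfolding F_def by measurable
  have Fle: "norm (F x) \<le> norm (pull x)" for x by (simp add: F_def indicator_def)
  have Fb: "AE x in \<mu>. norm (F x) \<le> W" using norm_pull_le by eventually_elim (use Fle order_trans in blast)
  define N where "N = (\<integral>x. norm (F x) \<partial>\<mu>)"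
  have N0: "N \<ge> 0" by (simp add: N_def)
  have intF: "integrable \<mu> (\<lambda>x. norm (F x))" using Fb by (intro integrable_bounded[of _ W]) auto
  have NA: "N \<le> W * measure \<mu> (near_end r)"
  proof -
    have "N \<le> (\<integral>x. W * indicat_real (near_end r) x \<partial>\<mu>)"
      unfolding N_def
    proof (rule integral_mono_AE[OF intF])
      show "integrable \<mu> (\<lambda>x. W * indicat_real (near_end r) x)"
        using W_nonneg by (intro integrable_bounded[of _ W]) (auto simp: indicator_def)
      show "AE x in \<mu>. norm (F x) \<le> W * indicat_real (near_end r) x"
        using Fb
      proof eventually_elim
        case (elim x)
        show ?case
        proof (cases "x \<in> near_end r")
          case False
          have "F x = 0"
          proof (cases "active x \<and> proj x \<in> S - T")
            case True
            then have "proj x \<in> S" "dist x (proj x) = dS x" "dist (proj x) e \<le> r"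
              using uniq_proj[of x] T(4) by (auto simp: active_def dist_commute subset_iff)
            then show ?thesis using False near_end_iff[of r x] r by auto
          qed (auto simp: F_def pull_def)
          then show ?thesis using False by simp
        qed (use elim in simp)
      qed
    qed
    also have "\<dots> = W * measure \<mu> (near_end r)" using near_end_sets by (simp add: sets_borel)
    finally show ?thesis .
  qed
  have mA: "measure \<mu> (near_end r) < \<alpha>" using \<delta>1(2)[of r] r rs by simp
  define s0 where "s0 = Q * (r + N)"
  have s0: "s0 > 0" using Q r N0 by (simp add: s0_def)
  obtain b0 :: 'a where b0: "norm b0 = 1" "N / (2 * n) \<le> (\<integral>x. max 0 (F x \<bullet> b0) \<partial>\<mu>)"
    using exists_positive_direction[OF Fm Fb] unfolding N_def n_def by auto
  define T' where "T' = T \<union> closed_segment e' (e' + (r/4) *\<^sub>R b0) \<union> closed_segment p (p + (r/4) *\<^sub>R b1)"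
  have T': "T' \<in> continua_le l" "T' \<subseteq> cball 0 (\<rho> + 3)"
    unfolding T'_def using competitor_admissible[OF T(1-3) e'(1) pT r(1) rs(2) len b0(1) p(3)] by auto
  have T'ne: "T' \<noteq> {}" using e' by (auto simp: T'_def)
  let ?f1 = "\<lambda>x. indicat_real (S - T) (proj x) * (pull x \<bullet> (proj x - e'))"
  let ?f2 = "\<lambda>x. max 0 (F x \<bullet> b0)"
  let ?f3 = "indicat_real (ball e (s0 + 2 * r))"
  let ?R = "\<lambda>x. ?f1 x - (r/4) * ?f2 x + 6 * W * r * ?f3 x + 9 * r\<^sup>2 / (2 * s0) * norm (F x)
     + 9 * K * r\<^sup>2 * indicat_real (near_end r) x - \<kappa> * h * indicat_real X x"
  have f1: "integrable \<mu> ?f1" "(\<integral>x. ?f1 x \<partial>\<mu>) = 0" by (rule field_zero_cut[OF clT e'S])+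
  have f2: "integrable \<mu> ?f2"
  proof (rule integrable_bounded)
    show "AE x in \<mu>. \<bar>max 0 (F x \<bullet> b0)\<bar> \<le> W"
      using Fb
    proof eventually_elim
      case (elim x)
      have "F x \<bullet> b0 \<le> norm (F x)" using norm_cauchy_schwarz[of "F x" b0] b0 by simp
      then show ?case using elim W_nonneg by linarith
    qed
  qed measurable
  have ind: "integrable \<mu> (indicat_real Y)" "(\<integral>x. indicat_real Y x \<partial>\<mu>) = measure \<mu> Y" if "Y \<in> sets borel" for Y
    using that by (auto simp: sets_borel emeasure_eq_measure)
  have "0 \<le> (\<integral>x. \<phi> (infdist x T') - \<phi> (dS x) \<partial>\<mu>)" by (rule increment_nonneg[OF T'])
  also have "\<dots> \<le> (\<integral>x. ?R x \<partial>\<mu>)"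
  proof (rule integral_mono_AE)
    show "integrable \<mu> (\<lambda>x. \<phi> (infdist x T') - \<phi> (dS x))" by (rule integrable_increment[OF T'ne T'(2)])
    show "integrable \<mu> (\<lambda>x. ?R x)"
      using X(1) by (intro Bochner_Integration.integrable_add Bochner_Integration.integrable_diff integrable_mult_right f1 f2 intF ind) auto
    show "AE x in \<mu>. \<phi> (infdist x T') - \<phi> (dS x) \<le> ?R x"
      unfolding F_def
    proof (rule competitor_pointwise)
      show "e' + (r/4) *\<^sub>R b0 \<in> T'" "p + (r/4) *\<^sub>R b1 \<in> T'" "T \<subseteq> T'" by (auto simp: T'_def)
    qed (use clT T e' r rs b0 s0 gain T' in auto)
  qed
  also have "\<dots> = 0 - (r/4) * (\<integral>x. ?f2 x \<partial>\<mu>) + 6 * W * r * measure \<mu> (ball e (s0 + 2 * r)) + 9 * r\<^sup>2 / (2 * s0) * N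
     + 9 * K * r\<^sup>2 * measure \<mu> (near_end r) - \<kappa> * h * measure \<mu> X"
    using f1 f2 intF ind X(1) by (simp add: N_def)
  finally have total: "0 \<le> - (r/4) * (\<integral>x. ?f2 x \<partial>\<mu>) + 6 * W * r * measure \<mu> (ball e (s0 + 2 * r)) + 9 * r\<^sup>2 / (2 * s0) * N
     + 9 * K * r\<^sup>2 * measure \<mu> (near_end r) - \<kappa> * h * measure \<mu> X" by simp
  have e1: "(r/4) * (N / (2 * n)) \<le> (r/4) * (\<integral>x. ?f2 x \<partial>\<mu>)" using b0 r by (intro mult_left_mono) auto
  have e2: "6 * W * r * measure \<mu> (ball e (s0 + 2 * r)) \<le> \<theta> * r * (r + N)"
  proof -
    have "measure \<mu> (near_end r) \<le> s1 / (2 * Q * (W + 1))" using mA by (simp add: \<alpha>_def)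
    then have "W * measure \<mu> (near_end r) \<le> (W + 1) * (s1 / (2 * Q * (W + 1)))"
      using W_nonneg measure_nonneg[of \<mu> "near_end r"] by (intro mult_mono) auto
    then have "Q * N \<le> Q * ((W + 1) * (s1 / (2 * Q * (W + 1))))" using NA Q by (intro mult_left_mono) auto
    also have "\<dots> = s1 / 2"
    proof -
      have "Q * (V * (s1 / (2 * Q * V))) = s1 / 2" if "V > 0" for V using that Q by simp
      from this[of "W + 1"] show ?thesis using W_nonneg Q by linarith
    qed
    finally have "Q * N \<le> s1 / 2" .
    moreover have "(Q + 2) * r \<le> s1 / 4" using rs(5) Q by (simp add: field_simps)
    ultimately have lt: "s0 + 2 * r < s1" using s1(1) by (simp add: s0_def algebra_simps)
    have "measure \<mu> (ball e (s0 + 2 * r)) \<le> \<eta> * (s0 + 2 * r)" using lt s0 r by (intro s1(2)) auto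
    also have "\<dots> \<le> \<eta> * ((Q + 2) * (r + N))"
      using \<eta> N0 by (intro mult_left_mono) (auto simp: s0_def algebra_simps)
    finally have "6 * W * r * measure \<mu> (ball e (s0 + 2 * r)) \<le> 6 * W * r * (\<eta> * ((Q + 2) * (r + N)))"
      using W_nonneg r by (intro mult_left_mono) auto
    also have "\<dots> \<le> 6 * (W + 1) * r * (\<eta> * ((Q + 2) * (r + N)))"
      using W_nonneg r \<eta> Q N0 by (intro mult_right_mono) auto
    also have "\<dots> = (6 * (W + 1) * (Q + 2) * \<eta>) * r * (r + N)" by (simp add: mult_ac)
    also have "6 * (W + 1) * (Q + 2) * \<eta> = \<theta>" unfolding \<eta>_def using W_nonneg Q by simp
    finally show ?thesis .
  qed
  have e2': "\<theta> * r * (r + N) \<le> (\<gamma>/4) * r\<^sup>2 + (1 / (16 * n)) * (r * N)"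
  proof -
    have "\<theta> * r\<^sup>2 \<le> (\<gamma>/4) * r\<^sup>2" using \<theta> by (intro mult_right_mono) auto
    moreover have "\<theta> * (r * N) \<le> (1 / (16 * n)) * (r * N)" using \<theta> r N0 by (intro mult_right_mono) auto
    ultimately show ?thesis by (simp add: distrib_left power2_eq_square mult_ac)
  qed
  have e3: "9 * r\<^sup>2 / (2 * s0) * N \<le> (\<gamma>/4) * r\<^sup>2"
  proof -
    have "N / (r + N) \<le> 1" using r N0 by simp
    have "9 * r\<^sup>2 / (2 * s0) * N = (9 / (2 * Q)) * r\<^sup>2 * (N / (r + N))" by (simp add: s0_def)
    also have "\<dots> \<le> (9 / (2 * Q)) * r\<^sup>2 * 1" using \<open>N / (r + N) \<le> 1\<close> Q by (intro mult_left_mono) auto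
    also have "9 / (2 * Q) = \<gamma> / 4" using \<gamma> by (simp add: Q_def)
    finally show ?thesis by simp
  qed
  have e4: "9 * K * r\<^sup>2 * measure \<mu> (near_end r) \<le> (\<gamma>/4) * r\<^sup>2"
  proof -
    have "measure \<mu> (near_end r) \<le> \<gamma> / (36 * (K + 1))" using mA by (simp add: \<alpha>_def)
    then have "K * measure \<mu> (near_end r) \<le> (K + 1) * (\<gamma> / (36 * (K + 1)))"
      using K_nonneg measure_nonneg[of \<mu> "near_end r"] by (intro mult_mono) auto
    also have "\<dots> = \<gamma> / 36"
    proof -
      have "V * (\<gamma> / (36 * V)) = \<gamma> / 36" if "V > 0" for V using that by simp
      from this[of "K + 1"] show ?thesis using K_nonneg by linarith
    qed
    finally have "9 * r\<^sup>2 * (K * measure \<mu> (near_end r)) \<le> 9 * r\<^sup>2 * (\<gamma> / 36)" by (intro mult_left_mono) auto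
    then show ?thesis by (simp add: mult_ac)
  qed
  have e5: "\<gamma> * r\<^sup>2 \<le> \<kappa> * h * measure \<mu> X"
  proof -
    have "\<gamma> * r\<^sup>2 = \<kappa> * h * (\<kappa> * h)" by (simp add: \<gamma>_def h_def power2_eq_square)
    also have "\<dots> \<le> \<kappa> * h * measure \<mu> X" using X(2) c h by (intro mult_left_mono) auto
    finally show ?thesis .
  qed
  have e6: "(r/4) * (N / (2 * n)) = 2 * ((1 / (16 * n)) * (r * N))" by simp
  have "0 \<le> (1 / (16 * n)) * (r * N)" using n1 r N0 by simp
  moreover have "0 < \<gamma> * r\<^sup>2" using \<gamma> r by simp
  ultimately show False using total e1 e2 e2' e3 e4 e5 e6 by linarith
qed

end

section \<open>Minimizers have atoms\<close>

lemma C11_loc_derivative_continuous: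
  fixes \<phi>' :: "real \<Rightarrow> real"
  assumes "\<And>t. t \<ge> 0 \<Longrightarrow> \<exists>r>0. \<exists>L. L-lipschitz_on (cball t r \<inter> {0..}) \<phi>'"
  shows "continuous_on {0..} \<phi>'"
  unfolding continuous_on_eq_continuous_within
proof
  fix t :: real assume t: "t \<in> {0..}"
  then obtain r L where r: "r > 0" "L-lipschitz_on (cball t r \<inter> {0..}) \<phi>'" using assms[of t] by auto
  have "continuous (at t within cball t r \<inter> {0..}) \<phi>'"
    using lipschitz_on_continuous_on[OF r(2)] r(1) t unfolding continuous_on_eq_continuous_within by auto
  moreover have "at t within cball t r \<inter> {0..} = at t within {0..}"
    by (rule at_within_nhd[of t "ball t r"]) (use r in auto)
  ultimately show "continuous (at t within {0..}) \<phi>'" by simp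
qed

lemma mono_imp_right_derivative_nonneg:
  fixes \<phi> :: "real \<Rightarrow> real"
  assumes der: "(\<phi> has_real_derivative D) (at s within {0..})" and s: "s \<ge> 0"
    and mono: "\<And>t. s \<le> t \<Longrightarrow> \<phi> s \<le> \<phi> t"
  shows "D \<ge> 0"
proof -
  have "(\<phi> has_real_derivative D) (at s within {s<..})"
    by (rule has_field_derivative_subset[OF der]) (use s in auto)
  then have "((\<lambda>y. (\<phi> y - \<phi> s) / (y - s)) \<longlongrightarrow> D) (at_right s)"
    by (simp add: has_field_derivative_iff)
  moreover have "eventually (\<lambda>y. 0 \<le> (\<phi> y - \<phi> s) / (y - s)) (at_right s)"
    unfolding eventually_at_right_field using mono
    by (intro exI[of _ "s + 1"]) (auto intro!: divide_nonneg_nonneg)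
  ultimately show ?thesis by (rule tendsto_lowerbound) simp
qed

text \<open>
  Only difference quotients from the left are used, since the lower bound on the growth is given up to the diameter of
  the support, not beyond.
\<close>
lemma expanding_imp_derivative_pos:
  fixes \<phi> :: "real \<Rightarrow> real"
  assumes der: "(\<phi> has_real_derivative D) (at d within {0..})" and c: "0 < c" "c < d"
    and mono: "\<And>s. c \<le> s \<Longrightarrow> s \<le> d \<Longrightarrow> \<phi> s \<le> \<phi> d"
    and low: "\<And>s. c \<le> s \<Longrightarrow> s \<le> d \<Longrightarrow> m * \<bar>s - d\<bar> \<le> \<bar>\<phi> s - \<phi> d\<bar>"
  shows "m \<le> D"
proof -
  have "at d within {0..} = at d" by (rule at_within_open_subset[of d "{0<..}"]) (use c in auto)
  then have "(\<phi> has_real_derivative D) (at d)" using der by simp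
  then have "(\<phi> has_real_derivative D) (at d within {..<d})" by (rule has_field_derivative_at_within)
  then have "((\<lambda>y. (\<phi> y - \<phi> d) / (y - d)) \<longlongrightarrow> D) (at_left d)"
    by (simp add: has_field_derivative_iff)
  moreover have "eventually (\<lambda>y. m \<le> (\<phi> y - \<phi> d) / (y - d)) (at_left d)"
    unfolding eventually_at_left_field
  proof (intro exI[of _ c] conjI allI impI)
    fix y assume y: "c < y" "y < d"
    have "m * (d - y) \<le> \<phi> d - \<phi> y" using low[of y] mono[of y] y by simp
    then have "m \<le> (\<phi> d - \<phi> y) / (d - y)" using y by (simp add: pos_le_divide_eq)
    then show "m \<le> (\<phi> y - \<phi> d) / (y - d)" by (metis minus_diff_eq minus_divide_divide)
  qed (rule c(2))
  ultimately show ?thesis by (rule tendsto_lowerbound) simp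
qed

text \<open>
  If the weight vanished almost everywhere, almost all points would be farther from \<open>S\<close> than the diameter of the support, and any
  single point of the support would be a better competitor.
\<close>
lemma (in avg_dist_minimizer) weight_nontrivial:
  assumes strict: "\<And>s t. 0 \<le> s \<Longrightarrow> s < t \<Longrightarrow> \<phi> s < \<phi> t" and l: "l \<ge> 0"
    and supp: "compact (measure_support \<mu>)" "measure_support \<mu> \<subseteq> cball 0 \<rho>"
    and pos: "\<And>d. 0 < d \<Longrightarrow> d \<le> diameter (measure_support \<mu>) \<Longrightarrow> \<phi>' d \<noteq> 0"
  shows "\<not> (AE x in \<mu>. weight x = 0)"
proof
  assume zero: "AE x in \<mu>. weight x = 0"
  have AEs: "AE x in \<mu>. x \<in> measure_support \<mu>" by (rule AE_in_measure_support[OF sets_borel])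
  have "measure_support \<mu> \<noteq> {}"
  proof
    assume "measure_support \<mu> = {}"
    then have "AE x in \<mu>. False" using AEs by simp
    then show False by (simp only: AE_False)
  qed
  then obtain y where y: "y \<in> measure_support \<mu>" by auto
  let ?f = "\<lambda>x. \<phi> (infdist x {y}) - \<phi> (infdist x S)"
  have "{y} \<in> continua_le l" by (simp add: continua_le_def hausdorff1_singleton)
  moreover have yb: "{y} \<subseteq> cball 0 (\<rho> + 3)" using supp(2) y by auto
  ultimately have inc: "0 \<le> (\<integral>x. ?f x \<partial>\<mu>)" by (rule increment_nonneg)
  have int: "integrable \<mu> (\<lambda>x. ?f x)"
    by (rule integrable_increment[OF _ yb]) simp
  have neg: "AE x in \<mu>. ?f x < 0"
    using zero AEs AE_notin
  proof eventually_elim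
    case (elim x)
    have "infdist x S > 0" using elim infdist_pos_iff by blast
    then have "diameter (measure_support \<mu>) < infdist x S" using pos[of "infdist x S"] elim by (force simp: weight_def)
    moreover have "dist x y \<le> diameter (measure_support \<mu>)"
      using elim y supp(1) by (intro diameter_bounded_bound compact_imp_bounded)
    ultimately show ?case using strict[of "dist x y" "infdist x S"] by simp
  qed
  let ?g = "\<lambda>x. \<phi> (infdist x S) - \<phi> (infdist x {y})"
  have "(\<integral>x. ?g x \<partial>\<mu>) = (\<integral>x. - (?f x) \<partial>\<mu>)" by simp
  also have "\<dots> = - (\<integral>x. ?f x \<partial>\<mu>)" by (rule integral_minus)
  finally have le: "(\<integral>x. ?g x \<partial>\<mu>) \<le> 0" using inc by simp
  have intg: "integrable \<mu> ?g" using Bochner_Integration.integrable_minus[OF int] by simp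
  have nn: "AE x in \<mu>. 0 \<le> ?g x" using neg by eventually_elim simp
  have "(\<integral>x. ?g x \<partial>\<mu>) = 0" using le integral_nonneg_AE[OF nn] by simp
  then have "AE x in \<mu>. ?g x = 0" using integral_nonneg_eq_0_iff_AE[OF intg nn] by simp
  then have "AE x in \<mu>. False" using neg by eventually_elim simp
  then show False by (simp only: AE_False)
qed

lemma average_distance_minimizer_has_atom:
  fixes \<mu> :: "'a::euclidean_space measure" and \<phi> :: "real \<Rightarrow> real"
  assumes prob: "prob_space \<mu>" and borel: "sets \<mu> = sets borel"
    and supp: "compact (measure_support \<mu>)"
    and phi_C11: "C11_loc \<phi>"
    and phi_mono: "strict_mono_on {0..} \<phi>"
    and phi_lower: "\<And>c. c > 0 \<Longrightarrow>
          \<exists>m>0. \<forall>s\<in>{c..diameter (measure_support \<mu>)}. \<forall>t\<in>{c..diameter (measure_support \<mu>)}.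
            \<bar>\<phi> s - \<phi> t\<bar> \<ge> m * \<bar>s - t\<bar>"
    and small: "\<And>x. (\<lambda>\<epsilon>. measure \<mu> (ball x \<epsilon>)) \<in> o[at_right 0](\<lambda>\<epsilon>. \<epsilon>)"
    and l_pos: "l > 0"
    and adm: "S \<in> continua_le l"
    and minim: "\<And>S'. S' \<in> continua_le l \<Longrightarrow> avg_dist \<mu> \<phi> S \<le> avg_dist \<mu> \<phi> S'"
  shows "\<exists>\<sigma>\<in>S. measure \<mu> {x. infdist x S = dist x \<sigma>} > 0"
proof -
  interpret prob_space \<mu> by fact
  have sp: "space \<mu> = UNIV" using sets_eq_imp_space_eq[OF borel] by simp
  have S: "S \<noteq> {}" "compact S" "connected S" "hausdorff1 S \<le> ennreal l" using adm by (auto simp: continua_le_def)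
  obtain b where b: "b \<in> S" using S by auto
  show ?thesis
  proof (cases "S = {b}")
    case True
    then show ?thesis using prob_space sp by simp
  next
    case False
    have "hausdorff1 S < top" using S(4) by (simp add: order_le_less_trans)
    then obtain e where e: "e \<in> S" and ends: "small_end S e"
      using exists_small_end[OF S(2,3) _ b False] by metis
    have "measure \<mu> {x. infdist x S = dist x e} > 0"
    proof (rule ccontr)
      assume "\<not> ?thesis"
      then have null: "measure \<mu> {x. infdist x S = dist x e} = 0" using measure_nonneg[of \<mu>] by (simp add: not_less order_antisym)
      obtain \<phi>' where der: "\<And>t. t \<ge> 0 \<Longrightarrow> (\<phi> has_real_derivative \<phi>' t) (at t within {0..})"
        and lip: "\<And>t. t \<ge> 0 \<Longrightarrow> \<exists>r>0. \<exists>L. L-lipschitz_on (cball t r \<inter> {0..}) \<phi>'"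
        using phi_C11 by (auto simp: C11_loc_def)
      have "bounded (measure_support \<mu> \<union> S)" using supp S by (simp add: compact_imp_bounded)
      then obtain \<rho> where \<rho>: "\<And>x. x \<in> measure_support \<mu> \<union> S \<Longrightarrow> norm x \<le> \<rho>" by (auto simp: bounded_iff)
      have \<rho>0: "\<rho> \<ge> 0" using \<rho>[of e] e norm_ge_zero[of e] by (intro order_trans[of 0 "norm e" \<rho>]) auto
      define D where "D = 2 * \<rho> + 3"
      obtain K where K: "K \<ge> 0"
        "\<And>s t. s \<in> {0..D} \<Longrightarrow> t \<in> {0..D} \<Longrightarrow> \<bar>\<phi> t - \<phi> s - \<phi>' s * (t - s)\<bar> \<le> K * (t - s)\<^sup>2"
        "\<And>s t. s \<in> {0..D} \<Longrightarrow> t \<in> {0..D} \<Longrightarrow> \<bar>\<phi>' s - \<phi>' t\<bar> \<le> K * \<bar>s - t\<bar>"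
        using C11_loc_uniform[OF der lip, of D] by blast
      define W where "W = \<bar>\<phi>' 0\<bar> + 2 * K * D"
      have D0: "D \<ge> 0" using \<rho>0 by (simp add: D_def)
      have strict: "\<phi> s < \<phi> t" if "0 \<le> s" "s < t" for s t
        using phi_mono that by (auto simp: strict_mono_on_def)
      have mono: "\<phi> s \<le> \<phi> t" if "0 \<le> s" "s \<le> t" for s t
        using strict[of s t] that by (cases "s = t") auto
      have upper: "\<phi>' s \<le> \<bar>\<phi>' 0\<bar> + K * D" if "s \<in> {0..D}" for s
      proof -
        have "\<bar>\<phi>' s - \<phi>' 0\<bar> \<le> K * \<bar>s - 0\<bar>" using that D0 by (intro K(3)) auto
        also have "\<dots> \<le> K * D" using that K(1) by (intro mult_left_mono) auto
        finally show ?thesis by linarith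
      qed
      have KD: "0 \<le> K * D" using K(1) D0 by simp
      interpret avg_dist_minimizer \<mu> \<phi> \<phi>' S l \<rho> K W
      proof
        show "sets \<mu> = sets borel" by (rule borel)
        show "AE x in \<mu>. norm x \<le> \<rho>" using AE_in_measure_support[OF borel] \<rho> by (auto elim: eventually_mono)
        show "S \<subseteq> cball 0 \<rho>" using \<rho> by auto
        show "\<phi> s \<le> \<phi> t" if "0 \<le> s" "s \<le> t" for s t by (rule mono[OF that])
        show "(\<phi> has_real_derivative \<phi>' t) (at t within {0..})" if "0 \<le> t" for t by (rule der[OF that])
        show "K \<ge> 0" by (rule K(1))
        show taylor: "\<phi> t - \<phi> s \<le> \<phi>' s * (t - s) + K * (t - s)\<^sup>2" if "s \<in> {0..2*\<rho>+3}" "t \<in> {0..2*\<rho>+3}" for s t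
          using K(2)[of s t] that by (simp add: D_def)
        show "\<phi> t - \<phi> s \<le> W * (t - s)" if st: "0 \<le> s" "s \<le> t" "t \<le> 2*\<rho>+3" for s t
        proof -
          have "\<phi> t - \<phi> s \<le> \<phi>' s * (t - s) + K * (t - s)\<^sup>2" using st by (intro taylor) auto
          also have "K * (t - s)\<^sup>2 = (K * (t - s)) * (t - s)" by (simp add: power2_eq_square)
          also have "\<phi>' s * (t - s) + (K * (t - s)) * (t - s) \<le> (\<bar>\<phi>' 0\<bar> + K * D) * (t - s) + (K * D) * (t - s)"
            using st upper[of s] K(1) by (intro add_mono mult_right_mono mult_left_mono) (auto simp: D_def)
          also have "\<dots> = W * (t - s)" by (simp add: W_def algebra_simps)
          finally show ?thesis .
        qed
        show "0 \<le> \<phi>' s \<and> \<phi>' s \<le> W" if "s \<in> {0..2*\<rho>+3}" for s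
        proof
          show "0 \<le> \<phi>' s" by (rule mono_imp_right_derivative_nonneg[OF der]) (use that mono in auto)
          show "\<phi>' s \<le> W" using upper[of s] that KD by (simp add: W_def D_def)
        qed
        show "continuous_on {0..} \<phi>'" by (rule C11_loc_derivative_continuous[OF lip])
        show "S \<in> continua_le l" by (rule adm)
        show "avg_dist \<mu> \<phi> S \<le> avg_dist \<mu> \<phi> T" if "T \<in> continua_le l" for T by (rule minim[OF that])
        have "emeasure \<mu> S = 0"
          using S l_pos by (intro small_balls_imp_null_on_finite_length[OF borel finite_measure_axioms small S(4)])
            (auto intro: borel_compact)
        then show "AE x in \<mu>. x \<notin> S" using S(2) by (intro AE_not_in) (auto simp: null_sets_def borel intro: borel_compact)
      qed
      interpret avg_dist_minimizer_end \<mu> \<phi> \<phi>' S l \<rho> K W e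
      proof
        show "AE x in \<mu>. infdist x S \<noteq> dist x e"
        proof -
          have "closed {x. infdist x S = dist x e}" by (intro closed_Collect_eq continuous_intros)
          then have "{x. infdist x S = dist x e} \<in> null_sets \<mu>"
            using null by (simp add: null_sets_def borel emeasure_eq_measure)
          then show ?thesis using AE_not_in by fastforce
        qed
      qed (use l_pos e ends in auto)
      have pos: "\<phi>' d \<noteq> 0" if d: "0 < d" "d \<le> diameter (measure_support \<mu>)" for d
      proof -
        obtain m where m: "m > 0" "\<forall>s\<in>{d/2..diameter (measure_support \<mu>)}. \<forall>t\<in>{d/2..diameter (measure_support \<mu>)}.
            \<bar>\<phi> s - \<phi> t\<bar> \<ge> m * \<bar>s - t\<bar>" using phi_lower[of "d/2"] d by auto
        have "m \<le> \<phi>' d"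
        proof (rule expanding_imp_derivative_pos[OF der, of d "d/2"])
          show "m * \<bar>s - d\<bar> \<le> \<bar>\<phi> s - \<phi> d\<bar>" if "d/2 \<le> s" "s \<le> d" for s
            by (rule bspec[OF bspec[OF m(2)]]) (use that d in auto)
        qed (use d mono in auto)
        then show ?thesis using m(1) by simp
      qed
      have "\<not> (AE x in \<mu>. weight x = 0)"
        by (rule weight_nontrivial[OF strict _ supp _ pos]) (use l_pos \<rho> in auto)
      then show False using not_atomless_end[OF _ small] by blast
    qed
    then show ?thesis using e by blast
  qed
qed

theorem theorem1p6:
  fixes \<mu> :: "(real ^ 'n) measure"
    and \<phi> :: "real \<Rightarrow> real"
    and l :: real
    and \<Sigma> :: "(real ^ 'n) set"
  assumes dim: "CARD('n) \<ge> 2"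
    and prob: "prob_space \<mu>" and borel: "sets \<mu> = sets borel"
    and supp: "compact (measure_support \<mu>)"
    and phi0: "\<phi> 0 = 0"
    and phi_C11: "C11_loc \<phi>"
    and phi_mono: "strict_mono_on {0..} \<phi>"
    and phi_lower: "\<And>c. c > 0 \<Longrightarrow>
          \<exists>m>0. \<forall>s\<in>{c..diameter (measure_support \<mu>)}. \<forall>t\<in>{c..diameter (measure_support \<mu>)}.
            \<bar>\<phi> s - \<phi> t\<bar> \<ge> m * \<bar>s - t\<bar>"
    and small: "\<And>x. (\<lambda>\<epsilon>. measure \<mu> (ball x \<epsilon>)) \<in> o[at_right 0](\<lambda>\<epsilon>. \<epsilon>)"
    and l_pos: "l > 0"
    and adm: "\<Sigma> \<in> continua_le l"
    and minim: "\<And>\<Sigma>'. \<Sigma>' \<in> continua_le l \<Longrightarrow> avg_dist \<mu> \<phi> \<Sigma> \<le> avg_dist \<mu> \<phi> \<Sigma>'"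
  shows "\<exists>\<sigma>\<in>\<Sigma>. measure \<mu> {x. infdist x \<Sigma> = dist x \<sigma>} > 0"
  by (rule average_distance_minimizer_has_atom) (fact assms)+

end
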